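(* Let $M$ be a monoid, let $X$ be a set, and let $R$ be a set of admissible identities over $X^*$. Let $\psi_R\colon \mathcal{FR}_R(M)\to\mathcal{FI}_R(M)$ be the morphism of restriction monoids determined by $\psi_R(\lfloor m\rfloor)=[m]$ for all $m\in M$. The following statements are equivalent: (1) $M$ embeds into a group; (2) the morphism $\psi_R$ is injective.
   Context: Restriction monoids. A restriction semigroup is an algebra $(S;\cdot,{}^*,{}^+)$ with $(S;\cdot)$ a semigroup satisfying $x^+x=x$, $x^+y^+=y^+x^+$, $(x^+y)^+=x^+y^+$, $xy^+=(xy)^+x$; $xx^*=x$, $x^*y^*=y^*x^*$, $(xy^* )^*=x^*y^*$, $x^*y=y(xy)^*$; $(x^+)^*=x^+$, $(x^* )^+=x^*$. A restriction monoid is a restriction semigroup with an identity element, in signature $(\cdot,{}^*,{}^+,1)$; morphisms preserve all operations. Every inverse monoid is a restriction monoid with $s^*=s^{-1}s$, $s^+=ss^{-1}$. Identities. $X^*$ is the free monoid on a set $X$ (empty word $\lambda$), and $FR(X^* )$ is the free restriction monoid on the set $X^*$ (its product is written $\cdot$, its identity is $1\neq\lambda$; the generator $uv$ is different from the product $u\cdot v$). For a map $f\colon X\to M$ into a monoid, with monoid-morphism extension $\widehat f\colon X^*\to M$, and a map $\gamma\colon M\to S$ into a restriction monoid, the value $[p]_{\gamma,f}\in S$ of $p\in FR(X^* )$ is the image of $p$ under the morphism $FR(X^* )\to S$ sending each generator $u\in X^*$ to $\gamma(\widehat f(u))$. An identity over $X^*$ is an equality $p=q$ with $p,q\in FR(X^*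 )$; $\gamma$ satisfies it if $[p]_{\gamma,f}=[q]_{\gamma,f}$ for all $f\colon X\to M$. An identity is admissible if every monoid morphism from a monoid to a restriction monoid (i.e. map preserving $1$ and products) satisfies it. Free objects. $\mathcal{FR}_R(M)$ is the restriction monoid generated by the set $\{\lfloor m\rfloor:m\in M\}$ subject to the relations $\lfloor 1\rfloor=1$, $\lfloor m\rfloor\lfloor n\rfloor=\lfloor mn\rfloor(\lfloor m\rfloor\lfloor n\rfloor)^*$ ($m,n\in M$), and $[p]_{\iota,f}=[q]_{\iota,f}$ for all identities $p=q$ in $R$ and all $f\colon X\to M$, where $\iota(m)=\lfloor m\rfloor$. $\mathcal{FI}_R(M)$ is the inverse monoid generated by the set $\{[m]:m\in M\}$ subject to the relations $[1]=1$, $[m][n]=[mn]([m][n])^*$, and $[p]_{\iota,f}=[q]_{\iota,f}$ for all $p=q$ in $R$ and all $f\colon X\to M$, where $\iota(m)=[m]$. The defining relations of $\mathcal{FR}_R(M)$ hold in $\mathcal{FI}_R(M)$, so $\psi_R$ exists and is unique. *)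

theory Defs
  imports "HOL-Algebra.Group"
begin

section \<open>Restriction monoids\<close>

record 'a restriction = "'a monoid" +
  rstar :: "'a \<Rightarrow> 'a" ("_\<^sup>\<star>\<index>" [1000] 999)
  rplus :: "'a \<Rightarrow> 'a" ("_\<^sup>\<oplus>\<index>" [1000] 999)

locale restriction_algebra =
  fixes S (structure)
  assumes mult_closed [intro, simp]:
      "\<lbrakk>x \<in> carrier S; y \<in> carrier S\<rbrakk> \<Longrightarrow> x \<otimes> y \<in> carrier S"
    and unit_closed [intro, simp]: "\<one> \<in> carrier S"
    and star_closed [intro, simp]: "x \<in> carrier S \<Longrightarrow> x\<^sup>\<star> \<in> carrier S"
    and plus_closed [intro, simp]: "x \<in> carrier S \<Longrightarrow> x\<^sup>\<oplus> \<in> carrier S"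

locale restriction_monoid = restriction_algebra S + monoid S for S (structure) +
  assumes plus_mult_self: "x \<in> carrier S \<Longrightarrow> x\<^sup>\<oplus> \<otimes> x = x"
    and plus_comm:
      "\<lbrakk>x \<in> carrier S; y \<in> carrier S\<rbrakk> \<Longrightarrow> x\<^sup>\<oplus> \<otimes> y\<^sup>\<oplus> = y\<^sup>\<oplus> \<otimes> x\<^sup>\<oplus>"
    and plus_mult_plus:
      "\<lbrakk>x \<in> carrier S; y \<in> carrier S\<rbrakk> \<Longrightarrow> (x\<^sup>\<oplus> \<otimes> y)\<^sup>\<oplus> = x\<^sup>\<oplus> \<otimes> y\<^sup>\<oplus>"
    and mult_plus:
      "\<lbrakk>x \<in> carrier S; y \<in> carrier S\<rbrakk> \<Longrightarrow> x \<otimes> y\<^sup>\<oplus> = (x \<otimes> y)\<^sup>\<oplus> \<otimes> x"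
    and mult_star_self: "x \<in> carrier S \<Longrightarrow> x \<otimes> x\<^sup>\<star> = x"
    and star_comm:
      "\<lbrakk>x \<in> carrier S; y \<in> carrier S\<rbrakk> \<Longrightarrow> x\<^sup>\<star> \<otimes> y\<^sup>\<star> = y\<^sup>\<star> \<otimes> x\<^sup>\<star>"
    and mult_star_star:
      "\<lbrakk>x \<in> carrier S; y \<in> carrier S\<rbrakk> \<Longrightarrow> (x \<otimes> y\<^sup>\<star>)\<^sup>\<star> = x\<^sup>\<star> \<otimes> y\<^sup>\<star>"
    and star_mult:
      "\<lbrakk>x \<in> carrier S; y \<in> carrier S\<rbrakk> \<Longrightarrow> x\<^sup>\<star> \<otimes> y = y \<otimes> (x \<otimes> y)\<^sup>\<star>"
    and plus_star: "x \<in> carrier S \<Longrightarrow> (x\<^sup>\<oplus>)\<^sup>\<star> = x\<^sup>\<oplus>"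
    and star_plus: "x \<in> carrier S \<Longrightarrow> (x\<^sup>\<star>)\<^sup>\<oplus> = x\<^sup>\<star>"

definition monoid_hom ::
    "('a, 'c) monoid_scheme \<Rightarrow> ('b, 'd) monoid_scheme \<Rightarrow> ('a \<Rightarrow> 'b) set" where
  "monoid_hom M N = {h \<in> hom M N. h \<one>\<^bsub>M\<^esub> = \<one>\<^bsub>N\<^esub>}"

definition restriction_hom ::
    "('a, 'c) restriction_scheme \<Rightarrow> ('b, 'd) restriction_scheme \<Rightarrow> ('a \<Rightarrow> 'b) set" where
  "restriction_hom S T = {h \<in> monoid_hom S T. \<forall>x\<in>carrier S.
     h (x\<^sup>\<star>\<^bsub>S\<^esub>) = (h x)\<^sup>\<star>\<^bsub>T\<^esub> \<and> h (x\<^sup>\<oplus>\<^bsub>S\<^esub>) = (h x)\<^sup>\<oplus>\<^bsub>T\<^esub>}"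

section \<open>Congruences and quotients\<close>

inductive_set monoid_cong :: "('a, 'c) monoid_scheme \<Rightarrow> ('a \<times> 'a) set \<Rightarrow> ('a \<times> 'a) set"
  for M (structure) and r where
  base: "\<lbrakk>(x, y) \<in> r; x \<in> carrier M; y \<in> carrier M\<rbrakk> \<Longrightarrow> (x, y) \<in> monoid_cong M r"
| refl: "x \<in> carrier M \<Longrightarrow> (x, x) \<in> monoid_cong M r"
| sym: "(x, y) \<in> monoid_cong M r \<Longrightarrow> (y, x) \<in> monoid_cong M r"
| trans: "\<lbrakk>(x, y) \<in> monoid_cong M r; (y, z) \<in> monoid_cong M r\<rbrakk>
    \<Longrightarrow> (x, z) \<in> monoid_cong M r"
| mult: "\<lbrakk>(x, x') \<in> monoid_cong M r; (y, y') \<in> monoid_cong M r\<rbrakk>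
    \<Longrightarrow> (x \<otimes> y, x' \<otimes> y') \<in> monoid_cong M r"

inductive_set restriction_cong ::
    "('a, 'c) restriction_scheme \<Rightarrow> ('a \<times> 'a) set \<Rightarrow> ('a \<times> 'a) set"
  for S (structure) and r where
  base: "\<lbrakk>(x, y) \<in> r; x \<in> carrier S; y \<in> carrier S\<rbrakk> \<Longrightarrow> (x, y) \<in> restriction_cong S r"
| refl: "x \<in> carrier S \<Longrightarrow> (x, x) \<in> restriction_cong S r"
| sym: "(x, y) \<in> restriction_cong S r \<Longrightarrow> (y, x) \<in> restriction_cong S r"
| trans: "\<lbrakk>(x, y) \<in> restriction_cong S r; (y, z) \<in> restriction_cong S r\<rbrakk>
    \<Longrightarrow> (x, z) \<in> restriction_cong S r"
| mult: "\<lbrakk>(x, x') \<in> restriction_cong S r; (y, y') \<in> restriction_cong S r\<rbrakk>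
    \<Longrightarrow> (x \<otimes> y, x' \<otimes> y') \<in> restriction_cong S r"
| star: "(x, y) \<in> restriction_cong S r \<Longrightarrow> (x\<^sup>\<star>, y\<^sup>\<star>) \<in> restriction_cong S r"
| plus: "(x, y) \<in> restriction_cong S r \<Longrightarrow> (x\<^sup>\<oplus>, y\<^sup>\<oplus>) \<in> restriction_cong S r"

definition quot_monoid :: "('a, 'c) monoid_scheme \<Rightarrow> ('a \<times> 'a) set \<Rightarrow> 'a set monoid" where
  "quot_monoid M E =
    \<lparr>carrier = carrier M // E,
     mult = \<lambda>A B. \<Union>x\<in>A. \<Union>y\<in>B. E `` {x \<otimes>\<^bsub>M\<^esub> y},
     one = E `` {\<one>\<^bsub>M\<^esub>}\<rparr>"

definition quot_restriction ::
    "('a, 'c) restriction_scheme \<Rightarrow> ('a \<times> 'a) set \<Rightarrow> 'a set restriction" where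
  "quot_restriction S E =
    \<lparr>carrier = carrier S // E,
     mult = \<lambda>A B. \<Union>x\<in>A. \<Union>y\<in>B. E `` {x \<otimes>\<^bsub>S\<^esub> y},
     one = E `` {\<one>\<^bsub>S\<^esub>},
     rstar = \<lambda>A. \<Union>x\<in>A. E `` {x\<^sup>\<star>\<^bsub>S\<^esub>},
     rplus = \<lambda>A. \<Union>x\<in>A. E `` {x\<^sup>\<oplus>\<^bsub>S\<^esub>}\<rparr>"

section \<open>Free restriction monoids\<close>

datatype (rgens: 'a) rterm =
  RGen 'a | ROne | RMult "'a rterm" "'a rterm" | RStar "'a rterm" | RPlus "'a rterm"

definition term_algebra :: "'a set \<Rightarrow> 'a rterm restriction" where
  "term_algebra A =
    \<lparr>carrier = {t. rgens t \<subseteq> A}, mult = RMult, one = ROne, rstar = RStar, rplus = RPlus\<rparr>"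

text \<open>All instances, in an algebra of the right signature, of the defining equations of
  restriction monoids; \<open>restriction_monoid_iff_laws\<close> below says that these are the axioms of
  \<open>restriction_monoid\<close>.\<close>

inductive_set restriction_laws :: "('a, 'c) restriction_scheme \<Rightarrow> ('a \<times> 'a) set"
  for S (structure) where
  "\<lbrakk>x \<in> carrier S; y \<in> carrier S; z \<in> carrier S\<rbrakk>
    \<Longrightarrow> ((x \<otimes> y) \<otimes> z, x \<otimes> (y \<otimes> z)) \<in> restriction_laws S"
| "x \<in> carrier S \<Longrightarrow> (\<one> \<otimes> x, x) \<in> restriction_laws S"
| "x \<in> carrier S \<Longrightarrow> (x \<otimes> \<one>, x) \<in> restriction_laws S"
| "x \<in> carrier S \<Longrightarrow> (x\<^sup>\<oplus> \<otimes> x, x) \<in> restriction_laws S"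
| "\<lbrakk>x \<in> carrier S; y \<in> carrier S\<rbrakk>
    \<Longrightarrow> (x\<^sup>\<oplus> \<otimes> y\<^sup>\<oplus>, y\<^sup>\<oplus> \<otimes> x\<^sup>\<oplus>) \<in> restriction_laws S"
| "\<lbrakk>x \<in> carrier S; y \<in> carrier S\<rbrakk>
    \<Longrightarrow> ((x\<^sup>\<oplus> \<otimes> y)\<^sup>\<oplus>, x\<^sup>\<oplus> \<otimes> y\<^sup>\<oplus>) \<in> restriction_laws S"
| "\<lbrakk>x \<in> carrier S; y \<in> carrier S\<rbrakk>
    \<Longrightarrow> (x \<otimes> y\<^sup>\<oplus>, (x \<otimes> y)\<^sup>\<oplus> \<otimes> x) \<in> restriction_laws S"
| "x \<in> carrier S \<Longrightarrow> (x \<otimes> x\<^sup>\<star>, x) \<in> restriction_laws S"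
| "\<lbrakk>x \<in> carrier S; y \<in> carrier S\<rbrakk>
    \<Longrightarrow> (x\<^sup>\<star> \<otimes> y\<^sup>\<star>, y\<^sup>\<star> \<otimes> x\<^sup>\<star>) \<in> restriction_laws S"
| "\<lbrakk>x \<in> carrier S; y \<in> carrier S\<rbrakk>
    \<Longrightarrow> ((x \<otimes> y\<^sup>\<star>)\<^sup>\<star>, x\<^sup>\<star> \<otimes> y\<^sup>\<star>) \<in> restriction_laws S"
| "\<lbrakk>x \<in> carrier S; y \<in> carrier S\<rbrakk>
    \<Longrightarrow> (x\<^sup>\<star> \<otimes> y, y \<otimes> (x \<otimes> y)\<^sup>\<star>) \<in> restriction_laws S"
| "x \<in> carrier S \<Longrightarrow> ((x\<^sup>\<oplus>)\<^sup>\<star>, x\<^sup>\<oplus>) \<in> restriction_laws S"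
| "x \<in> carrier S \<Longrightarrow> ((x\<^sup>\<star>)\<^sup>\<oplus>, x\<^sup>\<star>) \<in> restriction_laws S"

abbreviation term_cong :: "'a set \<Rightarrow> ('a rterm \<times> 'a rterm) set" where
  "term_cong A \<equiv> restriction_cong (term_algebra A) (restriction_laws (term_algebra A))"

definition free_restriction :: "'a set \<Rightarrow> 'a rterm set restriction" where
  "free_restriction A = quot_restriction (term_algebra A) (term_cong A)"

definition free_gen :: "'a set \<Rightarrow> 'a \<Rightarrow> 'a rterm set" where
  "free_gen A a = term_cong A `` {RGen a}"

primrec reval :: "('s, 'c) restriction_scheme \<Rightarrow> ('a \<Rightarrow> 's) \<Rightarrow> 'a rterm \<Rightarrow> 's" where
  "reval S g (RGen a) = g a"
| "reval S g ROne = \<one>\<^bsub>S\<^esub>"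
| "reval S g (RMult s t) = reval S g s \<otimes>\<^bsub>S\<^esub> reval S g t"
| "reval S g (RStar t) = (reval S g t)\<^sup>\<star>\<^bsub>S\<^esub>"
| "reval S g (RPlus t) = (reval S g t)\<^sup>\<oplus>\<^bsub>S\<^esub>"

text \<open>The morphism out of a free restriction monoid that extends \<open>g\<close>: all terms in a class have
  the same value (\<open>free_extend_hom\<close>, \<open>free_extend_gen\<close>, \<open>free_restriction_hom_unique\<close>).\<close>

definition free_extend ::
    "('s, 'c) restriction_scheme \<Rightarrow> ('a \<Rightarrow> 's) \<Rightarrow> 'a rterm set \<Rightarrow> 's" where
  "free_extend S g p = the_elem (reval S g ` p)"

section \<open>Identities\<close>

definition word_value :: "('m, 'c) monoid_scheme \<Rightarrow> ('x \<Rightarrow> 'm) \<Rightarrow> 'x list \<Rightarrow> 'm" where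
  "word_value M f u = foldr (mult M) (map f u) \<one>\<^bsub>M\<^esub>"

text \<open>\<open>[p]\<^bsub>\<gamma>,f\<^esub>\<close> for \<open>f : X \<rightarrow> M\<close>, \<open>\<gamma> : M \<rightarrow> S\<close> and \<open>p\<close> in the free restriction monoid on the
  set \<open>lists X\<close>; the empty word is a generator of the latter, different from its unit.\<close>

definition identity_value ::
    "('m, 'c) monoid_scheme \<Rightarrow> ('s, 'd) restriction_scheme \<Rightarrow> ('m \<Rightarrow> 's) \<Rightarrow> ('x \<Rightarrow> 'm)
      \<Rightarrow> 'x list rterm set \<Rightarrow> 's" where
  "identity_value M S \<gamma> f p = free_extend S (\<lambda>u. \<gamma> (word_value M f u)) p"

definition satisfies ::
    "'x set \<Rightarrow> ('m, 'c) monoid_scheme \<Rightarrow> ('s, 'd) restriction_scheme \<Rightarrow> ('m \<Rightarrow> 's)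
      \<Rightarrow> 'x list rterm set \<times> 'x list rterm set \<Rightarrow> bool" where
  "satisfies X M S \<gamma> e \<longleftrightarrow>
    (\<forall>f \<in> X \<rightarrow> carrier M. identity_value M S \<gamma> f (fst e) = identity_value M S \<gamma> f (snd e))"

definition is_identity :: "'x set \<Rightarrow> 'x list rterm set \<times> 'x list rterm set \<Rightarrow> bool" where
  "is_identity X e \<longleftrightarrow>
    fst e \<in> carrier (free_restriction (lists X)) \<and> snd e \<in> carrier (free_restriction (lists X))"

text \<open>HOL formulas cannot quantify over types, so the monoids and restriction monoids below live
  on two fixed types. These are large enough: \<open>admissible_satisfies\<close> gives the
  same for monoids and restriction monoids on arbitrary types.\<close>

definition admissible :: "'x set \<Rightarrow> 'x list rterm set \<times> 'x list rterm set \<Rightarrow> bool" where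
  "admissible X e \<longleftrightarrow> is_identity X e \<and>
    (\<forall>(N :: 'x list monoid) (S :: 'x list rterm set restriction) \<phi>.
      monoid N \<longrightarrow> restriction_monoid S \<longrightarrow> \<phi> \<in> monoid_hom N S \<longrightarrow> satisfies X N S \<phi> e)"

section \<open>Inverse monoids\<close>

locale inverse_monoid = monoid S for S (structure) +
  assumes ex1_inverse:
    "x \<in> carrier S \<Longrightarrow> \<exists>!y. y \<in> carrier S \<and> x \<otimes> y \<otimes> x = x \<and> y \<otimes> x \<otimes> y = y"

definition winv :: "('a, 'c) monoid_scheme \<Rightarrow> 'a \<Rightarrow> 'a" where
  "winv S x = (THE y. y \<in> carrier S \<and> x \<otimes>\<^bsub>S\<^esub> y \<otimes>\<^bsub>S\<^esub> x = x \<and> y \<otimes>\<^bsub>S\<^esub> x \<otimes>\<^bsub>S\<^esub> y = y)"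

definition inverse_restriction :: "('a, 'c) monoid_scheme \<Rightarrow> 'a restriction" where
  "inverse_restriction S =
    \<lparr>carrier = carrier S, mult = mult S, one = one S,
     rstar = \<lambda>x. winv S x \<otimes>\<^bsub>S\<^esub> x, rplus = \<lambda>x. x \<otimes>\<^bsub>S\<^esub> winv S x\<rparr>"

text \<open>The free inverse monoid as the quotient of the free monoid with involution by the Wagner
  congruence; \<open>(a, True)\<close> stands for the letter \<open>a\<close> and \<open>(a, False)\<close> for its formal inverse.\<close>

definition signed_words :: "'a set \<Rightarrow> ('a \<times> bool) list monoid" where
  "signed_words A = \<lparr>carrier = lists (A \<times> UNIV), mult = (@), one = []\<rparr>"

definition word_inv :: "('a \<times> bool) list \<Rightarrow> ('a \<times> bool) list" where
  "word_inv w = rev (map (\<lambda>(a, b). (a, \<not> b)) w)"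

definition wagner :: "'a set \<Rightarrow> (('a \<times> bool) list \<times> ('a \<times> bool) list) set" where
  "wagner A =
    {(u @ word_inv u @ u, u) | u. u \<in> lists (A \<times> UNIV)} \<union>
    {(u @ word_inv u @ v @ word_inv v, v @ word_inv v @ u @ word_inv u) | u v.
      u \<in> lists (A \<times> UNIV) \<and> v \<in> lists (A \<times> UNIV)}"

abbreviation wagner_cong :: "'a set \<Rightarrow> (('a \<times> bool) list \<times> ('a \<times> bool) list) set" where
  "wagner_cong A \<equiv> monoid_cong (signed_words A) (wagner A)"

definition free_inverse :: "'a set \<Rightarrow> ('a \<times> bool) list set monoid" where
  "free_inverse A = quot_monoid (signed_words A) (wagner_cong A)"

definition free_inverse_gen :: "'a set \<Rightarrow> 'a \<Rightarrow> ('a \<times> bool) list set" where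
  "free_inverse_gen A a = wagner_cong A `` {[(a, True)]}"

section \<open>The restriction monoid and the inverse monoid presented by \<open>M\<close> and \<open>R\<close>\<close>

text \<open>The defining relations as pairs of elements of \<open>F\<close>, where \<open>F\<close> is free on the set
  \<open>carrier M\<close> and \<open>\<iota>\<close> is the inclusion of the generators.\<close>

definition defining_relations ::
    "('m, 'c) monoid_scheme \<Rightarrow> 'x set \<Rightarrow> ('x list rterm set \<times> 'x list rterm set) set
      \<Rightarrow> ('s, 'd) restriction_scheme \<Rightarrow> ('m \<Rightarrow> 's) \<Rightarrow> ('s \<times> 's) set" where
  "defining_relations M X R F \<iota> =
    {(\<iota> \<one>\<^bsub>M\<^esub>, \<one>\<^bsub>F\<^esub>)} \<union>
    {(\<iota> m \<otimes>\<^bsub>F\<^esub> \<iota> n, \<iota> (m \<otimes>\<^bsub>M\<^esub> n) \<otimes>\<^bsub>F\<^esub> (\<iota> m \<otimes>\<^bsub>F\<^esub> \<iota> n)\<^sup>\<star>\<^bsub>F\<^esub>) | m n.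
      m \<in> carrier M \<and> n \<in> carrier M} \<union>
    {(identity_value M F \<iota> f p, identity_value M F \<iota> f q) | p q f.
      (p, q) \<in> R \<and> f \<in> X \<rightarrow> carrier M}"

definition FR_cong ::
    "('m, 'c) monoid_scheme \<Rightarrow> 'x set \<Rightarrow> ('x list rterm set \<times> 'x list rterm set) set
      \<Rightarrow> ('m rterm set \<times> 'm rterm set) set" where
  "FR_cong M X R = restriction_cong (free_restriction (carrier M))
     (defining_relations M X R (free_restriction (carrier M)) (free_gen (carrier M)))"

definition FR ::
    "('m, 'c) monoid_scheme \<Rightarrow> 'x set \<Rightarrow> ('x list rterm set \<times> 'x list rterm set) set
      \<Rightarrow> 'm rterm set set restriction" where
  "FR M X R = quot_restriction (free_restriction (carrier M)) (FR_cong M X R)"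

definition FR_gen ::
    "('m, 'c) monoid_scheme \<Rightarrow> 'x set \<Rightarrow> ('x list rterm set \<times> 'x list rterm set) set
      \<Rightarrow> 'm \<Rightarrow> 'm rterm set set" where
  "FR_gen M X R m = FR_cong M X R `` {free_gen (carrier M) m}"

text \<open>A monoid congruence on an inverse monoid is compatible with inversion
  (\<open>inverse_monoid.quot_inverse_monoid\<close>), so \<open>monoid_cong\<close> generates the right congruence here.\<close>

definition FI_cong ::
    "('m, 'c) monoid_scheme \<Rightarrow> 'x set \<Rightarrow> ('x list rterm set \<times> 'x list rterm set) set
      \<Rightarrow> (('m \<times> bool) list set \<times> ('m \<times> bool) list set) set" where
  "FI_cong M X R = monoid_cong (free_inverse (carrier M))
     (defining_relations M X R (inverse_restriction (free_inverse (carrier M)))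
       (free_inverse_gen (carrier M)))"

definition FI ::
    "('m, 'c) monoid_scheme \<Rightarrow> 'x set \<Rightarrow> ('x list rterm set \<times> 'x list rterm set) set
      \<Rightarrow> ('m \<times> bool) list set set monoid" where
  "FI M X R = quot_monoid (free_inverse (carrier M)) (FI_cong M X R)"

definition FI_gen ::
    "('m, 'c) monoid_scheme \<Rightarrow> 'x set \<Rightarrow> ('x list rterm set \<times> 'x list rterm set) set
      \<Rightarrow> 'm \<Rightarrow> ('m \<times> bool) list set set" where
  "FI_gen M X R m = FI_cong M X R `` {free_inverse_gen (carrier M) m}"

section \<open>Embeddability into a group\<close>

text \<open>The group lives on a fixed type; \<open>embeds_into_groupI\<close> shows that an embedding into a
  group on any type whatsoever yields one into a group on this type.\<close>

definition embeds_into_group :: "('m, 'c) monoid_scheme \<Rightarrow> bool" where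
  "embeds_into_group M \<longleftrightarrow>
    (\<exists>(G :: ('m \<times> bool) list set monoid) h.
      group G \<and> h \<in> monoid_hom M G \<and> inj_on h (carrier M))"

section \<open>Consistency of the definitions\<close>

lemma restriction_monoid_iff_laws:
  "restriction_monoid S \<longleftrightarrow> restriction_algebra S \<and> restriction_laws S \<subseteq> Id"
proof
  assume S: "restriction_monoid S"
  then interpret restriction_monoid S .
  have "a = b" if "(a, b) \<in> restriction_laws S" for a b
    using that
    by cases (auto simp: m_assoc plus_mult_self plus_mult_plus mult_star_self mult_star_star
        plus_star star_plus intro: plus_comm mult_plus star_comm star_mult)
  then show "restriction_algebra S \<and> restriction_laws S \<subseteq> Id"
    using restriction_algebra_axioms by auto
next
  assume S: "restriction_algebra S \<and> restriction_laws S \<subseteq> Id"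
  then interpret restriction_algebra S by simp
  have *: "a = b" if "(a, b) \<in> restriction_laws S" for a b
    using S that by auto
  show "restriction_monoid S"
    by unfold_locales (auto intro: * restriction_laws.intros)
qed

lemma restriction_homD:
  assumes "h \<in> restriction_hom S T"
  shows "x \<in> carrier S \<Longrightarrow> h x \<in> carrier T"
    and "\<lbrakk>x \<in> carrier S; y \<in> carrier S\<rbrakk> \<Longrightarrow> h (x \<otimes>\<^bsub>S\<^esub> y) = h x \<otimes>\<^bsub>T\<^esub> h y"
    and "h \<one>\<^bsub>S\<^esub> = \<one>\<^bsub>T\<^esub>"
    and "x \<in> carrier S \<Longrightarrow> h (x\<^sup>\<star>\<^bsub>S\<^esub>) = (h x)\<^sup>\<star>\<^bsub>T\<^esub>"
    and "x \<in> carrier S \<Longrightarrow> h (x\<^sup>\<oplus>\<^bsub>S\<^esub>) = (h x)\<^sup>\<oplus>\<^bsub>T\<^esub>"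
  using assms by (auto simp: restriction_hom_def monoid_hom_def hom_def)

lemma restriction_homI:
  assumes "\<And>x. x \<in> carrier S \<Longrightarrow> h x \<in> carrier T"
    and "\<And>x y. \<lbrakk>x \<in> carrier S; y \<in> carrier S\<rbrakk> \<Longrightarrow> h (x \<otimes>\<^bsub>S\<^esub> y) = h x \<otimes>\<^bsub>T\<^esub> h y"
    and "h \<one>\<^bsub>S\<^esub> = \<one>\<^bsub>T\<^esub>"
    and "\<And>x. x \<in> carrier S \<Longrightarrow> h (x\<^sup>\<star>\<^bsub>S\<^esub>) = (h x)\<^sup>\<star>\<^bsub>T\<^esub>"
    and "\<And>x. x \<in> carrier S \<Longrightarrow> h (x\<^sup>\<oplus>\<^bsub>S\<^esub>) = (h x)\<^sup>\<oplus>\<^bsub>T\<^esub>"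
  shows "h \<in> restriction_hom S T"
  using assms by (auto simp: restriction_hom_def monoid_hom_def hom_def)

lemma restriction_hom_compose:
  assumes "h \<in> restriction_hom S T" "k \<in> restriction_hom T U"
  shows "(\<lambda>x. k (h x)) \<in> restriction_hom S U"
  using restriction_homD[OF assms(1)] restriction_homD[OF assms(2)]
  by (intro restriction_homI) auto

subsection \<open>Quotients\<close>

lemma UN_class1:
  assumes "equiv A E" "\<And>x y. (x, y) \<in> E \<Longrightarrow> (f x, f y) \<in> E" "x \<in> A"
  shows "(\<Union>a\<in>E `` {x}. E `` {f a}) = E `` {f x}"
proof (rule UN_equiv_class[OF assms(1) _ assms(3)])
  show "(\<lambda>x. E `` {f x}) respects E"
    by (intro congruentI equiv_class_eq[OF assms(1)] assms(2))
qed

lemma UN_class2: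
  assumes "equiv A E"
    "\<And>x x' y y'. (x, x') \<in> E \<Longrightarrow> (y, y') \<in> E \<Longrightarrow> (f x y, f x' y') \<in> E" "x \<in> A" "y \<in> A"
  shows "(\<Union>a\<in>E `` {x}. \<Union>b\<in>E `` {y}. E `` {f a b}) = E `` {f x y}"
proof (rule UN_equiv_class2[OF assms(1) assms(1) _ assms(3,4)])
  show "(\<lambda>x y. E `` {f x y}) respects2 E"
    by (intro congruent2I' equiv_class_eq[OF assms(1)] assms(2))
qed

lemma (in restriction_algebra) restriction_cong_equiv: "equiv (carrier S) (restriction_cong S r)"
proof (rule equivI)
  have "x \<in> carrier S \<and> y \<in> carrier S" if "(x, y) \<in> restriction_cong S r" for x y
    using that by induction auto
  then show "restriction_cong S r \<subseteq> carrier S \<times> carrier S" by auto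
qed (auto intro!: refl_onI symI transI intro: restriction_cong.intros)

lemma (in monoid) monoid_cong_equiv: "equiv (carrier G) (monoid_cong G r)"
proof (rule equivI)
  have "x \<in> carrier G \<and> y \<in> carrier G" if "(x, y) \<in> monoid_cong G r" for x y
    using that by induction auto
  then show "monoid_cong G r \<subseteq> carrier G \<times> carrier G" by auto
qed (auto intro!: refl_onI symI transI intro: monoid_cong.intros)

locale restriction_quotient = restriction_algebra S for S (structure) +
  fixes r E Q
  defines "E \<equiv> restriction_cong S r" and "Q \<equiv> quot_restriction S E"
begin

lemma equiv_E: "equiv (carrier S) E"
  unfolding E_def by (rule restriction_cong_equiv)

lemma carrier_cases:
  assumes "a \<in> carrier Q"
  obtains x where "x \<in> carrier S" "a = E `` {x}"
  using assms unfolding Q_def quot_restriction_def by (auto elim!: quotientE)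

lemma class_closed [simp, intro]: "x \<in> carrier S \<Longrightarrow> E `` {x} \<in> carrier Q"
  unfolding Q_def quot_restriction_def by (auto intro: quotientI)

lemma class_eq: "(x, y) \<in> E \<Longrightarrow> E `` {x} = E `` {y}"
  by (rule equiv_class_eq[OF equiv_E])

lemma ops [simp]:
  "\<one>\<^bsub>Q\<^esub> = E `` {\<one>}"
  "\<lbrakk>x \<in> carrier S; y \<in> carrier S\<rbrakk> \<Longrightarrow> (E `` {x}) \<otimes>\<^bsub>Q\<^esub> (E `` {y}) = E `` {x \<otimes> y}"
  "x \<in> carrier S \<Longrightarrow> (E `` {x})\<^sup>\<star>\<^bsub>Q\<^esub> = E `` {x\<^sup>\<star>}"
  "x \<in> carrier S \<Longrightarrow> (E `` {x})\<^sup>\<oplus>\<^bsub>Q\<^esub> = E `` {x\<^sup>\<oplus>}"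
proof -
  show "\<one>\<^bsub>Q\<^esub> = E `` {\<one>}" by (simp add: Q_def quot_restriction_def)
  show "(E `` {x}) \<otimes>\<^bsub>Q\<^esub> (E `` {y}) = E `` {x \<otimes> y}" if "x \<in> carrier S" "y \<in> carrier S"
    using UN_class2[OF equiv_E, of "\<lambda>x y. x \<otimes> y", OF _ that]
    by (simp add: Q_def quot_restriction_def E_def restriction_cong.mult)
  show "(E `` {x})\<^sup>\<star>\<^bsub>Q\<^esub> = E `` {x\<^sup>\<star>}" if "x \<in> carrier S"
    using UN_class1[OF equiv_E, of "\<lambda>x. x\<^sup>\<star>", OF _ that]
    by (simp add: Q_def quot_restriction_def E_def restriction_cong.star)
  show "(E `` {x})\<^sup>\<oplus>\<^bsub>Q\<^esub> = E `` {x\<^sup>\<oplus>}" if "x \<in> carrier S"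
    using UN_class1[OF equiv_E, of "\<lambda>x. x\<^sup>\<oplus>", OF _ that]
    by (simp add: Q_def quot_restriction_def E_def restriction_cong.plus)
qed

lemma quot_algebra: "restriction_algebra Q"
  by unfold_locales (auto elim!: carrier_cases)

lemma proj_hom: "(\<lambda>x. E `` {x}) \<in> restriction_hom S Q"
  by (intro restriction_homI) auto

lemma quot_restriction_monoid:
  assumes "restriction_laws S \<subseteq> E"
  shows "restriction_monoid Q"
proof -
  have *: "E `` {x} = E `` {y}" if "(x, y) \<in> restriction_laws S" for x y
    using that assms by (intro class_eq) blast
  have "a = b" if "(a, b) \<in> restriction_laws Q" for a b
    using that
  proof cases
  qed (elim carrier_cases; simp; rule *; auto intro: restriction_laws.intros)+
  then show ?thesis using quot_algebra by (auto simp: restriction_monoid_iff_laws)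
qed

lemma hom_respects:
  assumes h: "h \<in> restriction_hom S T"
    and r: "\<And>x y. \<lbrakk>(x, y) \<in> r; x \<in> carrier S; y \<in> carrier S\<rbrakk> \<Longrightarrow> h x = h y"
    and "(x, y) \<in> E"
  shows "h x = h y"
proof -
  have sub: "E \<subseteq> carrier S \<times> carrier S" using equiv_E by (simp add: equiv_def)
  from \<open>(x, y) \<in> E\<close> have "(x, y) \<in> E \<and> h x = h y"
    unfolding E_def
  proof induction
    case (base x y) then show ?case using r by (auto intro: restriction_cong.intros)
  next
    case (mult x x' y y')
    moreover have "x \<in> carrier S" "x' \<in> carrier S" "y \<in> carrier S" "y' \<in> carrier S"
      using mult sub unfolding E_def by blast+
    ultimately show ?case using restriction_homD[OF h] by (auto intro: restriction_cong.intros)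
  next
    case (star x y)
    moreover have "x \<in> carrier S" "y \<in> carrier S" using star sub unfolding E_def by blast+
    ultimately show ?case using restriction_homD[OF h] by (auto intro: restriction_cong.intros)
  next
    case (plus x y)
    moreover have "x \<in> carrier S" "y \<in> carrier S" using plus sub unfolding E_def by blast+
    ultimately show ?case using restriction_homD[OF h] by (auto intro: restriction_cong.intros)
  qed (auto intro: restriction_cong.intros)
  then show ?thesis ..
qed

lemma lift_class:
  assumes "h \<in> restriction_hom S T"
    and "\<And>x y. \<lbrakk>(x, y) \<in> r; x \<in> carrier S; y \<in> carrier S\<rbrakk> \<Longrightarrow> h x = h y"
    and "x \<in> carrier S"
  shows "the_elem (h ` (E `` {x})) = h x"
proof -
  have "h ` (E `` {x}) = {h x}"
    using hom_respects[OF assms(1,2)] assms(3) equiv_class_self[OF equiv_E]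
    by (auto simp: image_iff Bex_def)
  then show ?thesis by simp
qed

lemma lift_hom:
  assumes h: "h \<in> restriction_hom S T"
    and "\<And>x y. \<lbrakk>(x, y) \<in> r; x \<in> carrier S; y \<in> carrier S\<rbrakk> \<Longrightarrow> h x = h y"
  shows "(\<lambda>a. the_elem (h ` a)) \<in> restriction_hom Q T"
  by (intro restriction_homI; (elim carrier_cases)?;
      simp add: lift_class[OF assms] restriction_homD[OF h])

end

lemma quot_restriction_monoid:
  assumes "restriction_monoid S"
  shows "restriction_monoid (quot_restriction S (restriction_cong S r))"
proof -
  interpret restriction_monoid S by fact
  interpret q: restriction_quotient S r "restriction_cong S r"
      "quot_restriction S (restriction_cong S r)"
    by (simp_all add: restriction_quotient_def restriction_algebra_axioms)
  have "restriction_laws S \<subseteq> restriction_cong S r"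
  proof clarify
    fix a b assume *: "(a, b) \<in> restriction_laws S"
    then have "a \<in> carrier S" by cases auto
    moreover have "a = b" using * assms by (auto simp: restriction_monoid_iff_laws)
    ultimately show "(a, b) \<in> restriction_cong S r" by (auto intro: restriction_cong.refl)
  qed
  then show ?thesis by (rule q.quot_restriction_monoid)
qed

subsection \<open>Free restriction monoids\<close>

lemma term_algebra: "restriction_algebra (term_algebra A)"
  by unfold_locales (auto simp: term_algebra_def)

lemma free_quotient:
  "restriction_quotient (term_algebra A)"
  by (simp add: restriction_quotient_def term_algebra)

lemma free_restriction_monoid: "restriction_monoid (free_restriction A)"
proof -
  interpret q: restriction_quotient "term_algebra A" "restriction_laws (term_algebra A)"
      "term_cong A" "free_restriction A"
    by (simp_all add: free_quotient free_restriction_def)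
  have "a \<in> carrier (term_algebra A) \<and> b \<in> carrier (term_algebra A)"
    if "(a, b) \<in> restriction_laws (term_algebra A)" for a b
    using that by cases auto
  then show ?thesis
    by (intro q.quot_restriction_monoid) (auto intro: restriction_cong.base)
qed

lemma reval_hom:
  assumes "restriction_algebra T" "g \<in> A \<rightarrow> carrier T"
  shows "reval T g \<in> restriction_hom (term_algebra A) T"
proof -
  interpret restriction_algebra T by fact
  have "rgens t \<subseteq> A \<Longrightarrow> reval T g t \<in> carrier T" for t
    using assms(2) by (induction t) auto
  then show ?thesis by (intro restriction_homI) (auto simp: term_algebra_def)
qed

lemma hom_laws:
  assumes "h \<in> restriction_hom S T" "restriction_algebra S"
    "(x, y) \<in> restriction_laws S"
  shows "(h x, h y) \<in> restriction_laws T"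
proof -
  interpret restriction_algebra S by fact
  show ?thesis using assms(3)
    by cases (auto simp: restriction_homD[OF assms(1)] intro!: restriction_laws.intros)
qed

lemma
  assumes T: "restriction_monoid T" and g: "g \<in> A \<rightarrow> carrier T"
  shows free_extend_hom: "free_extend T g \<in> restriction_hom (free_restriction A) T"
    and free_extend_gen: "a \<in> A \<Longrightarrow> free_extend T g (free_gen A a) = g a"
proof -
  interpret q: restriction_quotient "term_algebra A" "restriction_laws (term_algebra A)"
      "term_cong A" "free_restriction A"
    by (simp_all add: free_quotient free_restriction_def)
  have T': "restriction_algebra T" using T by (simp add: restriction_monoid_iff_laws)
  have *: "reval T g x = reval T g y" if "(x, y) \<in> restriction_laws (term_algebra A)" for x y
    using hom_laws[OF reval_hom[OF T' g] term_algebra that] T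
    by (auto simp: restriction_monoid_iff_laws)
  show "free_extend T g \<in> restriction_hom (free_restriction A) T"
    using q.lift_hom[OF reval_hom[OF T' g] *] by (simp add: free_extend_def[abs_def])
  show "free_extend T g (free_gen A a) = g a" if "a \<in> A"
    using q.lift_class[OF reval_hom[OF T' g] *, of "RGen a"] that
    by (simp add: free_extend_def free_gen_def term_algebra_def)
qed

lemma free_gen_closed: "a \<in> A \<Longrightarrow> free_gen A a \<in> carrier (free_restriction A)"
proof -
  interpret q: restriction_quotient "term_algebra A" "restriction_laws (term_algebra A)"
      "term_cong A" "free_restriction A"
    by (simp_all add: free_quotient free_restriction_def)
  show "a \<in> A \<Longrightarrow> ?thesis" unfolding free_gen_def by (rule q.class_closed) (simp add: term_algebra_def)
qed

lemma free_restriction_hom_unique: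
  assumes h: "h \<in> restriction_hom (free_restriction A) T"
    and k: "k \<in> restriction_hom (free_restriction A) T"
    and gen: "\<And>a. a \<in> A \<Longrightarrow> h (free_gen A a) = k (free_gen A a)"
    and p: "p \<in> carrier (free_restriction A)"
  shows "h p = k p"
proof -
  interpret q: restriction_quotient "term_algebra A" "restriction_laws (term_algebra A)"
      "term_cong A" "free_restriction A"
    by (simp_all add: free_quotient free_restriction_def)
  note h' = restriction_homD[OF restriction_hom_compose[OF q.proj_hom h]]
  note k' = restriction_homD[OF restriction_hom_compose[OF q.proj_hom k]]
  have "rgens t \<subseteq> A \<Longrightarrow> h (term_cong A `` {t}) = k (term_cong A `` {t})" for t
  proof (induction t)
    case (RGen x) then show ?case using gen by (simp add: free_gen_def)
  next
    case ROne then show ?case using h'(3) k'(3) by (simp add: term_algebra_def)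
  next
    case (RMult s t) then show ?case
      using h'(2)[of s t] k'(2)[of s t] by (simp add: term_algebra_def)
  next
    case (RStar t) then show ?case
      using h'(4)[of t] k'(4)[of t] by (simp add: term_algebra_def)
  next
    case (RPlus t) then show ?case
      using h'(5)[of t] k'(5)[of t] by (simp add: term_algebra_def)
  qed
  with p show ?thesis by (auto elim!: q.carrier_cases simp: term_algebra_def)
qed

lemma word_value_closed:
  assumes "monoid M" "f \<in> X \<rightarrow> carrier M" "u \<in> lists X"
  shows "word_value M f u \<in> carrier M"
proof -
  interpret monoid M by fact
  show ?thesis using assms(3,2) by induction (auto simp: word_value_def)
qed

lemma identity_value_hom:
  assumes "monoid M" "restriction_monoid S" "\<gamma> \<in> carrier M \<rightarrow> carrier S" "f \<in> X \<rightarrow> carrier M"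
  shows "identity_value M S \<gamma> f \<in> restriction_hom (free_restriction (lists X)) S"
  unfolding identity_value_def[abs_def]
  using assms word_value_closed[OF assms(1,4)]
  by (intro free_extend_hom) auto

lemma identity_value_gen:
  assumes "monoid M" "restriction_monoid S" "\<gamma> \<in> carrier M \<rightarrow> carrier S" "f \<in> X \<rightarrow> carrier M"
    "u \<in> lists X"
  shows "identity_value M S \<gamma> f (free_gen (lists X) u) = \<gamma> (word_value M f u)"
  unfolding identity_value_def[abs_def]
  using assms word_value_closed[OF assms(1,4)]
  by (subst free_extend_gen[where A = "lists X"]) auto

lemma hom_identity_value:
  assumes "monoid M" "restriction_monoid S" "restriction_monoid T"
    "\<gamma> \<in> carrier M \<rightarrow> carrier S" "f \<in> X \<rightarrow> carrier M" "k \<in> restriction_hom S T"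
    "p \<in> carrier (free_restriction (lists X))"
  shows "k (identity_value M S \<gamma> f p) = identity_value M T (\<lambda>m. k (\<gamma> m)) f p"
proof (rule free_restriction_hom_unique[OF _ _ _ assms(7)])
  show "(\<lambda>p. k (identity_value M S \<gamma> f p)) \<in> restriction_hom (free_restriction (lists X)) T"
    by (rule restriction_hom_compose[OF identity_value_hom assms(6)]) fact+
  have *: "(\<lambda>m. k (\<gamma> m)) \<in> carrier M \<rightarrow> carrier T"
    using assms(4) restriction_homD(1)[OF assms(6)] by auto
  show "identity_value M T (\<lambda>m. k (\<gamma> m)) f \<in> restriction_hom (free_restriction (lists X)) T"
    by (rule identity_value_hom) (fact | fact *)+
  show "k (identity_value M S \<gamma> f (free_gen (lists X) a)) =
      identity_value M T (\<lambda>m. k (\<gamma> m)) f (free_gen (lists X) a)" if "a \<in> lists X" for a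
    using identity_value_gen[OF assms(1,2,4,5) that] identity_value_gen[OF assms(1,3) * assms(5) that]
    by simp
qed

subsection \<open>Inverse monoids\<close>

text \<open>A monoid with an involution satisfying Wagner's identities is an inverse monoid.\<close>

locale wagner_monoid = monoid S for S (structure) +
  fixes i
  assumes i_closed [simp]: "x \<in> carrier S \<Longrightarrow> i x \<in> carrier S"
    and i_i: "x \<in> carrier S \<Longrightarrow> i (i x) = x"
    and i_mult: "\<lbrakk>x \<in> carrier S; y \<in> carrier S\<rbrakk> \<Longrightarrow> i (x \<otimes> y) = i y \<otimes> i x"
    and mult_i_mult: "x \<in> carrier S \<Longrightarrow> x \<otimes> i x \<otimes> x = x"
    and i_comm:
      "\<lbrakk>x \<in> carrier S; y \<in> carrier S\<rbrakk> \<Longrightarrow> x \<otimes> i x \<otimes> (y \<otimes> i y) = y \<otimes> i y \<otimes> (x \<otimes> i x)"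
begin

lemma i_mult_i: "x \<in> carrier S \<Longrightarrow> i x \<otimes> x \<otimes> i x = i x"
  using mult_i_mult[of "i x"] by (simp add: i_i)

lemma idem_eq:
  assumes e: "e \<in> carrier S" "e \<otimes> e = e"
  shows "e \<otimes> i e = e"
proof -
  have ii: "i e \<otimes> i e = i e" using i_mult[of e e] e by simp
  have "i e = i e \<otimes> (e \<otimes> e) \<otimes> i e" using i_mult_i e by simp
  also have "\<dots> = i e \<otimes> i (i e) \<otimes> (e \<otimes> i e)" using e(1) by (simp add: m_assoc i_i)
  also have "\<dots> = e \<otimes> i e \<otimes> (i e \<otimes> i (i e))" using e i_comm by simp
  also have "\<dots> = e \<otimes> (i e \<otimes> i e) \<otimes> e" using e by (simp add: m_assoc i_i)
  also have "\<dots> = e" using ii mult_i_mult e by simp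
  finally show ?thesis using e by simp
qed

lemma idem_comm:
  assumes "e \<in> carrier S" "f \<in> carrier S" "e \<otimes> e = e" "f \<otimes> f = f"
  shows "e \<otimes> f = f \<otimes> e"
  using i_comm[of e f] idem_eq assms by simp

lemma inverse_unique:
  assumes c: "x \<in> carrier S" "y \<in> carrier S" "z \<in> carrier S"
    and y: "x \<otimes> y \<otimes> x = x" "y \<otimes> x \<otimes> y = y" and z: "x \<otimes> z \<otimes> x = x" "z \<otimes> x \<otimes> z = z"
  shows "y = z"
proof -
  have idem: "(x \<otimes> y) \<otimes> (x \<otimes> y) = x \<otimes> y" "(x \<otimes> z) \<otimes> (x \<otimes> z) = x \<otimes> z"
    "(y \<otimes> x) \<otimes> (y \<otimes> x) = y \<otimes> x" "(z \<otimes> x) \<otimes> (z \<otimes> x) = z \<otimes> x"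
    using c y z by (simp_all add: m_assoc[symmetric])
  have "y = y \<otimes> (x \<otimes> z \<otimes> x) \<otimes> y" using y z by simp
  also have "\<dots> = y \<otimes> ((x \<otimes> z) \<otimes> (x \<otimes> y))" using c by (simp add: m_assoc)
  also have "\<dots> = y \<otimes> ((x \<otimes> y) \<otimes> (x \<otimes> z))"
    using c idem idem_comm[of "x \<otimes> z" "x \<otimes> y"] by simp
  also have "\<dots> = (y \<otimes> x \<otimes> y) \<otimes> x \<otimes> z" using c by (simp add: m_assoc)
  also have "\<dots> = y \<otimes> x \<otimes> (z \<otimes> x \<otimes> z)" using c y z by simp
  also have "\<dots> = (y \<otimes> x) \<otimes> (z \<otimes> x) \<otimes> z" using c by (simp add: m_assoc)
  also have "\<dots> = (z \<otimes> x) \<otimes> (y \<otimes> x) \<otimes> z"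
    using c idem idem_comm[of "y \<otimes> x" "z \<otimes> x"] by simp
  also have "\<dots> = z \<otimes> (x \<otimes> y \<otimes> x) \<otimes> z" using c by (simp add: m_assoc)
  also have "\<dots> = z" using c y z by simp
  finally show ?thesis .
qed

lemma inverse_monoid: "inverse_monoid S"
proof unfold_locales
  fix x assume x: "x \<in> carrier S"
  show "\<exists>!y. y \<in> carrier S \<and> x \<otimes> y \<otimes> x = x \<and> y \<otimes> x \<otimes> y = y"
    using x i_closed mult_i_mult i_mult_i inverse_unique
    by (intro ex1I[of _ "i x"]) blast+
qed

end

context inverse_monoid
begin

lemma winv: "x \<in> carrier S \<Longrightarrow>
  winv S x \<in> carrier S \<and> x \<otimes> winv S x \<otimes> x = x \<and> winv S x \<otimes> x \<otimes> winv S x = winv S x"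
  unfolding winv_def by (rule theI') (rule ex1_inverse)

lemma winv_closed [simp]: "x \<in> carrier S \<Longrightarrow> winv S x \<in> carrier S"
  and winv_r: "x \<in> carrier S \<Longrightarrow> x \<otimes> winv S x \<otimes> x = x"
  and winv_l: "x \<in> carrier S \<Longrightarrow> winv S x \<otimes> x \<otimes> winv S x = winv S x"
  using winv by auto

lemma winv_unique:
  assumes "x \<in> carrier S" "y \<in> carrier S" "x \<otimes> y \<otimes> x = x" "y \<otimes> x \<otimes> y = y"
  shows "winv S x = y"
  using ex1_inverse[OF assms(1)] winv[OF assms(1)] assms by blast

lemma winv_winv: "x \<in> carrier S \<Longrightarrow> winv S (winv S x) = x"
  by (rule winv_unique) (auto simp: winv_r winv_l)

lemma idem_winv: "x \<in> carrier S \<Longrightarrow> x \<otimes> x = x \<Longrightarrow> winv S x = x"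
  by (rule winv_unique) auto

lemma idem_mult:
  assumes c: "e \<in> carrier S" "f \<in> carrier S" and e: "e \<otimes> e = e" and f: "f \<otimes> f = f"
  shows "(e \<otimes> f) \<otimes> (e \<otimes> f) = e \<otimes> f"
proof -
  define y where "y = winv S (e \<otimes> f)"
  have y: "y \<in> carrier S" "e \<otimes> f \<otimes> y \<otimes> (e \<otimes> f) = e \<otimes> f" "y \<otimes> (e \<otimes> f) \<otimes> y = y"
    using winv[of "e \<otimes> f"] c by (simp_all add: y_def)
  have ee: "e \<otimes> (e \<otimes> w) = e \<otimes> w" "f \<otimes> (f \<otimes> w) = f \<otimes> w" if "w \<in> carrier S" for w
    using that c e f by (simp_all add: m_assoc[symmetric])
  have "winv S (e \<otimes> f) = f \<otimes> y \<otimes> e"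
  proof (rule winv_unique)
    show "e \<otimes> f \<otimes> (f \<otimes> y \<otimes> e) \<otimes> (e \<otimes> f) = e \<otimes> f"
      using y c ee by (simp add: m_assoc)
    have "f \<otimes> y \<otimes> e \<otimes> (e \<otimes> f) \<otimes> (f \<otimes> y \<otimes> e) = f \<otimes> (y \<otimes> (e \<otimes> f) \<otimes> y) \<otimes> e"
      using y(1) c ee by (simp add: m_assoc)
    then show "f \<otimes> y \<otimes> e \<otimes> (e \<otimes> f) \<otimes> (f \<otimes> y \<otimes> e) = f \<otimes> y \<otimes> e"
      using y by simp
  qed (use c y in auto)
  then have yy: "y = f \<otimes> y \<otimes> e" by (simp add: y_def)
  have "y \<otimes> y = (f \<otimes> y \<otimes> e) \<otimes> (f \<otimes> y \<otimes> e)" using yy by simp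
  also have "\<dots> = f \<otimes> (y \<otimes> (e \<otimes> f) \<otimes> y) \<otimes> e" using y(1) c by (simp add: m_assoc)
  also have "\<dots> = y" using y yy by simp
  finally have yy': "y \<otimes> y = y" .
  then have "winv S y = y" using y by (intro idem_winv)
  moreover have "winv S y = e \<otimes> f" using winv_winv[of "e \<otimes> f"] c by (simp add: y_def)
  ultimately show ?thesis using yy' by simp
qed

lemma idem_comm:
  assumes c: "e \<in> carrier S" "f \<in> carrier S" and e: "e \<otimes> e = e" and f: "f \<otimes> f = f"
  shows "e \<otimes> f = f \<otimes> e"
proof -
  note ef = idem_mult[OF c e f] and fe = idem_mult[OF c(2,1) f e]
  have ee: "e \<otimes> (e \<otimes> w) = e \<otimes> w" "f \<otimes> (f \<otimes> w) = f \<otimes> w" if "w \<in> carrier S" for w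
    using that c e f by (simp_all add: m_assoc[symmetric])
  have "winv S (e \<otimes> f) = f \<otimes> e"
    using c ee ef fe by (intro winv_unique) (auto simp: m_assoc)
  then show ?thesis using idem_winv[of "e \<otimes> f"] c ef by simp
qed

lemma idem_r: "x \<in> carrier S \<Longrightarrow> (x \<otimes> winv S x) \<otimes> (x \<otimes> winv S x) = x \<otimes> winv S x"
  and idem_l: "x \<in> carrier S \<Longrightarrow> (winv S x \<otimes> x) \<otimes> (winv S x \<otimes> x) = winv S x \<otimes> x"
  by (simp_all add: m_assoc[symmetric] winv_r winv_l)

lemma winv_mult:
  assumes c: "x \<in> carrier S" "y \<in> carrier S"
  shows "winv S (x \<otimes> y) = winv S y \<otimes> winv S x"
proof (rule winv_unique)
  let ?x = "winv S x" and ?y = "winv S y"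
  have comm: "?x \<otimes> x \<otimes> (y \<otimes> ?y) = y \<otimes> ?y \<otimes> (?x \<otimes> x)"
    using c by (intro idem_comm) (auto simp: idem_r idem_l)
  have "x \<otimes> y \<otimes> (?y \<otimes> ?x) \<otimes> (x \<otimes> y) = x \<otimes> (y \<otimes> ?y \<otimes> (?x \<otimes> x)) \<otimes> y"
    using c by (simp add: m_assoc)
  also have "\<dots> = (x \<otimes> ?x \<otimes> x) \<otimes> (y \<otimes> ?y \<otimes> y)"
    using c by (subst comm[symmetric]) (simp add: m_assoc)
  finally show "x \<otimes> y \<otimes> (?y \<otimes> ?x) \<otimes> (x \<otimes> y) = x \<otimes> y" using c by (simp add: winv_r)
  have "?y \<otimes> ?x \<otimes> (x \<otimes> y) \<otimes> (?y \<otimes> ?x) = ?y \<otimes> (?x \<otimes> x \<otimes> (y \<otimes> ?y)) \<otimes> ?x"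
    using c by (simp add: m_assoc)
  also have "\<dots> = (?y \<otimes> y \<otimes> ?y) \<otimes> (?x \<otimes> x \<otimes> ?x)"
    using c by (subst comm) (simp add: m_assoc)
  finally show "?y \<otimes> ?x \<otimes> (x \<otimes> y) \<otimes> (?y \<otimes> ?x) = ?y \<otimes> ?x" using c by (simp add: winv_l)
qed (use c in auto)

lemma wagner_monoid: "wagner_monoid S (winv S)"
  by unfold_locales (auto simp: winv_winv winv_mult winv_r intro: idem_comm idem_r)

lemma restriction_monoid: "restriction_monoid (inverse_restriction S)"
proof -
  have assoc4: "x \<otimes> winv S x \<otimes> (x \<otimes> w) = x \<otimes> w" "winv S x \<otimes> x \<otimes> (winv S x \<otimes> w) = winv S x \<otimes> w"
    if "x \<in> carrier S" "w \<in> carrier S" for x w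
    using that by (simp_all add: m_assoc[symmetric] winv_r winv_l)
  have plus_idem: "winv S (x \<otimes> winv S x) = x \<otimes> winv S x" if "x \<in> carrier S" for x
    using that by (intro idem_winv) (auto simp: idem_r)
  have star_idem: "winv S (winv S x \<otimes> x) = winv S x \<otimes> x" if "x \<in> carrier S" for x
    using that by (intro idem_winv) (auto simp: idem_l)
  note comm = idem_comm[OF _ _ idem_r idem_r] idem_comm[OF _ _ idem_l idem_l]
    idem_comm[OF _ _ idem_l idem_r]
  show ?thesis
  proof (unfold_locales, simp_all add: inverse_restriction_def m_assoc)
    fix x y assume c: "x \<in> carrier S" "y \<in> carrier S"
    let ?x = "winv S x" and ?y = "winv S y"
    show "x \<otimes> (?x \<otimes> x) = x" using c by (simp add: m_assoc[symmetric] winv_r)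
    show "x \<otimes> (?x \<otimes> (y \<otimes> ?y)) = y \<otimes> (?y \<otimes> (x \<otimes> ?x))"
      using comm(1)[of x y] c by (simp add: m_assoc)
    show "?x \<otimes> (x \<otimes> (?y \<otimes> y)) = ?y \<otimes> (y \<otimes> (?x \<otimes> x))"
      using comm(2)[of x y] c by (simp add: m_assoc)
    have "x \<otimes> (?x \<otimes> (y \<otimes> winv S (x \<otimes> (?x \<otimes> y)))) = (x \<otimes> ?x) \<otimes> ((y \<otimes> ?y) \<otimes> (x \<otimes> ?x))"
      using c winv_mult[of "x \<otimes> ?x" y] plus_idem[of x] by (simp add: m_assoc)
    also have "\<dots> = (x \<otimes> ?x) \<otimes> ((x \<otimes> ?x) \<otimes> (y \<otimes> ?y))" using comm(1)[of x y] c by simp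
    also have "\<dots> = x \<otimes> (?x \<otimes> (y \<otimes> ?y))"
      using c idem_r[of x] by (simp add: m_assoc[symmetric])
    finally show "x \<otimes> (?x \<otimes> (y \<otimes> winv S (x \<otimes> (?x \<otimes> y)))) = x \<otimes> (?x \<otimes> (y \<otimes> ?y))" .
    have "winv S (x \<otimes> (?y \<otimes> y)) \<otimes> (x \<otimes> (?y \<otimes> y)) = (?y \<otimes> y) \<otimes> (?x \<otimes> x) \<otimes> (?y \<otimes> y)"
      using c winv_mult[of x "?y \<otimes> y"] star_idem[of y] by (simp add: m_assoc)
    also have "\<dots> = (?x \<otimes> x) \<otimes> (?y \<otimes> y) \<otimes> (?y \<otimes> y)" using comm(2)[of x y] c by simp
    also have "\<dots> = ?x \<otimes> (x \<otimes> (?y \<otimes> y))"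
      using c idem_l[of y] by (simp add: m_assoc)
    finally show "winv S (x \<otimes> (?y \<otimes> y)) \<otimes> (x \<otimes> (?y \<otimes> y)) = ?x \<otimes> (x \<otimes> (?y \<otimes> y))" .
    have "x \<otimes> (y \<otimes> (winv S (x \<otimes> y) \<otimes> x)) = x \<otimes> ((y \<otimes> ?y) \<otimes> (?x \<otimes> x))"
      using c by (simp add: winv_mult m_assoc)
    also have "\<dots> = x \<otimes> ((?x \<otimes> x) \<otimes> (y \<otimes> ?y))" using comm(3)[of x y] c by simp
    also have "\<dots> = x \<otimes> (y \<otimes> ?y)" using c winv_r[of x] by (simp add: m_assoc[symmetric])
    finally show "x \<otimes> (y \<otimes> ?y) = x \<otimes> (y \<otimes> (winv S (x \<otimes> y) \<otimes> x))" by simp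
    have "y \<otimes> (winv S (x \<otimes> y) \<otimes> (x \<otimes> y)) = ((y \<otimes> ?y) \<otimes> (?x \<otimes> x)) \<otimes> y"
      using c by (simp add: winv_mult m_assoc)
    also have "\<dots> = ((?x \<otimes> x) \<otimes> (y \<otimes> ?y)) \<otimes> y" using comm(3)[of x y] c by simp
    also have "\<dots> = ?x \<otimes> (x \<otimes> y)" using c winv_r[of y] by (simp add: m_assoc)
    finally show "?x \<otimes> (x \<otimes> y) = y \<otimes> (winv S (x \<otimes> y) \<otimes> (x \<otimes> y))" by simp
    show "winv S (x \<otimes> ?x) \<otimes> (x \<otimes> ?x) = x \<otimes> ?x"
      using c plus_idem[of x] idem_r[of x] by simp
    show "?x \<otimes> (x \<otimes> winv S (?x \<otimes> x)) = ?x \<otimes> x"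
      using c star_idem[of x] idem_l[of x] by (simp add: m_assoc)
  qed (simp add: m_assoc[symmetric] winv_r)
qed

end

lemma monoid_hom_inverse_restriction:
  assumes S: "inverse_monoid S" and T: "inverse_monoid T" and h: "h \<in> monoid_hom S T"
  shows "h \<in> restriction_hom (inverse_restriction S) (inverse_restriction T)"
proof -
  interpret S: inverse_monoid S by fact
  interpret T: inverse_monoid T by fact
  have c: "h x \<in> carrier T" if "x \<in> carrier S" for x
    using h that by (auto simp: monoid_hom_def hom_def)
  have m: "h (x \<otimes>\<^bsub>S\<^esub> y) = h x \<otimes>\<^bsub>T\<^esub> h y" if "x \<in> carrier S" "y \<in> carrier S" for x y
    using h that by (auto simp: monoid_hom_def hom_def)
  have "winv T (h x) = h (winv S x)" if x: "x \<in> carrier S" for x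
  proof (rule T.winv_unique)
    show "h x \<otimes>\<^bsub>T\<^esub> h (winv S x) \<otimes>\<^bsub>T\<^esub> h x = h x"
      using x S.winv_r[OF x] by (simp flip: m)
    show "h (winv S x) \<otimes>\<^bsub>T\<^esub> h x \<otimes>\<^bsub>T\<^esub> h (winv S x) = h (winv S x)"
      using x S.winv_l[OF x] by (simp flip: m)
  qed (use c x in auto)
  then show ?thesis
    using c m h by (intro restriction_homI) (auto simp: inverse_restriction_def monoid_hom_def)
qed

locale monoid_quotient = monoid S for S (structure) +
  fixes r E Q
  defines "E \<equiv> monoid_cong S r" and "Q \<equiv> quot_monoid S E"
begin

lemma equiv_E: "equiv (carrier S) E"
  unfolding E_def by (rule monoid_cong_equiv)

lemma carrier_cases:
  assumes "a \<in> carrier Q"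
  obtains x where "x \<in> carrier S" "a = E `` {x}"
  using assms unfolding Q_def quot_monoid_def by (auto elim!: quotientE)

lemma class_closed [simp, intro]: "x \<in> carrier S \<Longrightarrow> E `` {x} \<in> carrier Q"
  unfolding Q_def quot_monoid_def by (auto intro: quotientI)

lemma class_eq: "(x, y) \<in> E \<Longrightarrow> E `` {x} = E `` {y}"
  by (rule equiv_class_eq[OF equiv_E])

lemma ops [simp]:
  "\<one>\<^bsub>Q\<^esub> = E `` {\<one>}"
  "\<lbrakk>x \<in> carrier S; y \<in> carrier S\<rbrakk> \<Longrightarrow> (E `` {x}) \<otimes>\<^bsub>Q\<^esub> (E `` {y}) = E `` {x \<otimes> y}"
proof -
  show "\<one>\<^bsub>Q\<^esub> = E `` {\<one>}" by (simp add: Q_def quot_monoid_def)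
  show "(E `` {x}) \<otimes>\<^bsub>Q\<^esub> (E `` {y}) = E `` {x \<otimes> y}" if "x \<in> carrier S" "y \<in> carrier S"
    using UN_class2[OF equiv_E, of "\<lambda>x y. x \<otimes> y", OF _ that]
    by (simp add: Q_def quot_monoid_def E_def monoid_cong.mult)
qed

lemma quot_monoid: "monoid Q"
  by (rule monoidI; (elim carrier_cases)?; simp add: m_assoc)

lemma proj_hom: "(\<lambda>x. E `` {x}) \<in> monoid_hom S Q"
  by (simp add: monoid_hom_def hom_def)

lemma quot_wagner:
  assumes c: "\<And>x. x \<in> carrier S \<Longrightarrow> i x \<in> carrier S"
    and cong: "\<And>x y. (x, y) \<in> E \<Longrightarrow> (i x, i y) \<in> E"
    and ii: "\<And>x. x \<in> carrier S \<Longrightarrow> i (i x) = x"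
    and im: "\<And>x y. \<lbrakk>x \<in> carrier S; y \<in> carrier S\<rbrakk> \<Longrightarrow> i (x \<otimes> y) = i y \<otimes> i x"
    and reg: "\<And>x. x \<in> carrier S \<Longrightarrow> (x \<otimes> i x \<otimes> x, x) \<in> E"
    and comm: "\<And>x y. \<lbrakk>x \<in> carrier S; y \<in> carrier S\<rbrakk> \<Longrightarrow>
      (x \<otimes> i x \<otimes> (y \<otimes> i y), y \<otimes> i y \<otimes> (x \<otimes> i x)) \<in> E"
  shows "inverse_monoid Q"
proof -
  let ?i = "\<lambda>a. \<Union>x\<in>a. E `` {i x}"
  have i: "?i (E `` {x}) = E `` {i x}" if "x \<in> carrier S" for x
    by (rule UN_class1[OF equiv_E cong that])
  interpret Q: monoid Q by (rule quot_monoid)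
  have "wagner_monoid Q ?i"
    using c
    by unfold_locales
      (elim carrier_cases; simp add: i ii im class_eq[OF reg] class_eq[OF comm])+
  then show ?thesis by (rule wagner_monoid.inverse_monoid)
qed

end

lemma (in inverse_monoid) quot_inverse_monoid:
  shows "inverse_monoid (quot_monoid S (monoid_cong S r))"
    and "(x, y) \<in> monoid_cong S r \<Longrightarrow> (winv S x, winv S y) \<in> monoid_cong S r"
proof -
  interpret q: monoid_quotient S r "monoid_cong S r" "quot_monoid S (monoid_cong S r)"
    by (simp_all add: monoid_quotient_def monoid_axioms)
  interpret w: wagner_monoid S "winv S" by (rule wagner_monoid)
  note refl = monoid_cong.refl[of _ S r]
  note tr = monoid_cong.trans[of _ _ S r] and mu = monoid_cong.mult[of _ _ S r]
  have sub: "x \<in> carrier S \<and> y \<in> carrier S" if "(x, y) \<in> monoid_cong S r" for x y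
    using that q.equiv_E by (auto simp: equiv_def)
  show cong: "(winv S x, winv S y) \<in> monoid_cong S r" if xy: "(x, y) \<in> monoid_cong S r" for x y
  proof -
    let ?x = "winv S x" and ?y = "winv S y"
    have c: "x \<in> carrier S" "y \<in> carrier S" using sub xy by auto
    have yx: "(y, x) \<in> monoid_cong S r" using xy by (rule monoid_cong.sym)
    define e f g h where "e = ?x \<otimes> x" and "f = ?y \<otimes> y" and "g = x \<otimes> ?x" and "h = y \<otimes> ?y"
    have cc: "e \<in> carrier S" "f \<in> carrier S" "g \<in> carrier S" "h \<in> carrier S"
      using c by (simp_all add: e_def f_def g_def h_def)
    have ef: "e \<otimes> f = f \<otimes> e" "g \<otimes> h = h \<otimes> g"
      using c by (auto simp: e_def f_def g_def h_def intro!: idem_comm idem_l idem_r)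
    have xf: "x \<otimes> e = x" "y \<otimes> f = y" "g \<otimes> x = x" "h \<otimes> y = y" "?x \<otimes> g = ?x" "?y \<otimes> h = ?y"
        "e \<otimes> ?x = ?x" "f \<otimes> ?y = ?y"
      using c by (simp_all add: e_def f_def g_def h_def winv_r winv_l flip: m_assoc)
    have m: "(a \<otimes> x \<otimes> b, a \<otimes> y \<otimes> b) \<in> monoid_cong S r"
      if "a \<in> carrier S" "b \<in> carrier S" for a b
      using that xy refl by (intro mu) auto
    have xf': "(x \<otimes> f, x) \<in> monoid_cong S r"
    proof -
      have "(x \<otimes> f, y \<otimes> f) \<in> monoid_cong S r" using m[of \<one> f] c cc by simp
      then show ?thesis using yx xf by (auto intro: tr)
    qed
    have ye': "(y \<otimes> e, y) \<in> monoid_cong S r"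
    proof -
      have "(y \<otimes> e, x \<otimes> e) \<in> monoid_cong S r" using m[of \<one> e] c cc by (simp add: monoid_cong.sym)
      then show ?thesis using xy xf by (auto intro: tr)
    qed
    have 1: "(e \<otimes> f, e) \<in> monoid_cong S r"
      using mu[OF refl xf', of ?x] c cc by (simp add: e_def m_assoc)
    have 2: "(f \<otimes> e, f) \<in> monoid_cong S r"
      using mu[OF refl ye', of ?y] c cc by (simp add: f_def m_assoc)
    have e_f: "(e, f) \<in> monoid_cong S r"
      using 1 2 ef by (auto intro: tr monoid_cong.sym)
    have hx: "(h \<otimes> x, x) \<in> monoid_cong S r"
    proof -
      have "(h \<otimes> x, h \<otimes> y) \<in> monoid_cong S r" using m[of h \<one>] c cc by simp
      then show ?thesis using yx xf by (auto intro: tr)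
    qed
    have gy: "(g \<otimes> y, y) \<in> monoid_cong S r"
    proof -
      have "(g \<otimes> y, g \<otimes> x) \<in> monoid_cong S r" using m[of g \<one>] c cc by (simp add: monoid_cong.sym)
      then show ?thesis using xy xf by (auto intro: tr)
    qed
    have 3: "(h \<otimes> g, g) \<in> monoid_cong S r"
      using mu[OF hx refl, of ?x] c cc by (simp add: g_def m_assoc)
    have 4: "(g \<otimes> h, h) \<in> monoid_cong S r"
      using mu[OF gy refl, of ?y] c cc by (simp add: h_def m_assoc)
    have g_h: "(g, h) \<in> monoid_cong S r"
      using 3 4 ef by (auto intro: tr monoid_cong.sym)
    have "(?x, ?x \<otimes> h) \<in> monoid_cong S r" using mu[OF refl g_h, of ?x] c xf by simp
    moreover have "(?x \<otimes> h, ?x \<otimes> x \<otimes> ?y) \<in> monoid_cong S r"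
      using monoid_cong.sym[OF m[of ?x ?y]] c by (simp add: h_def m_assoc)
    moreover have "(?x \<otimes> x \<otimes> ?y, ?y) \<in> monoid_cong S r"
      using mu[OF e_f refl, of ?y] c xf by (simp add: e_def)
    ultimately show ?thesis by (blast intro: tr)
  qed
  show "inverse_monoid (quot_monoid S (monoid_cong S r))"
    by (rule q.quot_wagner[where i = "winv S"])
      (auto simp: winv_winv winv_mult winv_r w.i_comm intro: refl cong)
qed

lemma word_inv_simps [simp]:
  "word_inv (u @ v) = word_inv v @ word_inv u" "word_inv (word_inv u) = u" "word_inv [] = []"
  by (simp_all add: word_inv_def rev_map o_def case_prod_unfold)

lemma word_inv_closed [simp]:
  "u \<in> lists (A \<times> UNIV) \<Longrightarrow> word_inv u \<in> lists (A \<times> UNIV)"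
  by (auto simp: word_inv_def lists_eq_set)

lemma signed_words_monoid: "monoid (signed_words A)"
  by (rule monoidI) (auto simp: signed_words_def)

lemma free_inverse_monoid: "inverse_monoid (free_inverse A)"
proof -
  interpret monoid "signed_words A" by (rule signed_words_monoid)
  interpret q: monoid_quotient "signed_words A" "wagner A" "wagner_cong A" "free_inverse A"
    by (simp_all add: monoid_quotient_def monoid_axioms free_inverse_def)
  have s: "carrier (signed_words A) = lists (A \<times> UNIV)" "mult (signed_words A) = (@)"
    by (simp_all add: signed_words_def)
  have base: "(u, v) \<in> wagner_cong A"
    if "(u, v) \<in> wagner A" "u \<in> lists (A \<times> UNIV)" "v \<in> lists (A \<times> UNIV)" for u v
    using that by (intro monoid_cong.base) (auto simp: s)
  have reg: "(u @ word_inv u @ u, u) \<in> wagner_cong A" if "u \<in> lists (A \<times> UNIV)" for u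
    using that by (intro base) (auto simp: wagner_def)
  have comm: "(u @ word_inv u @ v @ word_inv v, v @ word_inv v @ u @ word_inv u) \<in> wagner_cong A"
    if "u \<in> lists (A \<times> UNIV)" "v \<in> lists (A \<times> UNIV)" for u v
    using that by (intro base) (auto simp: wagner_def)
  have cong: "(word_inv u, word_inv v) \<in> wagner_cong A" if "(u, v) \<in> wagner_cong A" for u v
    using that
  proof induction
    case (base u v)
    then consider "u = v @ word_inv v @ v"
      | x y where "u = x @ word_inv x @ y @ word_inv y" "v = y @ word_inv y @ x @ word_inv x"
          "x \<in> lists (A \<times> UNIV)" "y \<in> lists (A \<times> UNIV)"
      unfolding wagner_def by blast
    then show ?case
    proof cases
      case 1
      have "word_inv v \<in> lists (A \<times> UNIV)" using base by (simp add: s)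
      from reg[OF this] 1 show ?thesis by simp
    next
      case 2
      then show ?thesis using comm[of y x] by simp
    qed
  next
    case (mult u u' v v')
    then show ?case using monoid_cong.mult[of "word_inv v" "word_inv v'" "signed_words A" "wagner A"]
      by (simp add: s)
  next
    case (refl u)
    then show ?case by (intro monoid_cong.refl) (simp only: s word_inv_closed)
  qed (auto intro: monoid_cong.intros simp: s)
  show ?thesis
    by (rule q.quot_wagner[where i = word_inv]) (use reg comm cong in \<open>auto simp: s\<close>)
qed

lemma FI_inverse_monoid: "inverse_monoid (FI M X R)"
  unfolding FI_def FI_cong_def by (rule inverse_monoid.quot_inverse_monoid(1)) (rule free_inverse_monoid)

lemma FR_restriction_monoid: "restriction_monoid (FR M X R)"
  unfolding FR_def FR_cong_def by (rule quot_restriction_monoid) (rule free_restriction_monoid)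

subsection \<open>Existence and uniqueness of \<open>\<psi>\<^sub>R\<close>\<close>

lemma FR_hom_unique:
  assumes h: "h \<in> restriction_hom (FR M X R) T"
    and k: "k \<in> restriction_hom (FR M X R) T"
    and gen: "\<And>m. m \<in> carrier M \<Longrightarrow> h (FR_gen M X R m) = k (FR_gen M X R m)"
    and p: "p \<in> carrier (FR M X R)"
  shows "h p = k p"
proof -
  let ?F = "free_restriction (carrier M)"
  let ?r = "defining_relations M X R ?F (free_gen (carrier M))"
  interpret F: restriction_monoid ?F by (rule free_restriction_monoid)
  interpret q: restriction_quotient ?F ?r "FR_cong M X R" "FR M X R"
    by (simp_all add: restriction_quotient_def F.restriction_algebra_axioms FR_def FR_cong_def)
  obtain x where x: "x \<in> carrier ?F" "p = FR_cong M X R `` {x}"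
    using p by (rule q.carrier_cases)
  have "h (FR_cong M X R `` {x}) = k (FR_cong M X R `` {x})"
    by (rule free_restriction_hom_unique[OF restriction_hom_compose[OF q.proj_hom h]
          restriction_hom_compose[OF q.proj_hom k] _ x(1)])
      (use gen in \<open>simp add: FR_gen_def\<close>)
  then show ?thesis by (simp add: x)
qed

theorem
  assumes M: "monoid M" and R: "\<forall>e\<in>R. is_identity X e"
  shows psi_exists:
      "\<exists>\<psi> \<in> restriction_hom (FR M X R) (inverse_restriction (FI M X R)).
        \<forall>m\<in>carrier M. \<psi> (FR_gen M X R m) = FI_gen M X R m" (is ?ex)
    and psi_unique:
      "\<lbrakk>\<psi> \<in> restriction_hom (FR M X R) (inverse_restriction (FI M X R));
        \<psi>' \<in> restriction_hom (FR M X R) (inverse_restriction (FI M X R));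
        \<forall>m\<in>carrier M. \<psi> (FR_gen M X R m) = FI_gen M X R m;
        \<forall>m\<in>carrier M. \<psi>' (FR_gen M X R m) = FI_gen M X R m; p \<in> carrier (FR M X R)\<rbrakk>
        \<Longrightarrow> \<psi> p = \<psi>' p"
proof -
  interpret M: monoid M by fact
  define A where "A = carrier M"
  define F where "F = free_restriction A"
  define I where "I = free_inverse A"
  define r where "r = defining_relations M X R F (free_gen A)"
  define s where "s = defining_relations M X R (inverse_restriction I) (free_inverse_gen A)"
  define T where "T = inverse_restriction (FI M X R)"
  define \<pi> where "\<pi> = (\<lambda>x. FI_cong M X R `` {x})"
  interpret F: restriction_monoid F unfolding F_def by (rule free_restriction_monoid)
  interpret I: inverse_monoid I unfolding I_def by (rule free_inverse_monoid)
  interpret IR: restriction_monoid "inverse_restriction I" by (rule I.restriction_monoid)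
  interpret q: restriction_quotient F r "FR_cong M X R" "FR M X R"
    by (simp_all add: restriction_quotient_def F.restriction_algebra_axioms[unfolded F_def A_def]
        FR_def FR_cong_def r_def F_def A_def)
  interpret qi: monoid_quotient I s "FI_cong M X R" "FI M X R"
    by (simp_all add: monoid_quotient_def I.monoid_axioms[unfolded I_def A_def]
        FI_def FI_cong_def s_def I_def A_def)
  interpret T: restriction_monoid T
    unfolding T_def by (rule inverse_monoid.restriction_monoid) (rule FI_inverse_monoid)
  interpret W: monoid "signed_words A" by (rule signed_words_monoid)
  interpret qw: monoid_quotient "signed_words A" "wagner A" "wagner_cong A" I
    by (simp_all add: monoid_quotient_def W.monoid_axioms I_def free_inverse_def)
  have carr: "carrier (inverse_restriction I) = carrier I"
    by (simp add: inverse_restriction_def)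
  have \<pi>: "\<pi> \<in> restriction_hom (inverse_restriction I) T"
    unfolding \<pi>_def T_def
    by (rule monoid_hom_inverse_restriction)
      (rule I.inverse_monoid_axioms FI_inverse_monoid qi.proj_hom)+
  note \<pi>' = restriction_homD[OF \<pi>, unfolded carr]
  have gI: "free_inverse_gen A m \<in> carrier I" if "m \<in> A" for m
    unfolding free_inverse_gen_def
    using that by (intro qw.class_closed) (simp add: signed_words_def)
  have gF: "free_gen A m \<in> carrier F" if "m \<in> A" for m
    using free_gen_closed that by (simp add: F_def)
  define g where "g = (\<lambda>m. \<pi> (free_inverse_gen A m))"
  have g: "g \<in> A \<rightarrow> carrier T" using gI \<pi>'(1) by (auto simp: g_def)
  define h where "h = free_extend T g"
  have h: "h \<in> restriction_hom F T"
    unfolding h_def F_def by (rule free_extend_hom) (rule T.restriction_monoid_axioms g)+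
  note h' = restriction_homD[OF h]
  have hg: "h (free_gen A m) = g m" if "m \<in> A" for m
    unfolding h_def by (rule free_extend_gen[OF T.restriction_monoid_axioms g that])
  have rel: "\<pi> x = \<pi> y" if "(x, y) \<in> s" "x \<in> carrier I" "y \<in> carrier I" for x y
    unfolding \<pi>_def
    by (rule qi.class_eq) (use that in \<open>auto simp: FI_cong_def s_def I_def A_def intro: monoid_cong.base\<close>)
  have resp: "h x = h y" if "(x, y) \<in> r" for x y
  proof -
    consider (unit) "x = free_gen A \<one>\<^bsub>M\<^esub>" "y = \<one>\<^bsub>F\<^esub>"
      | (mult) m n where "m \<in> A" "n \<in> A" "x = free_gen A m \<otimes>\<^bsub>F\<^esub> free_gen A n"
          "y = free_gen A (m \<otimes>\<^bsub>M\<^esub> n) \<otimes>\<^bsub>F\<^esub> (free_gen A m \<otimes>\<^bsub>F\<^esub> free_gen A n)\<^sup>\<star>\<^bsub>F\<^esub>"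
      | (ident) p q f where "(p, q) \<in> R" "f \<in> X \<rightarrow> carrier M"
          "x = identity_value M F (free_gen A) f p" "y = identity_value M F (free_gen A) f q"
      using \<open>(x, y) \<in> r\<close> unfolding r_def defining_relations_def A_def by blast
    then show ?thesis
    proof cases
      case unit
      have "\<pi> (free_inverse_gen A \<one>\<^bsub>M\<^esub>) = \<pi> \<one>\<^bsub>inverse_restriction I\<^esub>"
        by (rule rel) (use gI IR.unit_closed in
            \<open>auto simp: s_def defining_relations_def A_def inverse_restriction_def\<close>)
      then show ?thesis using unit h'(3) \<pi>'(3) hg[of "\<one>\<^bsub>M\<^esub>"] by (simp add: g_def A_def)
    next
      case (mult m n)
      let ?J = "inverse_restriction I" and ?m = "free_inverse_gen A m" and ?n = "free_inverse_gen A n"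
      have mn: "m \<otimes>\<^bsub>M\<^esub> n \<in> A" using mult by (simp add: A_def)
      have c: "?m \<in> carrier ?J" "?n \<in> carrier ?J" "free_inverse_gen A (m \<otimes>\<^bsub>M\<^esub> n) \<in> carrier ?J"
        using mult mn gI by (simp_all add: carr)
      have "\<pi> (?m \<otimes>\<^bsub>?J\<^esub> ?n) =
          \<pi> (free_inverse_gen A (m \<otimes>\<^bsub>M\<^esub> n) \<otimes>\<^bsub>?J\<^esub> (?m \<otimes>\<^bsub>?J\<^esub> ?n)\<^sup>\<star>\<^bsub>?J\<^esub>)"
      proof (rule rel)
        show "(?m \<otimes>\<^bsub>?J\<^esub> ?n, free_inverse_gen A (m \<otimes>\<^bsub>M\<^esub> n) \<otimes>\<^bsub>?J\<^esub> (?m \<otimes>\<^bsub>?J\<^esub> ?n)\<^sup>\<star>\<^bsub>?J\<^esub>) \<in> s"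
          unfolding s_def defining_relations_def using mult by (auto simp: A_def)
        show "?m \<otimes>\<^bsub>?J\<^esub> ?n \<in> carrier I"
          using IR.mult_closed[OF c(1,2)] by (simp add: carr)
        show "free_inverse_gen A (m \<otimes>\<^bsub>M\<^esub> n) \<otimes>\<^bsub>?J\<^esub> (?m \<otimes>\<^bsub>?J\<^esub> ?n)\<^sup>\<star>\<^bsub>?J\<^esub> \<in> carrier I"
          using IR.mult_closed[OF c(3) IR.star_closed[OF IR.mult_closed[OF c(1,2)]]]
          by (simp add: carr)
      qed
      then have "g m \<otimes>\<^bsub>T\<^esub> g n = g (m \<otimes>\<^bsub>M\<^esub> n) \<otimes>\<^bsub>T\<^esub> (g m \<otimes>\<^bsub>T\<^esub> g n)\<^sup>\<star>\<^bsub>T\<^esub>"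
        using c restriction_homD[OF \<pi>] unfolding g_def by simp
      then show ?thesis using mult mn gF hg h' by simp
    next
      case (ident p q f)
      have pq: "p \<in> carrier (free_restriction (lists X))" "q \<in> carrier (free_restriction (lists X))"
        using R ident by (auto simp: is_identity_def)
      have \<iota>: "free_gen A \<in> carrier M \<rightarrow> carrier F"
          "free_inverse_gen A \<in> carrier M \<rightarrow> carrier (inverse_restriction I)"
        using gF gI by (auto simp: A_def carr)
      have gA: "g \<in> carrier M \<rightarrow> carrier T" using g by (simp add: A_def)
      have val: "h (identity_value M F (free_gen A) f z) =
          \<pi> (identity_value M (inverse_restriction I) (free_inverse_gen A) f z)"
        if z: "z \<in> carrier (free_restriction (lists X))" for z
      proof -
        have "h (identity_value M F (free_gen A) f z) = identity_value M T (\<lambda>m. h (free_gen A m)) f z"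
          by (rule hom_identity_value[OF M F.restriction_monoid_axioms T.restriction_monoid_axioms
                \<iota>(1) ident(2) h z])
        also have "\<dots> = identity_value M T g f z"
        proof (rule free_restriction_hom_unique[OF _ _ _ z])
          have c: "(\<lambda>m. h (free_gen A m)) \<in> carrier M \<rightarrow> carrier T"
            using hg g by (auto simp: A_def)
          show "identity_value M T (\<lambda>m. h (free_gen A m)) f
              \<in> restriction_hom (free_restriction (lists X)) T"
            by (rule identity_value_hom[OF M T.restriction_monoid_axioms c ident(2)])
          show "identity_value M T g f \<in> restriction_hom (free_restriction (lists X)) T"
            by (rule identity_value_hom[OF M T.restriction_monoid_axioms gA ident(2)])
          show "identity_value M T (\<lambda>m. h (free_gen A m)) f (free_gen (lists X) u) =
              identity_value M T g f (free_gen (lists X) u)" if "u \<in> lists X" for u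
            using identity_value_gen[OF M T.restriction_monoid_axioms c ident(2) that]
              identity_value_gen[OF M T.restriction_monoid_axioms gA ident(2) that]
              word_value_closed[OF M ident(2) that] hg by (simp add: A_def)
        qed
        also have "\<dots> = \<pi> (identity_value M (inverse_restriction I) (free_inverse_gen A) f z)"
          unfolding g_def
          by (rule hom_identity_value[OF M IR.restriction_monoid_axioms T.restriction_monoid_axioms
                \<iota>(2) ident(2) \<pi> z, symmetric])
        finally show ?thesis .
      qed
      have "\<pi> (identity_value M (inverse_restriction I) (free_inverse_gen A) f p) =
          \<pi> (identity_value M (inverse_restriction I) (free_inverse_gen A) f q)"
      proof (rule rel)
        show "(identity_value M (inverse_restriction I) (free_inverse_gen A) f p,
            identity_value M (inverse_restriction I) (free_inverse_gen A) f q) \<in> s"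
          unfolding s_def defining_relations_def using ident by blast
      qed (use restriction_homD(1)[OF identity_value_hom[OF M IR.restriction_monoid_axioms
                \<iota>(2) ident(2)]] pq in \<open>simp_all add: carr\<close>)
      then show ?thesis using ident val pq by simp
    qed
  qed
  define \<psi> where "\<psi> = (\<lambda>a. the_elem (h ` a))"
  have "\<psi> \<in> restriction_hom (FR M X R) T"
    unfolding \<psi>_def by (rule q.lift_hom[OF h resp])
  moreover have "\<psi> (FR_gen M X R m) = FI_gen M X R m" if "m \<in> carrier M" for m
    using q.lift_class[OF h resp, of "free_gen A m"] gF[of m] hg[of m] that
    by (simp add: \<psi>_def FR_gen_def FI_gen_def g_def \<pi>_def A_def)
  ultimately show ?ex unfolding T_def by blast
qed (rule FR_hom_unique, auto)

subsection \<open>Independence of the choice of types\<close>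

theorem embeds_into_groupI:
  fixes M :: "('m, 'c) monoid_scheme" and G :: "('g, 'd) monoid_scheme"
  assumes G: "group G" and h: "h \<in> monoid_hom M G" and inj: "inj_on h (carrier M)"
  shows "embeds_into_group M"
proof -
  interpret G: group G by fact
  have hc: "h m \<in> carrier G" if "m \<in> carrier M" for m
    using h that by (auto simp: monoid_hom_def hom_def)
  define l where "l = (\<lambda>(m, b). if b then h m else inv\<^bsub>G\<^esub> h m)"
  define ev where "ev = (\<lambda>w. foldr (mult G) (map l w) \<one>\<^bsub>G\<^esub>)"
  define W where "W = lists (carrier M \<times> (UNIV :: bool set))"
  have lc: "l x \<in> carrier G" if "x \<in> carrier M \<times> UNIV" for x
    using that hc by (auto simp: l_def)
  have evc: "ev w \<in> carrier G" if "w \<in> W" for w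
    using that lc unfolding W_def ev_def by induction auto
  have ev_app: "ev (u @ v) = ev u \<otimes>\<^bsub>G\<^esub> ev v" if "u \<in> W" "v \<in> W" for u v
    using that(1) unfolding W_def
  proof induction
    case Nil then show ?case using evc[OF that(2)] by (simp add: ev_def)
  next
    case (Cons a u)
    then show ?case using lc[of a] evc[of u] evc[OF that(2)]
      by (simp add: ev_def G.m_assoc W_def)
  qed
  have ev_inv: "ev (word_inv u) = inv\<^bsub>G\<^esub> ev u" if "u \<in> W" for u
    using that unfolding W_def
  proof induction
    case Nil then show ?case by (simp add: ev_def)
  next
    case (Cons a u)
    obtain m b where a: "a = (m, b)" "m \<in> carrier M" using Cons by auto
    have "word_inv (a # u) = word_inv u @ [(m, \<not> b)]" by (simp add: word_inv_def a)
    moreover have "word_inv u \<in> W" "[(m, \<not> b)] \<in> W" using Cons a by (auto simp: W_def)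
    moreover have "ev [(m, \<not> b)] = inv\<^bsub>G\<^esub> l a" using a hc by (simp add: ev_def l_def)
    moreover have "ev (a # u) = l a \<otimes>\<^bsub>G\<^esub> ev u" by (simp add: ev_def)
    moreover have "l a \<in> carrier G" "ev u \<in> carrier G"
      using lc Cons evc by (auto simp: W_def)
    ultimately show ?case using ev_app Cons by (simp add: G.inv_mult_group)
  qed
  have Wc: "[] \<in> W" "\<And>u v. u \<in> W \<Longrightarrow> v \<in> W \<Longrightarrow> u @ v \<in> W" "\<And>u. u \<in> W \<Longrightarrow> word_inv u \<in> W"
    by (auto simp: W_def)
  define k where "k = (\<lambda>g. {w \<in> W. ev w = g})"
  define G' :: "('m \<times> bool) list set monoid" where
    "G' = \<lparr>carrier = (k \<circ> ev) ` W,
      mult = \<lambda>A B. k (ev ((SOME w. w \<in> A) @ (SOME w. w \<in> B))), one = k \<one>\<^bsub>G\<^esub>\<rparr>"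
  have some: "(SOME w. w \<in> k (ev u)) \<in> W \<and> ev (SOME w. w \<in> k (ev u)) = ev u" if "u \<in> W" for u
    using someI[of "\<lambda>w. w \<in> k (ev u)" u] that by (simp add: k_def)
  have mult: "k (ev u) \<otimes>\<^bsub>G'\<^esub> k (ev v) = k (ev u \<otimes>\<^bsub>G\<^esub> ev v)" if "u \<in> W" "v \<in> W" for u v
    using some that ev_app by (simp add: G'_def)
  have carr: "carrier G' = (\<lambda>u. k (ev u)) ` W" by (auto simp: G'_def)
  have one: "\<one>\<^bsub>G'\<^esub> = k (ev [])" by (simp add: G'_def ev_def)
  have mult': "k (ev u) \<otimes>\<^bsub>G'\<^esub> k (ev v) = k (ev (u @ v))" if "u \<in> W" "v \<in> W" for u v
    using mult ev_app that by simp
  have "group G'"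
  proof (rule groupI)
    show "\<one>\<^bsub>G'\<^esub> \<in> carrier G'" using Wc(1) by (auto simp: carr one)
    show "\<exists>y\<in>carrier G'. y \<otimes>\<^bsub>G'\<^esub> x = \<one>\<^bsub>G'\<^esub>" if "x \<in> carrier G'" for x
    proof -
      obtain u where u: "u \<in> W" "x = k (ev u)" using \<open>x \<in> carrier G'\<close> by (auto simp: carr)
      then have "k (ev (word_inv u)) \<otimes>\<^bsub>G'\<^esub> x = k (inv\<^bsub>G\<^esub> ev u \<otimes>\<^bsub>G\<^esub> ev u)"
        using Wc(3) mult[of "word_inv u" u] by (simp add: ev_inv)
      then have "k (ev (word_inv u)) \<otimes>\<^bsub>G'\<^esub> x = \<one>\<^bsub>G'\<^esub>"
        using evc[OF u(1)] by (simp add: one ev_def)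
      then show ?thesis using u Wc by (auto simp: carr)
    qed
  qed (auto simp: carr mult' one Wc)
  moreover have hW: "[(m, True)] \<in> W \<and> ev [(m, True)] = h m" if "m \<in> carrier M" for m
    using that hc by (simp add: W_def ev_def l_def)
  have "(\<lambda>m. k (h m)) \<in> monoid_hom M G'"
  proof -
    have "k (h m) \<in> carrier G'" if "m \<in> carrier M" for m
      using hW[OF that] by (auto simp: carr image_iff intro!: bexI[of _ "[(m, True)]"])
    moreover have "k (h (m \<otimes>\<^bsub>M\<^esub> n)) = k (h m) \<otimes>\<^bsub>G'\<^esub> k (h n)"
      if "m \<in> carrier M" "n \<in> carrier M" for m n
      using hW[OF that(1)] hW[OF that(2)] mult[of "[(m, True)]" "[(n, True)]"] h that
      by (simp add: monoid_hom_def hom_def)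
    moreover have "k (h \<one>\<^bsub>M\<^esub>) = \<one>\<^bsub>G'\<^esub>" using h by (simp add: monoid_hom_def G'_def)
    ultimately show ?thesis by (simp add: monoid_hom_def hom_def)
  qed
  moreover have "inj_on (\<lambda>m. k (h m)) (carrier M)"
  proof (rule inj_onI)
    fix m n assume mn: "m \<in> carrier M" "n \<in> carrier M" "k (h m) = k (h n)"
    then have "[(m, True)] \<in> k (h n)" using hW[of m] unfolding k_def by blast
    then have "h m = h n" using hW[OF mn(1)] unfolding k_def by simp
    then show "m = n" using inj mn by (auto dest: inj_onD)
  qed
  ultimately show ?thesis unfolding embeds_into_group_def by blast
qed

theorem admissible_satisfies:
  fixes X :: "'x set" and N :: "('n, 'c) monoid_scheme" and S :: "('s, 'd) restriction_scheme"
  assumes adm: "admissible X e" and N: "monoid N" and S: "restriction_monoid S"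
    and \<phi>: "\<phi> \<in> monoid_hom N S"
  shows "satisfies X N S \<phi> e"
  unfolding satisfies_def
proof
  fix f assume f: "f \<in> X \<rightarrow> carrier N"
  interpret N: monoid N by fact
  interpret S: restriction_monoid S by fact
  have e: "fst e \<in> carrier (free_restriction (lists X))" "snd e \<in> carrier (free_restriction (lists X))"
    using adm by (auto simp: admissible_def is_identity_def)
  define L :: "'x list monoid" where "L = \<lparr>carrier = lists X, mult = (@), one = []\<rparr>"
  have L: "monoid L" by (rule monoidI) (auto simp: L_def)
  define c where "c = (\<lambda>x::'x. [x])"
  have cX: "c \<in> X \<rightarrow> carrier L" by (auto simp: c_def L_def)
  have wc: "word_value L c u = u" for u
    by (induction u) (simp_all add: word_value_def L_def c_def)
  have \<phi>c: "\<phi> \<in> carrier N \<rightarrow> carrier S" using \<phi> by (auto simp: monoid_hom_def hom_def)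
  define v where "v = identity_value N S \<phi> f"
  have v: "v \<in> restriction_hom (free_restriction (lists X)) S"
    unfolding v_def by (rule identity_value_hom[OF N S \<phi>c f])
  note v' = restriction_homD[OF v]
  interpret F: restriction_monoid "free_restriction (lists X)" by (rule free_restriction_monoid)
  let ?F = "free_restriction (lists X)"
  define V where "V = v ` carrier ?F"
  have V: "\<one>\<^bsub>S\<^esub> \<in> V" "\<And>x y. x \<in> V \<Longrightarrow> y \<in> V \<Longrightarrow> x \<otimes>\<^bsub>S\<^esub> y \<in> V"
    "\<And>x. x \<in> V \<Longrightarrow> x\<^sup>\<star>\<^bsub>S\<^esub> \<in> V" "\<And>x. x \<in> V \<Longrightarrow> x\<^sup>\<oplus>\<^bsub>S\<^esub> \<in> V" "V \<subseteq> carrier S"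
  proof -
    show "\<one>\<^bsub>S\<^esub> \<in> V" unfolding V_def using v'(3) F.unit_closed by (metis imageI)
    show "x \<otimes>\<^bsub>S\<^esub> y \<in> V" if "x \<in> V" "y \<in> V" for x y
      using that unfolding V_def by (elim imageE) (metis v'(2) F.mult_closed imageI)
    show "x\<^sup>\<star>\<^bsub>S\<^esub> \<in> V" if "x \<in> V" for x
      using that unfolding V_def by (elim imageE) (metis v'(4) F.star_closed imageI)
    show "x\<^sup>\<oplus>\<^bsub>S\<^esub> \<in> V" if "x \<in> V" for x
      using that unfolding V_def by (elim imageE) (metis v'(5) F.plus_closed imageI)
    show "V \<subseteq> carrier S" unfolding V_def using v'(1) by auto
  qed
  define k where "k = inv_into (carrier ?F) v"
  have k: "v (k x) = x" if "x \<in> V" for x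
    using that unfolding V_def k_def by (simp add: f_inv_into_f)
  define S' :: "'x list rterm set restriction" where
    "S' = \<lparr>carrier = k ` V, mult = \<lambda>x y. k (v x \<otimes>\<^bsub>S\<^esub> v y), one = k \<one>\<^bsub>S\<^esub>,
      rstar = \<lambda>x. k ((v x)\<^sup>\<star>\<^bsub>S\<^esub>), rplus = \<lambda>x. k ((v x)\<^sup>\<oplus>\<^bsub>S\<^esub>)\<rparr>"
  have s': "carrier S' = k ` V" "\<one>\<^bsub>S'\<^esub> = k \<one>\<^bsub>S\<^esub>"
    "\<And>x y. x \<in> V \<Longrightarrow> y \<in> V \<Longrightarrow> k x \<otimes>\<^bsub>S'\<^esub> k y = k (x \<otimes>\<^bsub>S\<^esub> y)"
    "\<And>x. x \<in> V \<Longrightarrow> (k x)\<^sup>\<star>\<^bsub>S'\<^esub> = k (x\<^sup>\<star>\<^bsub>S\<^esub>)"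
    "\<And>x. x \<in> V \<Longrightarrow> (k x)\<^sup>\<oplus>\<^bsub>S'\<^esub> = k (x\<^sup>\<oplus>\<^bsub>S\<^esub>)"
    using k by (simp_all add: S'_def)
  have alg: "restriction_algebra S'"
    by unfold_locales (auto simp: s' V)
  have vS: "v \<in> restriction_hom S' S"
    by (rule restriction_homI) (use V(5) in \<open>auto simp: s' V(1-4) k\<close>)
  have "a = b" if ab: "(a, b) \<in> restriction_laws S'" for a b
  proof -
    have "(v a, v b) \<in> restriction_laws S" by (rule hom_laws[OF vS alg ab])
    then have "v a = v b" using S by (auto simp: restriction_monoid_iff_laws)
    moreover have "a \<in> k ` V \<and> b \<in> k ` V"
      using ab by cases (auto simp: s' V)
    ultimately show ?thesis using k by auto
  qed
  with alg have S': "restriction_monoid S'" by (auto simp: restriction_monoid_iff_laws)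
  have gen: "v (free_gen (lists X) u) = \<phi> (word_value N f u)" if "u \<in> lists X" for u
    unfolding v_def by (rule identity_value_gen[OF N S \<phi>c f that])
  have genV: "\<phi> (word_value N f u) \<in> V" if "u \<in> lists X" for u
    unfolding V_def using gen[OF that] free_gen_closed[OF that] by (metis imageI)
  have app: "\<phi> (word_value N f (u @ w)) = \<phi> (word_value N f u) \<otimes>\<^bsub>S\<^esub> \<phi> (word_value N f w)"
    if u: "u \<in> lists X" and w: "w \<in> lists X" for u w
  proof -
    have "word_value N f (u @ w) = word_value N f u \<otimes>\<^bsub>N\<^esub> word_value N f w"
      using u
    proof induction
      case Nil then show ?case using word_value_closed[OF N f w] by (simp add: word_value_def)
    next
      case (Cons a u)
      moreover have "f a \<in> carrier N" using f Cons by auto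
      ultimately show ?case
        using word_value_closed[OF N f w] word_value_closed[OF N f, of u]
        by (simp add: word_value_def N.m_assoc)
    qed
    then show ?thesis using \<phi> word_value_closed[OF N f] u w by (auto simp: monoid_hom_def hom_def)
  qed
  define \<theta> where "\<theta> = (\<lambda>u. k (\<phi> (word_value N f u)))"
  have \<theta>: "\<theta> \<in> monoid_hom L S'"
    using \<phi> genV app by (auto simp: monoid_hom_def hom_def L_def \<theta>_def s' word_value_def[of _ _ "[]"])
  have "satisfies X L S' \<theta> e" using adm L S' \<theta> by (auto simp: admissible_def)
  then have eq: "identity_value L S' \<theta> c (fst e) = identity_value L S' \<theta> c (snd e)"
    using cX by (auto simp: satisfies_def)
  have \<theta>c: "\<theta> \<in> carrier L \<rightarrow> carrier S'" using \<theta> by (auto simp: monoid_hom_def hom_def)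
  note iv = identity_value_hom[OF L S' \<theta>c cX]
  have "v (identity_value L S' \<theta> c p) = v p" if p: "p \<in> carrier ?F" for p
  proof (rule free_restriction_hom_unique[OF restriction_hom_compose[OF iv vS] v _ p])
    fix u assume u: "u \<in> lists X"
    show "v (identity_value L S' \<theta> c (free_gen (lists X) u)) = v (free_gen (lists X) u)"
      using identity_value_gen[OF L S' \<theta>c cX u] gen[OF u] genV[OF u] k by (simp add: wc \<theta>_def)
  qed
  then have "v (fst e) = v (snd e)" using eq e by metis
  then show "identity_value N S \<phi> f (fst e) = identity_value N S \<phi> f (snd e)"
    by (simp add: v_def)
qed

end

theory Submission
  imports Defs
begin

text \<open>Every element of \<open>FR M X R\<close> has the form \<open>e \<lfloor>m\<rfloor>\<close> with a projection \<open>e\<close>, and is determined by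
  \<open>m\<close> and its plus. The Munn representation of a restriction monoid by partial bijections of its
  projections is faithful on projections and takes values in an inverse monoid, so for
  \<open>FR M X R\<close> it factors through \<open>FI M X R\<close>; hence \<open>\<psi>\<close> is always injective on projections. If \<open>M\<close>
  embeds into a group \<open>G\<close>, the embedding extends to \<open>FI M X R\<close>, so \<open>\<psi> a\<close> also determines \<open>m\<close>.

  Conversely, every idempotent of \<open>FI M X R\<close> is the image of a projection. If \<open>[m]\<close> and \<open>[n]\<close> agree
  in the maximal group quotient of \<open>FI M X R\<close>, then \<open>[m] e = [n] e\<close> for an idempotent \<open>e\<close>, and
  injectivity lifts this to \<open>FR M X R\<close>, where it can be read in the quotient \<open>M\<close> that
  identifies all projections with 1. So \<open>M\<close> embeds into this group.\<close>

section \<open>Projections and the Munn representation\<close>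

text \<open>By \<open>plus_star\<close> and \<open>star_plus\<close>, the fixed points of star, the
  fixed points of plus and the values of either operation on a restriction monoid are the same
  elements, so one equation describes them all.\<close>

definition projections :: "('a, 'c) restriction_scheme \<Rightarrow> 'a set" where
  "projections S = {e \<in> carrier S. e\<^sup>\<star>\<^bsub>S\<^esub> = e}"

text \<open>Partial bijections are encoded as relations, so that inversion is
  \<open>converse\<close>. The composition \<open>(O)\<close> runs from left to right, which fits
  the right action \<open>e \<mapsto> (e \<otimes> s)\<^sup>\<star>\<close> used below.\<close>

definition symmetric_inverse :: "'a set \<Rightarrow> ('a \<times> 'a) set monoid" where
  "symmetric_inverse A =
    \<lparr>carrier = {r. r \<subseteq> A \<times> A \<and> single_valued r \<and> single_valued (r\<inverse>)},
     mult = (O), one = Id_on A\<rparr>"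

text \<open>Injectivity makes \<open>r O r\<inverse>\<close> the identity on the domain of
  \<open>r\<close>, and partial identities commute because their products are the identities on the
  intersections of their domains.\<close>

lemma symmetric_inverse_wagner: "wagner_monoid (symmetric_inverse A) converse"
proof -
  have sv: "single_valued (r O s)" if "single_valued r" "single_valued s" for r s :: "('a \<times> 'a) set"
    using that by (rule single_valued_relcomp)
  interpret monoid "symmetric_inverse A"
  proof (rule monoidI)
    show "\<one>\<^bsub>symmetric_inverse A\<^esub> \<in> carrier (symmetric_inverse A)"
      by (auto simp: symmetric_inverse_def single_valued_def)
  qed (auto simp: symmetric_inverse_def O_assoc converse_relcomp intro!: sv)
  have idem: "r O r\<inverse> = Id_on (Domain r)" if "single_valued (r\<inverse>)" for r :: "('a \<times> 'a) set"
    using that by (auto simp: single_valued_def)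
  show ?thesis
  proof unfold_locales
    fix r s assume "r \<in> carrier (symmetric_inverse A)" "s \<in> carrier (symmetric_inverse A)"
    then have "r O r\<inverse> = Id_on (Domain r)" "s O s\<inverse> = Id_on (Domain s)"
      using idem by (simp_all add: symmetric_inverse_def)
    then show "r \<otimes>\<^bsub>symmetric_inverse A\<^esub> r\<inverse> \<otimes>\<^bsub>symmetric_inverse A\<^esub> r = r"
      "r \<otimes>\<^bsub>symmetric_inverse A\<^esub> r\<inverse> \<otimes>\<^bsub>symmetric_inverse A\<^esub> (s \<otimes>\<^bsub>symmetric_inverse A\<^esub> s\<inverse>) =
       s \<otimes>\<^bsub>symmetric_inverse A\<^esub> s\<inverse> \<otimes>\<^bsub>symmetric_inverse A\<^esub> (r \<otimes>\<^bsub>symmetric_inverse A\<^esub> r\<inverse>)"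
      by (auto simp: symmetric_inverse_def)
  qed (auto simp: symmetric_inverse_def converse_relcomp)
qed

lemma symmetric_inverse_monoid: "inverse_monoid (symmetric_inverse A)"
  by (rule wagner_monoid.inverse_monoid) (rule symmetric_inverse_wagner)

lemma winv_symmetric_inverse:
  assumes "r \<in> carrier (symmetric_inverse A)"
  shows "winv (symmetric_inverse A) r = r\<inverse>"
proof -
  interpret wagner_monoid "symmetric_inverse A" converse by (rule symmetric_inverse_wagner)
  show ?thesis
    by (rule inverse_monoid.winv_unique[OF symmetric_inverse_monoid])
      (use assms in \<open>auto simp: mult_i_mult i_mult_i\<close>)
qed

text \<open>The graph of the isomorphism \<open>e \<mapsto> (e s)\<^sup>\<star>\<close>, with inverse \<open>f \<mapsto> (s f)\<^sup>\<oplus>\<close>, from the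
  projections below \<open>s\<^sup>\<oplus>\<close> to those below \<open>s\<^sup>\<star>\<close>, in a form that is symmetric in \<open>e\<close> and \<open>f\<close>.\<close>

definition munn :: "('a, 'c) restriction_scheme \<Rightarrow> 'a \<Rightarrow> ('a \<times> 'a) set" where
  "munn S s = {(e, f). e \<in> projections S \<and> f \<in> projections S \<and>
     e \<otimes>\<^bsub>S\<^esub> s = s \<otimes>\<^bsub>S\<^esub> f \<and> e \<otimes>\<^bsub>S\<^esub> s\<^sup>\<oplus>\<^bsub>S\<^esub> = e \<and> s\<^sup>\<star>\<^bsub>S\<^esub> \<otimes>\<^bsub>S\<^esub> f = f}"

section \<open>Arithmetic of projections in a restriction monoid\<close>

context restriction_monoid
begin

lemma projectionsD:
  assumes "e \<in> projections S"
  shows "e \<in> carrier S" "e\<^sup>\<star> = e" "e\<^sup>\<oplus> = e"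
  using assms star_plus[of e] by (auto simp: projections_def)

lemma star_projection [simp]: "x \<in> carrier S \<Longrightarrow> x\<^sup>\<star> \<in> projections S"
  using plus_star[of "x\<^sup>\<star>"] star_plus[of x] by (auto simp: projections_def)

lemma plus_projection [simp]: "x \<in> carrier S \<Longrightarrow> x\<^sup>\<oplus> \<in> projections S"
  by (auto simp: projections_def plus_star)

lemma proj_comm: "\<lbrakk>e \<in> projections S; f \<in> projections S\<rbrakk> \<Longrightarrow> e \<otimes> f = f \<otimes> e"
  using star_comm[of e f] projectionsD by simp

lemma proj_idem: "e \<in> projections S \<Longrightarrow> e \<otimes> e = e"
  using mult_star_self[of e] projectionsD by simp

lemma proj_mult:
  assumes e: "e \<in> projections S" and f: "f \<in> projections S"
  shows "e \<otimes> f \<in> projections S"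
  using mult_star_star[OF projectionsD(1)[OF e] projectionsD(1)[OF f]]
    projectionsD(1,2)[OF e] projectionsD(1,2)[OF f] by (simp add: projections_def)

lemma one_projection [simp]: "\<one> \<in> projections S"
  using mult_star_self[of \<one>] by (simp add: projections_def)

text \<open>The product \<open>x \<otimes> y\<close> absorbs \<open>y\<^sup>\<star>\<close> on its
  right. In the order of projections this puts \<open>(x \<otimes> y)\<^sup>\<star>\<close> below
  \<open>y\<^sup>\<star>\<close>; \<open>plus_mult_le\<close> is the mirror image.\<close>

lemma star_mult_le: "\<lbrakk>x \<in> carrier S; y \<in> carrier S\<rbrakk> \<Longrightarrow> y\<^sup>\<star> \<otimes> (x \<otimes> y)\<^sup>\<star> = (x \<otimes> y)\<^sup>\<star>"
  using mult_star_star[of "x \<otimes> y" y] mult_star_self[of y] star_comm[of "x \<otimes> y" y]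
  by (simp add: m_assoc)

lemma plus_mult_le: "\<lbrakk>x \<in> carrier S; y \<in> carrier S\<rbrakk> \<Longrightarrow> x\<^sup>\<oplus> \<otimes> (x \<otimes> y)\<^sup>\<oplus> = (x \<otimes> y)\<^sup>\<oplus>"
  using plus_mult_plus[of x "x \<otimes> y"] plus_mult_self[of x]
  by (simp flip: m_assoc)

text \<open>The law \<open>star_mult\<close> moves \<open>x\<^sup>\<star>\<close> to the other side
  of \<open>y\<close>, and \<open>star_mult_le\<close> absorbs the factor
  \<open>y\<^sup>\<star>\<close> that then arises. The mirror image is
  \<open>plus_mult_of_plus\<close>.\<close>

lemma star_star_mult: "\<lbrakk>x \<in> carrier S; y \<in> carrier S\<rbrakk> \<Longrightarrow> (x\<^sup>\<star> \<otimes> y)\<^sup>\<star> = (x \<otimes> y)\<^sup>\<star>"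
  using mult_star_star[of y "x \<otimes> y"] star_mult_le[of x y] star_mult[of x y] by simp

lemma plus_mult_of_plus: "\<lbrakk>x \<in> carrier S; y \<in> carrier S\<rbrakk> \<Longrightarrow> (x \<otimes> y\<^sup>\<oplus>)\<^sup>\<oplus> = (x \<otimes> y)\<^sup>\<oplus>"
  using plus_mult_plus[of "x \<otimes> y" x] plus_mult_le[of x y] plus_comm[of "x \<otimes> y" x] mult_plus[of x y]
  by simp

section \<open>The Munn representation by partial bijections of the projections\<close>

lemma munnD:
  assumes "(e, f) \<in> munn S s"
  shows "e \<in> projections S" "f \<in> projections S" "e \<otimes> s = s \<otimes> f" "e \<otimes> s\<^sup>\<oplus> = e" "s\<^sup>\<star> \<otimes> f = f"
  using assms by (auto simp: munn_def)

text \<open>Because \<open>e\<close> lies below \<open>s\<^sup>\<oplus>\<close> and \<open>f\<close>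
  below \<open>s\<^sup>\<star>\<close>, the plus of \<open>e \<otimes> s\<close> is \<open>e\<close>
  and the star of \<open>s \<otimes> f\<close> is \<open>f\<close>. The two products are equal, so
  each coordinate of a pair determines the other; hence the graph is single-valued in both
  directions.\<close>

lemma munn_eqs:
  assumes s: "s \<in> carrier S" and ef: "(e, f) \<in> munn S s"
  shows "e = (s \<otimes> f)\<^sup>\<oplus>" "f = (e \<otimes> s)\<^sup>\<star>"
proof -
  note d = munnD[OF ef]
  show "e = (s \<otimes> f)\<^sup>\<oplus>"
    using plus_mult_plus[of e s] projectionsD[OF d(1)] d s by simp
  show "f = (e \<otimes> s)\<^sup>\<star>"
    using mult_star_star[of s f] projectionsD[OF d(2)] d s by simp
qed

text \<open>The partner of \<open>e\<close> is forced by \<open>munn_eqs\<close>, and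
  \<open>star_mult\<close> is the equation that it has to satisfy. Together with
  \<open>munn_range\<close> this identifies domain and range as all projections below
  \<open>s\<^sup>\<oplus>\<close> and all those below \<open>s\<^sup>\<star>\<close>.\<close>

lemma munn_domain:
  assumes s: "s \<in> carrier S" and e: "e \<in> projections S" "e \<otimes> s\<^sup>\<oplus> = e"
  shows "(e, (e \<otimes> s)\<^sup>\<star>) \<in> munn S s"
proof -
  note e' = projectionsD[OF e(1)]
  have "e \<otimes> s = s \<otimes> (e \<otimes> s)\<^sup>\<star>" using star_mult[OF e'(1) s] unfolding e'(2) .
  then show ?thesis using star_mult_le[OF e'(1) s] e e'(1) s by (simp only: munn_def) simp
qed

lemma munn_range:
  assumes s: "s \<in> carrier S" and f: "f \<in> projections S" "s\<^sup>\<star> \<otimes> f = f"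
  shows "((s \<otimes> f)\<^sup>\<oplus>, f) \<in> munn S s"
proof -
  note f' = projectionsD[OF f(1)]
  have "s \<otimes> f = (s \<otimes> f)\<^sup>\<oplus> \<otimes> s" using mult_plus[OF s f'(1)] unfolding f'(3) .
  moreover have "(s \<otimes> f)\<^sup>\<oplus> \<otimes> s\<^sup>\<oplus> = (s \<otimes> f)\<^sup>\<oplus>"
    using plus_comm[of "s \<otimes> f" s] plus_mult_le[OF s f'(1)] s f'(1) by (metis mult_closed)
  ultimately show ?thesis using f f'(1) s by (simp add: munn_def)
qed

lemma munn_closed:
  assumes s: "s \<in> carrier S"
  shows "munn S s \<in> carrier (symmetric_inverse (projections S))"
proof -
  have "f = f'" if "(e, f) \<in> munn S s" "(e, f') \<in> munn S s" for e f f'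
    by (rule HOL.trans[OF munn_eqs(2)[OF s that(1)] munn_eqs(2)[OF s that(2), symmetric]])
  moreover have "e = e'" if "(e, f) \<in> munn S s" "(e', f) \<in> munn S s" for e e' f
    by (rule HOL.trans[OF munn_eqs(1)[OF s that(1)] munn_eqs(1)[OF s that(2), symmetric]])
  ultimately have "single_valued (munn S s)" "single_valued ((munn S s)\<inverse>)"
    unfolding single_valued_def by blast+
  moreover have "munn S s \<subseteq> projections S \<times> projections S" by (auto dest: munnD)
  ultimately show ?thesis by (simp add: symmetric_inverse_def)
qed

lemma munn_mult:
  assumes s: "s \<in> carrier S" and t: "t \<in> carrier S"
  shows "munn S (s \<otimes> t) = munn S s O munn S t"
proof (intro equalityI subrelI)
  fix e g assume eg: "(e, g) \<in> munn S (s \<otimes> t)"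
  note d = munnD[OF eg]
  note [simp] = projectionsD[OF d(1)] projectionsD[OF d(2)]
  \<comment> \<open>By \<open>munn_eqs\<close> no other projection can link \<open>e\<close> to
    \<open>g\<close>.\<close>
  define f where "f = (e \<otimes> s)\<^sup>\<star>"
  have f: "f \<in> projections S" unfolding f_def using s by simp
  note [simp] = projectionsD[OF f]
  have "e \<otimes> s\<^sup>\<oplus> = e \<otimes> ((s \<otimes> t)\<^sup>\<oplus> \<otimes> s\<^sup>\<oplus>)" using arg_cong[OF d(4), of "\<lambda>z. z \<otimes> s\<^sup>\<oplus>"] s t
    by (simp add: m_assoc)
  also have "(s \<otimes> t)\<^sup>\<oplus> \<otimes> s\<^sup>\<oplus> = (s \<otimes> t)\<^sup>\<oplus>"
    using plus_comm[of s "s \<otimes> t"] plus_mult_le[OF s t] s t by (metis mult_closed)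
  finally have es: "e \<otimes> s\<^sup>\<oplus> = e" using d(4) by simp
  then have ef: "(e, f) \<in> munn S s" unfolding f_def using munn_domain s d(1) by blast
  note d' = munnD[OF ef]
  have "t \<otimes> (f \<otimes> t)\<^sup>\<star> = f \<otimes> t"
    using star_mult[OF projectionsD(1)[OF f] t, symmetric] unfolding projectionsD(2)[OF f] .
  moreover have "(f \<otimes> t)\<^sup>\<star> = (e \<otimes> (s \<otimes> t))\<^sup>\<star>"
    using star_star_mult[of "e \<otimes> s" t] s t by (simp add: f_def m_assoc)
  ultimately have ft: "f \<otimes> t = t \<otimes> g" using munn_eqs(2)[OF _ eg] s t by simp
  \<comment> \<open>To get \<open>f\<close> below \<open>t\<^sup>\<oplus>\<close>, this is first
    shown after multiplication by \<open>s\<close> on the left. Taking the star then cancels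
    \<open>s\<close>, because \<open>f\<close> lies below \<open>s\<^sup>\<star>\<close>.\<close>
  have "e \<otimes> s \<otimes> t\<^sup>\<oplus> = (e \<otimes> s \<otimes> t)\<^sup>\<oplus> \<otimes> (e \<otimes> s)" by (rule mult_plus) (use s t in auto)
  also have "(e \<otimes> s \<otimes> t)\<^sup>\<oplus> = e" using munn_eqs(1)[OF _ eg] s t d(3) by (simp add: m_assoc)
  also have "e \<otimes> (e \<otimes> s) = e \<otimes> s" using proj_idem[OF d(1)] s by (simp flip: m_assoc)
  finally have "s \<otimes> f \<otimes> t\<^sup>\<oplus> = s \<otimes> f" unfolding d'(3) .
  then have "s \<otimes> (f \<otimes> t\<^sup>\<oplus>) = s \<otimes> f" using s t by (simp add: m_assoc)
  moreover have "(s \<otimes> (f \<otimes> t\<^sup>\<oplus>))\<^sup>\<star> = s\<^sup>\<star> \<otimes> (f \<otimes> t\<^sup>\<oplus>)"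
    using mult_star_star[of s "f \<otimes> t\<^sup>\<oplus>"] proj_mult[OF f plus_projection[OF t]] projectionsD s t
    by simp
  moreover have "(s \<otimes> f)\<^sup>\<star> = f" using munn_eqs(2)[OF s ef] unfolding d'(3) by (rule HOL.sym)
  ultimately have "f \<otimes> t\<^sup>\<oplus> = f" using d'(5) s t by (simp flip: m_assoc)
  moreover have "t\<^sup>\<star> \<otimes> g = g"
  proof -
    have "t\<^sup>\<star> \<otimes> ((s \<otimes> t)\<^sup>\<star> \<otimes> g) = (s \<otimes> t)\<^sup>\<star> \<otimes> g"
      using star_mult_le[OF s t] s t by (simp flip: m_assoc)
    then show ?thesis unfolding d(5) .
  qed
  ultimately have "(f, g) \<in> munn S t" using f d ft by (simp add: munn_def)
  then show "(e, g) \<in> munn S s O munn S t" using ef by blast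
next
  fix e g assume "(e, g) \<in> munn S s O munn S t"
  then obtain f where ef: "(e, f) \<in> munn S s" and fg: "(f, g) \<in> munn S t" by blast
  note d = munnD[OF ef] and d' = munnD[OF fg]
  note [simp] = projectionsD[OF d(1)] projectionsD[OF d(2)] projectionsD[OF d'(2)]
  have sft: "e \<otimes> (s \<otimes> t) = s \<otimes> (f \<otimes> t)"
    using arg_cong[OF d(3), of "\<lambda>z. z \<otimes> t"] s t by (simp add: m_assoc)
  also have "\<dots> = s \<otimes> t \<otimes> g" using d'(3) s t by (simp add: m_assoc)
  finally have comm: "e \<otimes> (s \<otimes> t) = s \<otimes> t \<otimes> g" .
  \<comment> \<open>Plus and star of the triple product are evaluated in two stages. The inner stage
    gives \<open>f\<close>, by \<open>munn_eqs\<close> for one of the two pairs; the outer stage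
    gives \<open>e\<close> or \<open>g\<close>, by \<open>munn_eqs\<close> for the other.\<close>
  have "e \<otimes> (s \<otimes> t)\<^sup>\<oplus> = (s \<otimes> (f \<otimes> t))\<^sup>\<oplus>"
    using plus_mult_plus[of e "s \<otimes> t"] sft s t by simp
  also have "\<dots> = (s \<otimes> (f \<otimes> t)\<^sup>\<oplus>)\<^sup>\<oplus>" using plus_mult_of_plus[of s "f \<otimes> t"] s t by simp
  also have "(f \<otimes> t)\<^sup>\<oplus> = f" by (rule munn_eqs(1)[OF t fg, folded d'(3), symmetric])
  also have "(s \<otimes> f)\<^sup>\<oplus> = e" by (rule munn_eqs(1)[OF s ef, symmetric])
  finally have 1: "e \<otimes> (s \<otimes> t)\<^sup>\<oplus> = e" .
  have "(s \<otimes> t)\<^sup>\<star> \<otimes> g = (s \<otimes> f \<otimes> t)\<^sup>\<star>"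
    using mult_star_star[of "s \<otimes> t" g] comm sft s t by (simp add: m_assoc)
  also have "\<dots> = ((s \<otimes> f)\<^sup>\<star> \<otimes> t)\<^sup>\<star>" using star_star_mult[of "s \<otimes> f" t] s t by simp
  also have "(s \<otimes> f)\<^sup>\<star> = f" by (rule munn_eqs(2)[OF s ef, unfolded d(3), symmetric])
  also have "(f \<otimes> t)\<^sup>\<star> = g" by (rule munn_eqs(2)[OF t fg, symmetric])
  finally show "(e, g) \<in> munn S (s \<otimes> t)" using d d' comm 1 by (simp add: munn_def)
qed

text \<open>Since \<open>e\<close> is its own star and plus, both bounds in the graph refer to
  \<open>e\<close>, and they force the two coordinates to coincide. The domain is the principal
  ideal below \<open>e\<close>.\<close>

lemma munn_projection:
  assumes e: "e \<in> projections S"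
  shows "munn S e = Id_on {f \<in> projections S. f \<otimes> e = f}"
proof (intro equalityI subrelI)
  note e' = projectionsD[OF e]
  fix f g assume "(f, g) \<in> munn S e"
  then have fg: "f \<in> projections S" "g \<in> projections S" "f \<otimes> e = e \<otimes> g" "f \<otimes> e = f" "e \<otimes> g = g"
    using munnD[of f g e] e' by simp_all
  then have "f = g" by simp
  with fg show "(f, g) \<in> Id_on {f \<in> projections S. f \<otimes> e = f}" by auto
next
  note e' = projectionsD[OF e]
  fix f g assume "(f, g) \<in> Id_on {f \<in> projections S. f \<otimes> e = f}"
  then have "f = g" "f \<in> projections S" "f \<otimes> e = f" by auto
  moreover from this have "e \<otimes> f = f" using proj_comm[OF e, of f] by simp
  ultimately show "(f, g) \<in> munn S e" using e' by (simp add: munn_def)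
qed

text \<open>Star and plus in the target are the identities on the range and on the domain of a
  relation. By \<open>munn_range\<close> and \<open>munn_domain\<close> these sets are the ideals
  below \<open>s\<^sup>\<star>\<close> and \<open>s\<^sup>\<oplus>\<close>, and
  \<open>munn_projection\<close> recognizes the identities on them as images of projections.\<close>

lemma munn_hom: "munn S \<in> restriction_hom S (inverse_restriction (symmetric_inverse (projections S)))"
proof (rule restriction_homI)
  fix s assume s: "s \<in> carrier S"
  have c: "munn S s \<in> carrier (symmetric_inverse (projections S))" using munn_closed s .
  then show "munn S s \<in> carrier (inverse_restriction (symmetric_inverse (projections S)))"
    by (simp add: inverse_restriction_def)
  have sv: "single_valued (munn S s)" "single_valued ((munn S s)\<inverse>)"
    using c by (auto simp: symmetric_inverse_def)
  have "(munn S s)\<inverse> O munn S s = Id_on {f \<in> projections S. f \<otimes> s\<^sup>\<star> = f}"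
  proof (intro equalityI subsetI)
    fix x assume "x \<in> (munn S s)\<inverse> O munn S s"
    then obtain e f where x: "x = (f, f)" "(e, f) \<in> munn S s" using sv by (blast dest: single_valuedD)
    then have "f \<in> projections S" "f \<otimes> s\<^sup>\<star> = f"
      using munnD(2,5)[OF x(2)] proj_comm[of f "s\<^sup>\<star>"] s by simp_all
    then show "x \<in> Id_on {f \<in> projections S. f \<otimes> s\<^sup>\<star> = f}" using x(1) by auto
  next
    fix x assume "x \<in> Id_on {f \<in> projections S. f \<otimes> s\<^sup>\<star> = f}"
    then obtain f where x: "x = (f, f)" "f \<in> projections S" "s\<^sup>\<star> \<otimes> f = f"
      using proj_comm[of _ "s\<^sup>\<star>"] s by auto
    then show "x \<in> (munn S s)\<inverse> O munn S s" using munn_range[OF s x(2,3)] by blast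
  qed
  then show "munn S (s\<^sup>\<star>) = (munn S s)\<^sup>\<star>\<^bsub>inverse_restriction (symmetric_inverse (projections S))\<^esub>"
    using s c munn_projection[of "s\<^sup>\<star>"]
    by (simp add: inverse_restriction_def winv_symmetric_inverse) (simp add: symmetric_inverse_def)
  have "munn S s O (munn S s)\<inverse> = Id_on {f \<in> projections S. f \<otimes> s\<^sup>\<oplus> = f}"
  proof (intro equalityI subsetI)
    fix x assume "x \<in> munn S s O (munn S s)\<inverse>"
    then obtain e f where x: "x = (e, e)" "(e, f) \<in> munn S s" using sv by (blast dest: single_valuedD)
    then show "x \<in> Id_on {f \<in> projections S. f \<otimes> s\<^sup>\<oplus> = f}" using munnD(1,4)[OF x(2)] by auto
  next
    fix x assume "x \<in> Id_on {f \<in> projections S. f \<otimes> s\<^sup>\<oplus> = f}"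
    then obtain e where x: "x = (e, e)" "e \<in> projections S" "e \<otimes> s\<^sup>\<oplus> = e" by auto
    then show "x \<in> munn S s O (munn S s)\<inverse>" using munn_domain[OF s x(2,3)] by blast
  qed
  then show "munn S (s\<^sup>\<oplus>) = (munn S s)\<^sup>\<oplus>\<^bsub>inverse_restriction (symmetric_inverse (projections S))\<^esub>"
    using s c munn_projection[of "s\<^sup>\<oplus>"]
    by (simp add: inverse_restriction_def winv_symmetric_inverse) (simp add: symmetric_inverse_def)
next
  show "munn S \<one> = \<one>\<^bsub>inverse_restriction (symmetric_inverse (projections S))\<^esub>"
    using munn_projection[of \<one>] projectionsD(1)
    by (auto simp: inverse_restriction_def symmetric_inverse_def)
qed (simp add: munn_mult inverse_restriction_def symmetric_inverse_def)

text \<open>A projection is recovered from its image as the largest element of the domain.\<close>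

lemma munn_inj: "inj_on (munn S) (projections S)"
proof (rule inj_onI)
  fix e f assume e: "e \<in> projections S" and f: "f \<in> projections S" and ef: "munn S e = munn S f"
  have "(e, e) \<in> munn S e" "(f, f) \<in> munn S f"
    unfolding munn_projection[OF e] munn_projection[OF f] using e f proj_idem by auto
  then have "(e, e) \<in> munn S f" "(f, f) \<in> munn S e" using ef by simp_all
  then have "e \<otimes> f = e" "f \<otimes> e = f"
    unfolding munn_projection[OF e] munn_projection[OF f] by auto
  then show "e = f" using proj_comm[OF e f] by simp
qed

end

section \<open>Inverse monoids and their group quotients\<close>

lemma (in group) inverse_monoid: "inverse_monoid G"
proof unfold_locales
  fix x assume x: "x \<in> carrier G"
  have "y = inv x" if "y \<in> carrier G" "x \<otimes> y \<otimes> x = x" for y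
    using that x by (metis inv_equality m_closed r_cancel_one' inv_comm)
  then show "\<exists>!y. y \<in> carrier G \<and> x \<otimes> y \<otimes> x = x \<and> y \<otimes> x \<otimes> y = y"
    using x by (intro ex1I[of _ "inv x"]) auto
qed

lemma (in group) winv_eq_inv: "x \<in> carrier G \<Longrightarrow> winv G x = inv x"
  by (rule inverse_monoid.winv_unique[OF inverse_monoid]) auto

lemma monoid_hom_winv:
  assumes S: "inverse_monoid S" and T: "inverse_monoid T" and h: "h \<in> monoid_hom S T"
    and x: "x \<in> carrier S"
  shows "h (winv S x) = winv T (h x)"
proof -
  interpret S: inverse_monoid S by fact
  interpret T: inverse_monoid T by fact
  have c: "h y \<in> carrier T" if "y \<in> carrier S" for y
    using h that by (auto simp: monoid_hom_def hom_def)
  have m: "h (y \<otimes>\<^bsub>S\<^esub> z) = h y \<otimes>\<^bsub>T\<^esub> h z" if "y \<in> carrier S" "z \<in> carrier S" for y z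
    using h that by (auto simp: monoid_hom_def hom_def)
  have "winv T (h x) = h (winv S x)"
    by (rule T.winv_unique) (use c x S.winv_r[OF x] S.winv_l[OF x] in \<open>auto simp flip: m\<close>)
  then show ?thesis by simp
qed

lemma inverse_restriction_simps [simp]:
  "carrier (inverse_restriction S) = carrier S"
  "mult (inverse_restriction S) = mult S"
  "one (inverse_restriction S) = one S"
  "rstar (inverse_restriction S) x = winv S x \<otimes>\<^bsub>S\<^esub> x"
  "rplus (inverse_restriction S) x = x \<otimes>\<^bsub>S\<^esub> winv S x"
  by (simp_all add: inverse_restriction_def)

section \<open>The least group congruence of an inverse monoid\<close>

definition idempotent_relation :: "('a, 'c) monoid_scheme \<Rightarrow> ('a \<times> 'a) set" where
  "idempotent_relation S = {(e, \<one>\<^bsub>S\<^esub>) | e. e \<in> carrier S \<and> e \<otimes>\<^bsub>S\<^esub> e = e}"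

context inverse_monoid
begin

text \<open>Agreement after right multiplication by some idempotent is itself a congruence that
  contains the generating pairs. Transitivity holds since idempotents commute; compatibility with
  products needs an idempotent to be carried past a factor by conjugation.\<close>

lemma idempotent_cong_imp:
  assumes "(x, y) \<in> monoid_cong S (idempotent_relation S)"
  shows "x \<in> carrier S \<and> y \<in> carrier S \<and>
    (\<exists>e. e \<in> carrier S \<and> e \<otimes> e = e \<and> x \<otimes> e = y \<otimes> e)"
  using assms
proof induction
  case (base x y)
  then have "x \<otimes> x = x" "y = \<one>" by (auto simp: idempotent_relation_def)
  then show ?case using base by (intro conjI exI[of _ x]) auto
next
  case (refl x)
  then show ?case by (intro conjI exI[of _ \<one>]) auto
next
  case (sym x y)
  then show ?case by metis
next
  case (trans x y z)
  then obtain e f where c: "x \<in> carrier S" "y \<in> carrier S" "z \<in> carrier S" "e \<in> carrier S" "f \<in> carrier S"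
    and e: "e \<otimes> e = e" "x \<otimes> e = y \<otimes> e" and f: "f \<otimes> f = f" "y \<otimes> f = z \<otimes> f"
    by auto
  have "x \<otimes> (e \<otimes> f) = y \<otimes> e \<otimes> f" using c e by (simp flip: m_assoc)
  also have "\<dots> = y \<otimes> f \<otimes> e" using c idem_comm[OF c(4,5) e(1) f(1)] by (simp add: m_assoc)
  also have "\<dots> = z \<otimes> (e \<otimes> f)" using c f idem_comm[OF c(4,5) e(1) f(1)] by (simp add: m_assoc)
  finally show ?case using c idem_mult[OF c(4,5) e(1) f(1)] by blast
next
  case (mult x x' y y')
  then obtain e f where c: "x \<in> carrier S" "x' \<in> carrier S" "y \<in> carrier S" "y' \<in> carrier S"
      "e \<in> carrier S" "f \<in> carrier S"
    and e: "e \<otimes> e = e" "x \<otimes> e = x' \<otimes> e" and f: "f \<otimes> f = f" "y \<otimes> f = y' \<otimes> f"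
    by auto
  \<comment> \<open>The idempotent \<open>e\<close> is needed between \<open>x\<close> and
    \<open>y\<close>, but may only be multiplied on the right. The idempotent \<open>p\<close> is
    its conjugate by \<open>y\<close>, and \<open>y \<otimes> p = e \<otimes> y\<close> carries it
    across; \<open>q\<close> does the same for \<open>y'\<close>.\<close>
  define u where "u = e \<otimes> y"
  define v where "v = e \<otimes> y'"
  define p where "p = winv S u \<otimes> u"
  define q where "q = winv S v \<otimes> v"
  have cc: "u \<in> carrier S" "v \<in> carrier S" "p \<in> carrier S" "q \<in> carrier S"
    using c by (auto simp: u_def v_def p_def q_def)
  have pq: "p \<otimes> p = p" "q \<otimes> q = q" using cc idem_l by (simp_all add: p_def q_def)
  have conj: "y \<otimes> (winv S (e \<otimes> y) \<otimes> (e \<otimes> y)) = e \<otimes> y" if y: "y \<in> carrier S" for y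
  proof -
    have we: "winv S e = e" using idem_winv[OF c(5) e(1)] .
    have "y \<otimes> (winv S (e \<otimes> y) \<otimes> (e \<otimes> y)) = y \<otimes> winv S y \<otimes> (e \<otimes> e) \<otimes> y"
      using winv_mult[OF c(5) y] we c y by (simp add: m_assoc)
    also have "\<dots> = e \<otimes> (y \<otimes> winv S y \<otimes> y)"
      using idem_comm[OF _ c(5) idem_r[OF y] e(1)] e(1) c y by (simp add: m_assoc)
    finally show ?thesis using winv_r y by simp
  qed
  have xp: "x \<otimes> y \<otimes> p = x \<otimes> u"
  proof -
    have "x \<otimes> y \<otimes> p = x \<otimes> (y \<otimes> (winv S (e \<otimes> y) \<otimes> (e \<otimes> y)))"
      using c by (simp add: p_def u_def m_assoc)
    then show ?thesis using conj c by (simp add: u_def)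
  qed
  have xq: "x' \<otimes> y' \<otimes> q = x' \<otimes> v"
  proof -
    have "x' \<otimes> y' \<otimes> q = x' \<otimes> (y' \<otimes> (winv S (e \<otimes> y') \<otimes> (e \<otimes> y')))"
      using c by (simp add: q_def v_def m_assoc)
    then show ?thesis using conj c by (simp add: v_def)
  qed
  have uv: "x \<otimes> u \<otimes> f = x' \<otimes> v \<otimes> f"
  proof -
    have "x \<otimes> u \<otimes> f = x \<otimes> e \<otimes> (y \<otimes> f)" using c by (simp add: u_def m_assoc)
    also have "\<dots> = x' \<otimes> e \<otimes> (y' \<otimes> f)" using e f by simp
    also have "\<dots> = x' \<otimes> v \<otimes> f" using c by (simp add: v_def m_assoc)
    finally show ?thesis .
  qed
  \<comment> \<open>The three idempotents commute, so \<open>g\<close> can be read as starting with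
    \<open>p\<close> or with \<open>q\<close>. This turns the two products into
    \<open>x \<otimes> u \<otimes> f \<otimes> q\<close> and
    \<open>x' \<otimes> v \<otimes> f \<otimes> p\<close>; after \<open>uv\<close> is applied,
    \<open>v\<close> absorbs \<open>q\<close> and \<open>u\<close> absorbs \<open>p\<close>.\<close>
  define g where "g = p \<otimes> (f \<otimes> q)"
  have fq: "f \<otimes> q = q \<otimes> f" and pf: "p \<otimes> f = f \<otimes> p" and pq': "p \<otimes> q = q \<otimes> p"
    using idem_comm c cc pq f by simp_all
  have gq: "g = q \<otimes> (f \<otimes> p)"
  proof -
    have "g = p \<otimes> q \<otimes> f" using fq cc c by (simp add: g_def m_assoc)
    also have "\<dots> = q \<otimes> (p \<otimes> f)" using pq' cc c by (simp add: m_assoc)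
    finally show ?thesis using pf by simp
  qed
  have "x \<otimes> y \<otimes> g = x \<otimes> u \<otimes> f \<otimes> q" using xp c cc by (simp add: g_def flip: m_assoc)
  moreover have "x' \<otimes> y' \<otimes> g = x' \<otimes> v \<otimes> f \<otimes> p" using xq c cc by (simp add: gq flip: m_assoc)
  moreover have "x \<otimes> u \<otimes> f \<otimes> p = x \<otimes> u \<otimes> f"
  proof -
    have "x \<otimes> u \<otimes> f \<otimes> p = x \<otimes> (u \<otimes> p) \<otimes> f" using pf c cc by (simp add: m_assoc)
    moreover have "u \<otimes> p = u" using winv_r[OF cc(1)] cc by (simp add: p_def m_assoc)
    ultimately show ?thesis by simp
  qed
  moreover have "x' \<otimes> v \<otimes> f \<otimes> q = x' \<otimes> v \<otimes> f"
  proof -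
    have "x' \<otimes> v \<otimes> f \<otimes> q = x' \<otimes> (v \<otimes> q) \<otimes> f" using fq c cc by (simp add: m_assoc)
    moreover have "v \<otimes> q = v" using winv_r[OF cc(2)] cc by (simp add: q_def m_assoc)
    ultimately show ?thesis by simp
  qed
  ultimately have "x \<otimes> y \<otimes> g = x' \<otimes> y' \<otimes> g" using uv by simp
  moreover have "g \<in> carrier S" "g \<otimes> g = g"
    using idem_mult[OF cc(3) _ pq(1) idem_mult[OF c(6) cc(4) f(1) pq(2)]] c cc by (simp_all add: g_def)
  ultimately show ?case using c by blast
qed

text \<open>The class of \<open>winv S x\<close> is a left inverse of the class of \<open>x\<close>,
  because \<open>winv S x \<otimes> x\<close> is idempotent and so is identified with the
  unit.\<close>

lemma group_quotient: "group (quot_monoid S (monoid_cong S (idempotent_relation S)))" (is "group ?Q")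
proof -
  interpret q: monoid_quotient S "idempotent_relation S" "monoid_cong S (idempotent_relation S)" ?Q
    by (simp_all add: monoid_quotient_def monoid_axioms)
  interpret Q: monoid ?Q by (rule q.quot_monoid)
  show ?thesis
  proof (rule groupI)
    fix a assume "a \<in> carrier ?Q"
    then obtain x where x: "x \<in> carrier S" "a = monoid_cong S (idempotent_relation S) `` {x}"
      by (rule q.carrier_cases)
    have "(winv S x \<otimes> x, \<one>) \<in> monoid_cong S (idempotent_relation S)"
      by (rule monoid_cong.base) (use x idem_l in \<open>auto simp: idempotent_relation_def\<close>)
    then show "\<exists>b\<in>carrier ?Q. b \<otimes>\<^bsub>?Q\<^esub> a = \<one>\<^bsub>?Q\<^esub>"
      using x q.class_eq by (intro bexI[of _ "monoid_cong S (idempotent_relation S) `` {winv S x}"]) auto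
  qed (use Q.m_assoc Q.l_one Q.m_closed Q.one_closed in \<open>auto simp del: q.ops\<close>)
qed

end

section \<open>Universal properties\<close>

context monoid_quotient
begin

lemma hom_respects:
  assumes h: "h \<in> monoid_hom S T"
    and r: "\<And>x y. \<lbrakk>(x, y) \<in> r; x \<in> carrier S; y \<in> carrier S\<rbrakk> \<Longrightarrow> h x = h y"
    and "(x, y) \<in> E"
  shows "h x = h y"
proof -
  have sub: "E \<subseteq> carrier S \<times> carrier S" using equiv_E by (simp add: equiv_def)
  have m: "h (x \<otimes> y) = h x \<otimes>\<^bsub>T\<^esub> h y" if "x \<in> carrier S" "y \<in> carrier S" for x y
    using h that by (auto simp: monoid_hom_def hom_def)
  from \<open>(x, y) \<in> E\<close> have "(x, y) \<in> E \<and> h x = h y"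
    unfolding E_def
  proof induction
    case (base x y) then show ?case using r by (auto intro: monoid_cong.intros)
  next
    case (mult x x' y y')
    moreover have "x \<in> carrier S" "x' \<in> carrier S" "y \<in> carrier S" "y' \<in> carrier S"
      using mult sub unfolding E_def by blast+
    ultimately show ?case using m by (auto intro: monoid_cong.intros)
  qed (auto intro: monoid_cong.intros)
  then show ?thesis ..
qed

lemma lift_hom:
  assumes h: "h \<in> monoid_hom S T"
    and r: "\<And>x y. \<lbrakk>(x, y) \<in> r; x \<in> carrier S; y \<in> carrier S\<rbrakk> \<Longrightarrow> h x = h y"
  obtains k where "k \<in> monoid_hom Q T" "\<And>x. x \<in> carrier S \<Longrightarrow> k (E `` {x}) = h x"
proof
  define k where "k = (\<lambda>a. the_elem (h ` a))"
  show kE: "k (E `` {x}) = h x" if x: "x \<in> carrier S" for x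
  proof -
    have "h ` (E `` {x}) = {h x}"
      using hom_respects[OF h r] x equiv_class_self[OF equiv_E]
      by (auto simp: image_iff Bex_def)
    then show ?thesis by (simp add: k_def)
  qed
  have h': "h x \<in> carrier T" "h (x \<otimes> y) = h x \<otimes>\<^bsub>T\<^esub> h y" "h \<one> = \<one>\<^bsub>T\<^esub>"
    if "x \<in> carrier S" "y \<in> carrier S" for x y
    using h that by (auto simp: monoid_hom_def hom_def)
  show "k \<in> monoid_hom Q T"
    unfolding monoid_hom_def hom_def
    by (auto elim!: carrier_cases simp: kE h' h'(3)[OF one_closed one_closed])
qed

end

lemma free_inverse_quotient: "monoid_quotient (signed_words A)"
  by (simp add: monoid_quotient_def signed_words_monoid)

text \<open>Words are evaluated in \<open>T\<close> with negative letters sent to inverses. By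
  \<open>ev_inv\<close> the formal inverse of a word evaluates to the inverse of its value, so the
  Wagner pairs become regularity and the commutation of idempotents, both true in
  \<open>T\<close>.\<close>

lemma free_inverse_lift:
  assumes T: "inverse_monoid T" and g: "g \<in> A \<rightarrow> carrier T"
  obtains k where "k \<in> monoid_hom (free_inverse A) T"
    "\<And>a. a \<in> A \<Longrightarrow> k (free_inverse_gen A a) = g a"
proof -
  interpret T: inverse_monoid T by fact
  interpret q: monoid_quotient "signed_words A" "wagner A" "wagner_cong A" "free_inverse A"
    by (simp_all add: free_inverse_quotient free_inverse_def)
  define l where "l = (\<lambda>(a, b). if b then g a else winv T (g a))"
  define ev where "ev = (\<lambda>w. foldr (mult T) (map l w) \<one>\<^bsub>T\<^esub>)"
  define W where "W = lists (A \<times> (UNIV :: bool set))"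
  have lc: "l x \<in> carrier T" if "x \<in> A \<times> UNIV" for x
    using that T.winv_closed[OF funcset_mem[OF g]] funcset_mem[OF g] by (auto simp: l_def)
  have evc: "ev w \<in> carrier T" if "w \<in> W" for w
    using that lc unfolding W_def ev_def by induction auto
  have ev_app: "ev (u @ v) = ev u \<otimes>\<^bsub>T\<^esub> ev v" if "u \<in> W" "v \<in> W" for u v
    using that(1) unfolding W_def
  proof induction
    case Nil then show ?case using evc[OF that(2)] by (simp add: ev_def)
  next
    case (Cons a u)
    then show ?case using lc[of a] evc[of u] evc[OF that(2)]
      by (simp add: ev_def T.m_assoc W_def)
  qed
  have ev_inv: "ev (word_inv u) = winv T (ev u)" if "u \<in> W" for u
    using that unfolding W_def
  proof induction
    case Nil then show ?case by (simp add: ev_def T.idem_winv)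
  next
    case (Cons a u)
    obtain m b where a: "a = (m, b)" "m \<in> A" using Cons by auto
    have gm: "g m \<in> carrier T" using a g by auto
    have "word_inv (a # u) = word_inv u @ [(m, \<not> b)]" by (simp add: word_inv_def a)
    moreover have "word_inv u \<in> W" "[(m, \<not> b)] \<in> W" using Cons a by (auto simp: W_def)
    moreover have "ev [(m, \<not> b)] = winv T (l a)" using a gm by (simp add: ev_def l_def T.winv_winv)
    moreover have "ev (a # u) = l a \<otimes>\<^bsub>T\<^esub> ev u" by (simp add: ev_def)
    moreover have "l a \<in> carrier T" "ev u \<in> carrier T"
      using lc Cons evc by (auto simp: W_def)
    ultimately show ?case using ev_app Cons by (simp add: T.winv_mult)
  qed
  have Wc: "\<And>u v. u \<in> W \<Longrightarrow> v \<in> W \<Longrightarrow> u @ v \<in> W" "\<And>u. u \<in> W \<Longrightarrow> word_inv u \<in> W"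
    by (auto simp: W_def)
  have "ev [] = \<one>\<^bsub>T\<^esub>" by (simp add: ev_def)
  then have ev: "ev \<in> monoid_hom (signed_words A) T"
    using evc ev_app by (auto simp: monoid_hom_def hom_def signed_words_def W_def)
  have "ev x = ev y" if xy: "(x, y) \<in> wagner A" for x y
  proof -
    consider u where "u \<in> W" "x = u @ word_inv u @ u" "y = u"
      | u v where "u \<in> W" "v \<in> W" "x = u @ word_inv u @ v @ word_inv v"
        "y = v @ word_inv v @ u @ word_inv u"
      using xy unfolding wagner_def W_def by blast
    then show ?thesis
    proof cases
      case 1
      then show ?thesis
        using ev_app ev_inv Wc evc T.winv_r by (simp flip: T.m_assoc)
    next
      case (2 u v)
      then show ?thesis
        using ev_app ev_inv Wc evc T.idem_comm[OF _ _ T.idem_r[of "ev u"] T.idem_r[of "ev v"]]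
        by (simp add: T.m_assoc)
    qed
  qed
  then obtain k where k: "k \<in> monoid_hom (free_inverse A) T"
    "\<And>w. w \<in> carrier (signed_words A) \<Longrightarrow> k (wagner_cong A `` {w}) = ev w"
    using q.lift_hom[OF ev] by metis
  show thesis
  proof (rule that[OF k(1)])
    fix a assume "a \<in> A"
    then show "k (free_inverse_gen A a) = g a"
      using k(2)[of "[(a, True)]"] g
      by (auto simp: free_inverse_gen_def signed_words_def ev_def l_def Pi_iff)
  qed
qed

lemma free_inverse_gen_closed: "a \<in> A \<Longrightarrow> free_inverse_gen A a \<in> carrier (free_inverse A)"
proof -
  interpret q: monoid_quotient "signed_words A" "wagner A" "wagner_cong A" "free_inverse A"
    by (simp_all add: free_inverse_quotient free_inverse_def)
  show "a \<in> A \<Longrightarrow> ?thesis"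
    unfolding free_inverse_gen_def by (rule q.class_closed) (simp add: signed_words_def)
qed

text \<open>Since \<open>winv\<close> is given by a description, the class of the negative letter
  has to be matched with it. The two equations that characterize the inverse are Wagner pairs for
  words of one letter.\<close>

lemma winv_free_inverse_gen:
  assumes a: "a \<in> A"
  shows "winv (free_inverse A) (free_inverse_gen A a) = wagner_cong A `` {[(a, False)]}"
proof -
  interpret q: monoid_quotient "signed_words A" "wagner A" "wagner_cong A" "free_inverse A"
    by (simp_all add: free_inverse_quotient free_inverse_def)
  have s: "carrier (signed_words A) = lists (A \<times> UNIV)" "mult (signed_words A) = (@)"
    by (simp_all add: signed_words_def)
  have *: "wagner_cong A `` {[(a, b), (a, \<not> b), (a, b)]} = wagner_cong A `` {[(a, b)]}" for b
  proof (rule q.class_eq, rule monoid_cong.base)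
    have "([(a, b)] @ word_inv [(a, b)] @ [(a, b)], [(a, b)]) \<in> wagner A"
      unfolding wagner_def by (rule UnI1) (use a in auto)
    then show "([(a, b), (a, \<not> b), (a, b)], [(a, b)]) \<in> wagner A" by (simp add: word_inv_def)
  qed (use a in \<open>auto simp: s\<close>)
  show ?thesis
    unfolding free_inverse_gen_def
    by (rule inverse_monoid.winv_unique[OF free_inverse_monoid])
      (use a *[of True] *[of False] in \<open>simp_all add: s\<close>)
qed

text \<open>Induction along a word, with negative letters rephrased through \<open>winv\<close>, so
  that the rule carries over to quotients such as \<open>FI M X R\<close>.\<close>

lemma free_inverse_induct [consumes 1, case_names one gen inv]:
  assumes x: "x \<in> carrier (free_inverse A)" and one: "P \<one>\<^bsub>free_inverse A\<^esub>"
    and gen: "\<And>a y. \<lbrakk>a \<in> A; y \<in> carrier (free_inverse A); P y\<rbrakk>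
      \<Longrightarrow> P (free_inverse_gen A a \<otimes>\<^bsub>free_inverse A\<^esub> y)"
    and inv: "\<And>a y. \<lbrakk>a \<in> A; y \<in> carrier (free_inverse A); P y\<rbrakk>
      \<Longrightarrow> P (winv (free_inverse A) (free_inverse_gen A a) \<otimes>\<^bsub>free_inverse A\<^esub> y)"
  shows "P x"
proof -
  interpret q: monoid_quotient "signed_words A" "wagner A" "wagner_cong A" "free_inverse A"
    by (simp_all add: free_inverse_quotient free_inverse_def)
  have s: "carrier (signed_words A) = lists (A \<times> UNIV)" "mult (signed_words A) = (@)"
      "\<one>\<^bsub>signed_words A\<^esub> = []"
    by (simp_all add: signed_words_def)
  obtain w where w: "w \<in> lists (A \<times> UNIV)" "x = wagner_cong A `` {w}"
    using x q.carrier_cases s by metis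
  have "P (wagner_cong A `` {w})"
    using w(1)
  proof induction
    case Nil then show ?case using one by (simp add: s)
  next
    case (Cons l u)
    obtain a b where l: "l = (a, b)" "a \<in> A" using Cons by auto
    have u: "wagner_cong A `` {u} \<in> carrier (free_inverse A)"
      using Cons by (intro q.class_closed) (simp add: s)
    have "wagner_cong A `` {l # u} =
        wagner_cong A `` {[l]} \<otimes>\<^bsub>free_inverse A\<^esub> wagner_cong A `` {u}"
      using Cons by (simp add: s)
    then show ?case
      using gen[OF l(2) u] inv[OF l(2) u] Cons winv_free_inverse_gen[OF l(2)] l(1)
      by (cases b) (simp_all add: free_inverse_gen_def)
  qed
  then show ?thesis using w by simp
qed

lemma free_restriction_induct [consumes 1, case_names gen one mult star plus]:
  assumes p: "p \<in> carrier (free_restriction A)"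
    and gen: "\<And>a. a \<in> A \<Longrightarrow> P (free_gen A a)"
    and one: "P \<one>\<^bsub>free_restriction A\<^esub>"
    and mult: "\<And>x y. \<lbrakk>x \<in> carrier (free_restriction A); y \<in> carrier (free_restriction A); P x; P y\<rbrakk>
      \<Longrightarrow> P (x \<otimes>\<^bsub>free_restriction A\<^esub> y)"
    and star: "\<And>x. \<lbrakk>x \<in> carrier (free_restriction A); P x\<rbrakk> \<Longrightarrow> P (x\<^sup>\<star>\<^bsub>free_restriction A\<^esub>)"
    and plus: "\<And>x. \<lbrakk>x \<in> carrier (free_restriction A); P x\<rbrakk> \<Longrightarrow> P (x\<^sup>\<oplus>\<^bsub>free_restriction A\<^esub>)"
  shows "P p"
proof -
  interpret q: restriction_quotient "term_algebra A" "restriction_laws (term_algebra A)"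
      "term_cong A" "free_restriction A"
    by (simp_all add: free_quotient free_restriction_def)
  have c: "rgens t \<subseteq> A \<Longrightarrow> term_cong A `` {t} \<in> carrier (free_restriction A)" for t
    by (rule q.class_closed) (simp add: term_algebra_def)
  have "rgens t \<subseteq> A \<Longrightarrow> P (term_cong A `` {t})" for t
  proof (induction t)
    case (RGen x) then show ?case using gen by (simp add: free_gen_def)
  next
    case ROne then show ?case using one by (simp add: term_algebra_def)
  next
    case (RMult s t) then show ?case
      using mult[OF c c, of s t] q.ops(2)[of s t] by (simp add: term_algebra_def)
  next
    case (RStar t) then show ?case
      using star[OF c, of t] q.ops(3)[of t] by (simp add: term_algebra_def)
  next
    case (RPlus t) then show ?case
      using plus[OF c, of t] q.ops(4)[of t] by (simp add: term_algebra_def)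
  qed
  with p show ?thesis by (auto elim!: q.carrier_cases simp: term_algebra_def)
qed

text \<open>The maps \<open>\<gamma>\<close> and \<open>\<delta>\<close> may differ outside
  \<open>carrier M\<close>, so they cannot simply be exchanged. Words take their values in
  \<open>carrier M\<close>; hence the two evaluation morphisms agree on generators and therefore
  everywhere.\<close>

lemma identity_value_cong:
  assumes M: "monoid M" and S: "restriction_monoid S" and \<gamma>: "\<gamma> \<in> carrier M \<rightarrow> carrier S"
    and eq: "\<And>m. m \<in> carrier M \<Longrightarrow> \<gamma> m = \<delta> m"
    and f: "f \<in> X \<rightarrow> carrier M" and p: "p \<in> carrier (free_restriction (lists X))"
  shows "identity_value M S \<gamma> f p = identity_value M S \<delta> f p"
proof (rule free_restriction_hom_unique[OF _ _ _ p])
  have \<delta>: "\<delta> \<in> carrier M \<rightarrow> carrier S" using \<gamma> eq by (metis Pi_cong)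
  show "identity_value M S \<gamma> f \<in> restriction_hom (free_restriction (lists X)) S"
    by (rule identity_value_hom[OF M S \<gamma> f])
  show "identity_value M S \<delta> f \<in> restriction_hom (free_restriction (lists X)) S"
    by (rule identity_value_hom[OF M S \<delta> f])
  show "identity_value M S \<gamma> f (free_gen (lists X) u) = identity_value M S \<delta> f (free_gen (lists X) u)"
    if u: "u \<in> lists X" for u
    using identity_value_gen[OF M S \<gamma> f u] identity_value_gen[OF M S \<delta> f u]
      eq[OF word_value_closed[OF M f u]] by simp
qed

section \<open>Transport of the defining relations along morphisms\<close>

lemma defining_relations_cases:
  assumes "(x, y) \<in> defining_relations M X R F \<iota>"
  obtains (one) "x = \<iota> \<one>\<^bsub>M\<^esub>" "y = \<one>\<^bsub>F\<^esub>"
  | (mult) m n where "m \<in> carrier M" "n \<in> carrier M" "x = \<iota> m \<otimes>\<^bsub>F\<^esub> \<iota> n"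
      "y = \<iota> (m \<otimes>\<^bsub>M\<^esub> n) \<otimes>\<^bsub>F\<^esub> (\<iota> m \<otimes>\<^bsub>F\<^esub> \<iota> n)\<^sup>\<star>\<^bsub>F\<^esub>"
  | (ident) p q f where "(p, q) \<in> R" "f \<in> X \<rightarrow> carrier M"
      "x = identity_value M F \<iota> f p" "y = identity_value M F \<iota> f q"
  using assms unfolding defining_relations_def by blast

text \<open>Morphisms commute with the operations and with \<open>identity_value\<close>. This
  reduces the compatibility of a lift with the presentation to relations between the images of the
  generators in \<open>T\<close>.\<close>

lemma defining_relations_hom:
  assumes M: "monoid M" and R: "\<forall>e\<in>R. is_identity X e"
    and F: "restriction_monoid F" and \<iota>: "\<iota> \<in> carrier M \<rightarrow> carrier F"
    and T: "restriction_monoid T" and k: "k \<in> restriction_hom F T"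
    and eq: "\<And>m. m \<in> carrier M \<Longrightarrow> k (\<iota> m) = \<gamma> m"
    and xy: "(x, y) \<in> defining_relations M X R F \<iota>"
  shows "(k x, k y) \<in> defining_relations M X R T \<gamma>"
  using xy
proof (cases rule: defining_relations_cases)
  case one
  then show ?thesis
    using restriction_homD(3)[OF k] eq[OF monoid.one_closed[OF M]]
    by (simp add: defining_relations_def)
next
  case (mult m n)
  interpret F: restriction_monoid F by fact
  have "\<iota> m \<in> carrier F" "\<iota> n \<in> carrier F" "\<iota> (m \<otimes>\<^bsub>M\<^esub> n) \<in> carrier F"
    using \<iota> mult monoid.m_closed[OF M] by auto
  then have "k x = \<gamma> m \<otimes>\<^bsub>T\<^esub> \<gamma> n" "k y = \<gamma> (m \<otimes>\<^bsub>M\<^esub> n) \<otimes>\<^bsub>T\<^esub> (\<gamma> m \<otimes>\<^bsub>T\<^esub> \<gamma> n)\<^sup>\<star>\<^bsub>T\<^esub>"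
    using mult monoid.m_closed[OF M] eq restriction_homD[OF k] by simp_all
  then show ?thesis using mult(1,2) unfolding defining_relations_def by blast
next
  case (ident p q f)
  have \<gamma>: "(\<lambda>m. k (\<iota> m)) \<in> carrier M \<rightarrow> carrier T" using \<iota> restriction_homD(1)[OF k] by auto
  have "k (identity_value M F \<iota> f z) = identity_value M T \<gamma> f z"
    if "z \<in> carrier (free_restriction (lists X))" for z
    using hom_identity_value[OF M F T \<iota> ident(2) k that]
      identity_value_cong[OF M T \<gamma> eq ident(2) that] by simp
  moreover have "p \<in> carrier (free_restriction (lists X))" "q \<in> carrier (free_restriction (lists X))"
    using R ident(1) by (auto simp: is_identity_def)
  ultimately show ?thesis using ident unfolding defining_relations_def by auto
qed

section \<open>The monoids \<open>FR M X R\<close> and \<open>FI M X R\<close>\<close>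

lemma FR_quotient:
  "restriction_quotient (free_restriction A)"
  using free_restriction_monoid[of A] by (simp add: restriction_quotient_def restriction_monoid_iff_laws)

lemma FI_quotient: "monoid_quotient (free_inverse A)"
  using free_inverse_monoid[of A] by (simp add: monoid_quotient_def inverse_monoid_def)

lemma FR_gen_closed: "m \<in> carrier M \<Longrightarrow> FR_gen M X R m \<in> carrier (FR M X R)"
proof -
  interpret q: restriction_quotient "free_restriction (carrier M)"
      "defining_relations M X R (free_restriction (carrier M)) (free_gen (carrier M))"
      "FR_cong M X R" "FR M X R"
    by (simp_all add: FR_quotient FR_def FR_cong_def)
  show "m \<in> carrier M \<Longrightarrow> ?thesis" by (simp add: FR_gen_def free_gen_closed)
qed

text \<open>Each of these pairs is the image, under the quotient map, of the corresponding pair in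
  the free restriction monoid, where the congruence identifies its components.\<close>

lemma FR_relations:
  assumes M: "monoid M" and R: "\<forall>e\<in>R. is_identity X e"
  shows "defining_relations M X R (FR M X R) (FR_gen M X R) \<subseteq> Id"
proof clarify
  let ?F = "free_restriction (carrier M)" and ?\<iota> = "free_gen (carrier M)"
  interpret q: restriction_quotient ?F "defining_relations M X R ?F ?\<iota>" "FR_cong M X R" "FR M X R"
    by (simp_all add: FR_quotient FR_def FR_cong_def)
  interpret F: restriction_monoid ?F by (rule free_restriction_monoid)
  interpret Q: restriction_monoid "FR M X R" by (rule FR_restriction_monoid)
  have \<iota>: "?\<iota> \<in> carrier M \<rightarrow> carrier ?F" using free_gen_closed by auto
  have rel: "FR_cong M X R `` {x} = FR_cong M X R `` {y}"
    if "(x, y) \<in> defining_relations M X R ?F ?\<iota>" "x \<in> carrier ?F" "y \<in> carrier ?F" for x y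
    by (rule q.class_eq) (use that in \<open>simp add: FR_cong_def restriction_cong.base\<close>)
  have \<gamma>: "FR_gen M X R \<in> carrier M \<rightarrow> carrier (FR M X R)" using FR_gen_closed by auto
  have genc: "m \<in> carrier M \<Longrightarrow> ?\<iota> m \<in> carrier ?F" for m by (rule free_gen_closed)
  fix a b assume "(a, b) \<in> defining_relations M X R (FR M X R) (FR_gen M X R)"
  then show "a = b"
  proof (cases rule: defining_relations_cases)
    case one
    have "(?\<iota> \<one>\<^bsub>M\<^esub>, \<one>\<^bsub>?F\<^esub>) \<in> defining_relations M X R ?F ?\<iota>" by (simp add: defining_relations_def)
    from rel[OF this] show ?thesis using one genc monoid.one_closed[OF M] by (simp add: FR_gen_def)
  next
    case (mult m n)
    have c: "?\<iota> m \<in> carrier ?F" "?\<iota> n \<in> carrier ?F" "?\<iota> (m \<otimes>\<^bsub>M\<^esub> n) \<in> carrier ?F"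
      using genc mult monoid.m_closed[OF M] by auto
    have "(?\<iota> m \<otimes>\<^bsub>?F\<^esub> ?\<iota> n, ?\<iota> (m \<otimes>\<^bsub>M\<^esub> n) \<otimes>\<^bsub>?F\<^esub> (?\<iota> m \<otimes>\<^bsub>?F\<^esub> ?\<iota> n)\<^sup>\<star>\<^bsub>?F\<^esub>)
        \<in> defining_relations M X R ?F ?\<iota>"
      using mult unfolding defining_relations_def by blast
    note rel' = rel[OF this]
    have a: "a = FR_cong M X R `` {?\<iota> m \<otimes>\<^bsub>?F\<^esub> ?\<iota> n}"
      using mult(3) c by (simp add: FR_gen_def)
    have b: "b = FR_cong M X R `` {?\<iota> (m \<otimes>\<^bsub>M\<^esub> n) \<otimes>\<^bsub>?F\<^esub> (?\<iota> m \<otimes>\<^bsub>?F\<^esub> ?\<iota> n)\<^sup>\<star>\<^bsub>?F\<^esub>}"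
      using mult(4) c by (simp add: FR_gen_def)
    show ?thesis unfolding a b by (rule rel') (use c in auto)
  next
    case (ident p q f)
    have pq: "p \<in> carrier (free_restriction (lists X))" "q \<in> carrier (free_restriction (lists X))"
      using R ident(1) by (auto simp: is_identity_def)
    have val: "FR_cong M X R `` {identity_value M ?F ?\<iota> f z} = identity_value M (FR M X R) (FR_gen M X R) f z"
      if "z \<in> carrier (free_restriction (lists X))" for z
      using hom_identity_value[OF M F.restriction_monoid_axioms Q.restriction_monoid_axioms
          \<iota> ident(2) q.proj_hom that] by (simp add: FR_gen_def[abs_def])
    have "(identity_value M ?F ?\<iota> f p, identity_value M ?F ?\<iota> f q) \<in> defining_relations M X R ?F ?\<iota>"
      using ident unfolding defining_relations_def by blast
    from rel[OF this] show ?thesis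
      using ident val pq restriction_homD(1)[OF identity_value_hom[OF M F.restriction_monoid_axioms
            \<iota> ident(2)]] by simp
  qed
qed

text \<open>Admissibility enters here: it makes the identities in \<open>R\<close> hold for the
  morphism \<open>\<gamma>\<close>. The product relation holds because \<open>\<gamma>\<close> is
  multiplicative and \<open>mult_star_self\<close> absorbs the star.\<close>

lemma FR_lift:
  assumes M: "monoid M" and R: "\<forall>e\<in>R. admissible X e"
    and T: "restriction_monoid T" and \<gamma>: "\<gamma> \<in> monoid_hom M T"
  obtains k where "k \<in> restriction_hom (FR M X R) T"
    "\<And>m. m \<in> carrier M \<Longrightarrow> k (FR_gen M X R m) = \<gamma> m"
proof -
  let ?F = "free_restriction (carrier M)" and ?\<iota> = "free_gen (carrier M)"
  interpret q: restriction_quotient ?F "defining_relations M X R ?F ?\<iota>" "FR_cong M X R" "FR M X R"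
    by (simp_all add: FR_quotient FR_def FR_cong_def)
  interpret T: restriction_monoid T by fact
  have \<gamma>c: "\<gamma> \<in> carrier M \<rightarrow> carrier T"
    and \<gamma>m: "\<And>m n. \<lbrakk>m \<in> carrier M; n \<in> carrier M\<rbrakk> \<Longrightarrow> \<gamma> (m \<otimes>\<^bsub>M\<^esub> n) = \<gamma> m \<otimes>\<^bsub>T\<^esub> \<gamma> n"
    and \<gamma>1: "\<gamma> \<one>\<^bsub>M\<^esub> = \<one>\<^bsub>T\<^esub>"
    using \<gamma> by (auto simp: monoid_hom_def hom_def)
  define h where "h = free_extend T \<gamma>"
  have h: "h \<in> restriction_hom ?F T" unfolding h_def by (rule free_extend_hom[OF T \<gamma>c])
  have hg: "h (?\<iota> m) = \<gamma> m" if "m \<in> carrier M" for m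
    unfolding h_def by (rule free_extend_gen[OF T \<gamma>c that])
  have \<iota>: "?\<iota> \<in> carrier M \<rightarrow> carrier ?F" using free_gen_closed by auto
  have resp: "h x = h y" if xy: "(x, y) \<in> defining_relations M X R ?F ?\<iota>" for x y
  proof -
    have "(h x, h y) \<in> defining_relations M X R T \<gamma>"
      by (rule defining_relations_hom[OF M _ free_restriction_monoid \<iota> T h hg xy])
        (use R in \<open>auto simp: admissible_def\<close>)
    then show ?thesis
    proof (cases rule: defining_relations_cases)
      case one then show ?thesis using \<gamma>1 by simp
    next
      case (mult m n)
      then have "\<gamma> m \<otimes>\<^bsub>T\<^esub> \<gamma> n \<in> carrier T" using \<gamma>c by auto
      then show ?thesis using mult \<gamma>m T.mult_star_self by simp
    next
      case (ident p q f)
      then show ?thesis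
        using admissible_satisfies[OF _ M T \<gamma>, of X "(p, q)"] R by (auto simp: satisfies_def)
    qed
  qed
  show thesis
  proof (rule that[OF q.lift_hom[OF h resp]])
    fix m assume m: "m \<in> carrier M"
    then show "the_elem (h ` FR_gen M X R m) = \<gamma> m"
      using q.lift_class[OF h resp, of "?\<iota> m"] hg free_gen_closed[OF m] by (simp add: FR_gen_def)
  qed
qed

lemma FR_induct [consumes 1, case_names gen one mult star plus]:
  assumes p: "p \<in> carrier (FR M X R)"
    and gen: "\<And>m. m \<in> carrier M \<Longrightarrow> P (FR_gen M X R m)"
    and one: "P \<one>\<^bsub>FR M X R\<^esub>"
    and mult: "\<And>x y. \<lbrakk>x \<in> carrier (FR M X R); y \<in> carrier (FR M X R); P x; P y\<rbrakk>
      \<Longrightarrow> P (x \<otimes>\<^bsub>FR M X R\<^esub> y)"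
    and star: "\<And>x. \<lbrakk>x \<in> carrier (FR M X R); P x\<rbrakk> \<Longrightarrow> P (x\<^sup>\<star>\<^bsub>FR M X R\<^esub>)"
    and plus: "\<And>x. \<lbrakk>x \<in> carrier (FR M X R); P x\<rbrakk> \<Longrightarrow> P (x\<^sup>\<oplus>\<^bsub>FR M X R\<^esub>)"
  shows "P p"
proof -
  interpret q: restriction_quotient "free_restriction (carrier M)"
      "defining_relations M X R (free_restriction (carrier M)) (free_gen (carrier M))"
      "FR_cong M X R" "FR M X R"
    by (simp_all add: FR_quotient FR_def FR_cong_def)
  obtain x where x: "x \<in> carrier (free_restriction (carrier M))" "p = FR_cong M X R `` {x}"
    using p by (rule q.carrier_cases)
  from x(1) have "P (FR_cong M X R `` {x})"
  proof (induction rule: free_restriction_induct)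
    case (gen m) then show ?case using assms(2) by (simp add: FR_gen_def)
  next
    case one then show ?case using assms(3) by simp
  next
    case (mult x y) then show ?case using assms(4)[of "FR_cong M X R `` {x}" "FR_cong M X R `` {y}"] by simp
  next
    case (star x) then show ?case using assms(5)[of "FR_cong M X R `` {x}"] by simp
  next
    case (plus x) then show ?case using assms(6)[of "FR_cong M X R `` {x}"] by simp
  qed
  then show ?thesis using x by simp
qed

section \<open>Normal form of the elements of \<open>FR M X R\<close>\<close>

lemma FR_gen_one:
  assumes "monoid M" "\<forall>e\<in>R. is_identity X e"
  shows "FR_gen M X R \<one>\<^bsub>M\<^esub> = \<one>\<^bsub>FR M X R\<^esub>"
  by (rule IdD, rule subsetD[OF FR_relations[OF assms]]) (simp add: defining_relations_def)

lemma FR_gen_mult: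
  assumes "monoid M" "\<forall>e\<in>R. is_identity X e" "m \<in> carrier M" "n \<in> carrier M"
  shows "FR_gen M X R m \<otimes>\<^bsub>FR M X R\<^esub> FR_gen M X R n = FR_gen M X R (m \<otimes>\<^bsub>M\<^esub> n) \<otimes>\<^bsub>FR M X R\<^esub>
    (FR_gen M X R m \<otimes>\<^bsub>FR M X R\<^esub> FR_gen M X R n)\<^sup>\<star>\<^bsub>FR M X R\<^esub>"
  by (rule IdD, rule subsetD[OF FR_relations[OF assms(1,2)]])
    (use assms(3,4) in \<open>auto simp: defining_relations_def\<close>)

text \<open>Elements of this form are closed under all operations. Stars and pluses are projections,
  to which the generator of the unit, equal to 1, is appended. In a product,
  \<open>mult_plus\<close> moves every projection to the left.\<close>

lemma FR_decomposition:
  assumes M: "monoid M" and R: "\<forall>e\<in>R. is_identity X e" and a: "a \<in> carrier (FR M X R)"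
  obtains e m where "e \<in> projections (FR M X R)" "m \<in> carrier M" "a = e \<otimes>\<^bsub>FR M X R\<^esub> FR_gen M X R m"
proof -
  let ?Q = "FR M X R" and ?g = "FR_gen M X R"
  interpret Q: restriction_monoid ?Q by (rule FR_restriction_monoid)
  interpret M: monoid M by fact
  have g: "m \<in> carrier M \<Longrightarrow> ?g m \<in> carrier ?Q" for m by (rule FR_gen_closed)
  define P where "P = (\<lambda>a. \<exists>e\<in>projections ?Q. \<exists>m\<in>carrier M. a = e \<otimes>\<^bsub>?Q\<^esub> ?g m)"
  have proj: "P e" if "e \<in> projections ?Q" for e
    unfolding P_def
    using that FR_gen_one[OF M R] Q.projectionsD(1)[OF that] by (intro bexI[of _ e] bexI[of _ "\<one>\<^bsub>M\<^esub>"]) auto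
  have mult: "P (x \<otimes>\<^bsub>?Q\<^esub> y)" if xy: "P x" "P y" for x y
  proof -
    obtain e m f n where e: "e \<in> projections ?Q" and f: "f \<in> projections ?Q"
      and m: "m \<in> carrier M" and n: "n \<in> carrier M"
      and x: "x = e \<otimes>\<^bsub>?Q\<^esub> ?g m" and y: "y = f \<otimes>\<^bsub>?Q\<^esub> ?g n"
      using xy unfolding P_def by blast
    note e' = Q.projectionsD(1)[OF e] and f' = Q.projectionsD(1,3)[OF f] and gm = g[OF m] and gn = g[OF n]
    have mn: "m \<otimes>\<^bsub>M\<^esub> n \<in> carrier M" using m n by simp
    \<comment> \<open>\<open>p\<close> is \<open>f\<close> after moving left past the generator of
      \<open>m\<close>; \<open>s\<close> is the star in the product relation for \<open>m\<close>
      and \<open>n\<close>; \<open>q\<close> is \<open>s\<close> after moving left past the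
      generator of their product.\<close>
    define p where "p = (?g m \<otimes>\<^bsub>?Q\<^esub> f)\<^sup>\<oplus>\<^bsub>?Q\<^esub>"
    define s where "s = (?g m \<otimes>\<^bsub>?Q\<^esub> ?g n)\<^sup>\<star>\<^bsub>?Q\<^esub>"
    define q where "q = (?g (m \<otimes>\<^bsub>M\<^esub> n) \<otimes>\<^bsub>?Q\<^esub> s)\<^sup>\<oplus>\<^bsub>?Q\<^esub>"
    have s: "s \<in> projections ?Q" using gm gn by (simp add: s_def)
    note s' = Q.projectionsD(1,3)[OF s]
    have p: "p \<in> projections ?Q" and q: "q \<in> projections ?Q"
      using gm f' s' g[OF mn] by (simp_all add: p_def q_def)
    note p' = Q.projectionsD(1)[OF p] and q' = Q.projectionsD(1)[OF q]
    have 1: "?g m \<otimes>\<^bsub>?Q\<^esub> f = p \<otimes>\<^bsub>?Q\<^esub> ?g m"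
      using Q.mult_plus[OF gm f'(1)] unfolding f'(2) p_def .
    have 2: "?g (m \<otimes>\<^bsub>M\<^esub> n) \<otimes>\<^bsub>?Q\<^esub> s = q \<otimes>\<^bsub>?Q\<^esub> ?g (m \<otimes>\<^bsub>M\<^esub> n)"
      using Q.mult_plus[OF g[OF mn] s'(1)] unfolding s'(2) q_def .
    have "x \<otimes>\<^bsub>?Q\<^esub> y = e \<otimes>\<^bsub>?Q\<^esub> (?g m \<otimes>\<^bsub>?Q\<^esub> f) \<otimes>\<^bsub>?Q\<^esub> ?g n"
      using e' f' gm gn by (simp add: x y Q.m_assoc)
    also have "\<dots> = e \<otimes>\<^bsub>?Q\<^esub> p \<otimes>\<^bsub>?Q\<^esub> (?g m \<otimes>\<^bsub>?Q\<^esub> ?g n)"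
      unfolding 1 using e' p' gm gn by (simp add: Q.m_assoc)
    also have "?g m \<otimes>\<^bsub>?Q\<^esub> ?g n = q \<otimes>\<^bsub>?Q\<^esub> ?g (m \<otimes>\<^bsub>M\<^esub> n)"
      using FR_gen_mult[OF M R m n] unfolding s_def[symmetric] 2 .
    also have "e \<otimes>\<^bsub>?Q\<^esub> p \<otimes>\<^bsub>?Q\<^esub> (q \<otimes>\<^bsub>?Q\<^esub> ?g (m \<otimes>\<^bsub>M\<^esub> n)) = e \<otimes>\<^bsub>?Q\<^esub> p \<otimes>\<^bsub>?Q\<^esub> q \<otimes>\<^bsub>?Q\<^esub> ?g (m \<otimes>\<^bsub>M\<^esub> n)"
      using e' p' q' g[OF mn] by (simp add: Q.m_assoc)
    finally show ?thesis
      unfolding P_def using Q.proj_mult[OF Q.proj_mult[OF e p] q] mn by blast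
  qed
  have "P a"
    using a
  proof (induction rule: FR_induct)
    case (gen m)
    then show ?case unfolding P_def using g[of m] by (intro bexI[of _ "\<one>\<^bsub>?Q\<^esub>"] bexI[of _ m]) auto
  qed (auto intro: mult proj)
  then show thesis using that unfolding P_def by blast
qed

section \<open>Factorization through \<open>FI M X R\<close>, and its idempotents\<close>

lemma FI_induct [consumes 1, case_names one gen inv]:
  assumes x: "x \<in> carrier (FI M X R)" and one: "P \<one>\<^bsub>FI M X R\<^esub>"
    and gen: "\<And>m y. \<lbrakk>m \<in> carrier M; y \<in> carrier (FI M X R); P y\<rbrakk>
      \<Longrightarrow> P (FI_gen M X R m \<otimes>\<^bsub>FI M X R\<^esub> y)"
    and inv: "\<And>m y. \<lbrakk>m \<in> carrier M; y \<in> carrier (FI M X R); P y\<rbrakk>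
      \<Longrightarrow> P (winv (FI M X R) (FI_gen M X R m) \<otimes>\<^bsub>FI M X R\<^esub> y)"
  shows "P x"
proof -
  let ?I = "free_inverse (carrier M)"
  interpret q: monoid_quotient ?I "defining_relations M X R (inverse_restriction ?I)
      (free_inverse_gen (carrier M))" "FI_cong M X R" "FI M X R"
    by (simp_all add: FI_quotient FI_def FI_cong_def)
  interpret I: inverse_monoid ?I by (rule free_inverse_monoid)
  note winv = monoid_hom_winv[OF free_inverse_monoid FI_inverse_monoid q.proj_hom]
  obtain w where w: "w \<in> carrier ?I" "x = FI_cong M X R `` {w}"
    using x by (rule q.carrier_cases)
  from w(1) have "P (FI_cong M X R `` {w})"
  proof (induction rule: free_inverse_induct)
    case one then show ?case using assms(2) by simp
  next
    case (gen a y)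
    then show ?case using assms(3)[of a "FI_cong M X R `` {y}"] free_inverse_gen_closed[OF gen(1)]
      by (simp add: FI_gen_def)
  next
    case (inv a y)
    then show ?case using assms(4)[of a "FI_cong M X R `` {y}"] free_inverse_gen_closed[OF inv(1)]
      by (simp add: FI_gen_def flip: winv)
  qed
  then show ?thesis using w by simp
qed

text \<open>The images of the generators under \<open>k\<close> satisfy the defining relations in
  \<open>T\<close>, so they induce a morphism from \<open>FI M X R\<close>; composed with
  \<open>\<psi>\<close> it agrees with \<open>k\<close> on generators. Consequently
  \<open>\<psi> a = \<psi> b\<close> implies \<open>k a = k b\<close> for every such
  \<open>k\<close>.\<close>

lemma FI_factor:
  assumes M: "monoid M" and R: "\<forall>e\<in>R. is_identity X e" and T: "inverse_monoid T"
    and k: "k \<in> restriction_hom (FR M X R) (inverse_restriction T)"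
    and \<psi>: "\<psi> \<in> restriction_hom (FR M X R) (inverse_restriction (FI M X R))"
    and \<psi>g: "\<And>m. m \<in> carrier M \<Longrightarrow> \<psi> (FR_gen M X R m) = FI_gen M X R m"
  obtains \<theta> where "\<And>a. a \<in> carrier (FR M X R) \<Longrightarrow> \<theta> (\<psi> a) = k a"
proof -
  let ?I = "free_inverse (carrier M)" and ?\<iota> = "free_inverse_gen (carrier M)"
  interpret q: monoid_quotient ?I "defining_relations M X R (inverse_restriction ?I) ?\<iota>"
      "FI_cong M X R" "FI M X R"
    by (simp_all add: FI_quotient FI_def FI_cong_def)
  note FR = FR_restriction_monoid[of M X R] and rI = inverse_monoid.restriction_monoid[OF free_inverse_monoid]
  note rT = inverse_monoid.restriction_monoid[OF T]
  define \<gamma> where "\<gamma> = (\<lambda>m. k (FR_gen M X R m))"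
  have \<gamma>: "\<gamma> \<in> carrier M \<rightarrow> carrier T"
    using restriction_homD(1)[OF k FR_gen_closed] by (simp add: \<gamma>_def)
  obtain h where h: "h \<in> monoid_hom ?I T" "\<And>m. m \<in> carrier M \<Longrightarrow> h (?\<iota> m) = \<gamma> m"
    using free_inverse_lift[OF T \<gamma>] by blast
  have hr: "h \<in> restriction_hom (inverse_restriction ?I) (inverse_restriction T)"
    by (rule monoid_hom_inverse_restriction[OF free_inverse_monoid T h(1)])
  have \<iota>: "?\<iota> \<in> carrier M \<rightarrow> carrier (inverse_restriction ?I)"
    using free_inverse_gen_closed by auto
  \<comment> \<open>The relations already hold in \<open>FR M X R\<close>, and \<open>k\<close>
    carries them into \<open>T\<close>.\<close>
  have sub: "defining_relations M X R (inverse_restriction T) \<gamma> \<subseteq> Id"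
  proof clarify
    fix a b assume "(a, b) \<in> defining_relations M X R (inverse_restriction T) \<gamma>"
    moreover have "(\<lambda>m. k (FR_gen M X R m)) = \<gamma>" by (simp add: \<gamma>_def)
    ultimately show "a = b"
    proof (cases rule: defining_relations_cases)
      case one
      then show ?thesis
        using FR_gen_one[OF M R] restriction_homD(3)[OF k] by (simp add: \<gamma>_def)
    next
      case (mult m n)
      interpret Q: restriction_monoid "FR M X R" by (rule FR)
      have c: "FR_gen M X R m \<in> carrier (FR M X R)" "FR_gen M X R n \<in> carrier (FR M X R)"
        "FR_gen M X R (m \<otimes>\<^bsub>M\<^esub> n) \<in> carrier (FR M X R)"
        using mult monoid.m_closed[OF M] by (simp_all add: FR_gen_closed)
      show ?thesis
        using arg_cong[OF FR_gen_mult[OF M R mult(1,2)], of k] restriction_homD[OF k] c mult(3,4)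
        by (simp add: \<gamma>_def del: inverse_restriction_simps)
    next
      case (ident p q f)
      have pq: "p \<in> carrier (free_restriction (lists X))" "q \<in> carrier (free_restriction (lists X))"
        using R ident(1) by (auto simp: is_identity_def)
      have g: "FR_gen M X R \<in> carrier M \<rightarrow> carrier (FR M X R)" using FR_gen_closed by auto
      have "identity_value M (FR M X R) (FR_gen M X R) f p = identity_value M (FR M X R) (FR_gen M X R) f q"
        by (rule IdD, rule subsetD[OF FR_relations[OF M R]])
          (use ident(1,2) in \<open>auto simp: defining_relations_def\<close>)
      then show ?thesis
        using hom_identity_value[OF M FR rT g ident(2) k pq(1)]
          hom_identity_value[OF M FR rT g ident(2) k pq(2)] ident(3,4) by (simp add: \<gamma>_def)
    qed
  qed
  have "h x = h y" if "(x, y) \<in> defining_relations M X R (inverse_restriction ?I) ?\<iota>" for x y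
    using defining_relations_hom[OF M R rI \<iota> rT hr h(2) that] sub by blast
  then obtain \<theta> where \<theta>: "\<theta> \<in> monoid_hom (FI M X R) T"
    "\<And>x. x \<in> carrier ?I \<Longrightarrow> \<theta> (FI_cong M X R `` {x}) = h x"
    using q.lift_hom[OF h(1)] by metis
  have \<theta>r: "\<theta> \<in> restriction_hom (inverse_restriction (FI M X R)) (inverse_restriction T)"
    by (rule monoid_hom_inverse_restriction[OF FI_inverse_monoid T \<theta>(1)])
  have \<theta>g: "\<theta> (\<psi> (FR_gen M X R m)) = k (FR_gen M X R m)" if m: "m \<in> carrier M" for m
    using \<psi>g[OF m] \<theta>(2)[OF free_inverse_gen_closed[OF m]] h(2)[OF m] by (simp add: FI_gen_def \<gamma>_def)
  show thesis
    by (rule that) (rule FR_hom_unique[OF restriction_hom_compose[OF \<psi> \<theta>r] k \<theta>g])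
qed

text \<open>The image of the projections contains 1 and is closed under conjugation by the
  generators and their inverses, hence by every element. Conjugating 1 by an idempotent returns this
  idempotent.\<close>

lemma FI_idempotent_image:
  assumes \<psi>: "\<psi> \<in> restriction_hom (FR M X R) (inverse_restriction (FI M X R))"
    and \<psi>g: "\<And>m. m \<in> carrier M \<Longrightarrow> \<psi> (FR_gen M X R m) = FI_gen M X R m"
    and e: "e \<in> carrier (FI M X R)" "e \<otimes>\<^bsub>FI M X R\<^esub> e = e"
  obtains p where "p \<in> projections (FR M X R)" "\<psi> p = e"
proof -
  let ?Q = "FR M X R" and ?I = "FI M X R"
  interpret Q: restriction_monoid ?Q by (rule FR_restriction_monoid)
  interpret I: inverse_monoid ?I by (rule FI_inverse_monoid)
  note \<psi>' = restriction_homD[OF \<psi>, simplified]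
  have psi_proj: "\<psi> p \<in> carrier ?I \<and> \<psi> p \<otimes>\<^bsub>?I\<^esub> \<psi> p = \<psi> p \<and> winv ?I (\<psi> p) = \<psi> p"
    if p: "p \<in> projections ?Q" for p
  proof -
    have c: "\<psi> p \<in> carrier ?I" using \<psi>'(1) Q.projectionsD(1)[OF p] .
    moreover have "\<psi> p \<otimes>\<^bsub>?I\<^esub> \<psi> p = \<psi> p"
      using \<psi>'(2)[of p p] Q.proj_idem[OF p] Q.projectionsD(1)[OF p] by simp
    ultimately show ?thesis using I.idem_winv by simp
  qed
  \<comment> \<open>Since \<open>\<psi> p\<close> is idempotent and its own inverse, plus and star
    in the inverse monoid turn into the two conjugates of \<open>\<psi> p\<close> by
    \<open>\<psi> x\<close>. Thus conjugation can be expressed by restriction operations.\<close>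
  have conj: "\<psi> ((x \<otimes>\<^bsub>?Q\<^esub> p)\<^sup>\<oplus>\<^bsub>?Q\<^esub>) = \<psi> x \<otimes>\<^bsub>?I\<^esub> \<psi> p \<otimes>\<^bsub>?I\<^esub> winv ?I (\<psi> x)"
      "\<psi> ((p \<otimes>\<^bsub>?Q\<^esub> x)\<^sup>\<star>\<^bsub>?Q\<^esub>) = winv ?I (\<psi> x) \<otimes>\<^bsub>?I\<^esub> \<psi> p \<otimes>\<^bsub>?I\<^esub> \<psi> x"
    if p: "p \<in> projections ?Q" and x: "x \<in> carrier ?Q" for p x
  proof -
    note pc = Q.projectionsD(1)[OF p]
    have pp: "\<psi> p \<otimes>\<^bsub>?I\<^esub> \<psi> p = \<psi> p" using psi_proj[OF p] by simp
    have pp1: "\<psi> p \<in> carrier ?I" "winv ?I (\<psi> p) = \<psi> p" using psi_proj[OF p] by simp_all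
    have xc: "\<psi> x \<in> carrier ?I" using \<psi>'(1)[OF x] .
    have "\<psi> ((x \<otimes>\<^bsub>?Q\<^esub> p)\<^sup>\<oplus>\<^bsub>?Q\<^esub>) = \<psi> x \<otimes>\<^bsub>?I\<^esub> (\<psi> p \<otimes>\<^bsub>?I\<^esub> \<psi> p) \<otimes>\<^bsub>?I\<^esub> winv ?I (\<psi> x)"
      using \<psi>'(2,5) x pc xc pp1 I.winv_mult[of "\<psi> x" "\<psi> p"] by (simp only: Q.mult_closed) (simp add: I.m_assoc)
    then show "\<psi> ((x \<otimes>\<^bsub>?Q\<^esub> p)\<^sup>\<oplus>\<^bsub>?Q\<^esub>) = \<psi> x \<otimes>\<^bsub>?I\<^esub> \<psi> p \<otimes>\<^bsub>?I\<^esub> winv ?I (\<psi> x)"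
      using pp by simp
    have "\<psi> ((p \<otimes>\<^bsub>?Q\<^esub> x)\<^sup>\<star>\<^bsub>?Q\<^esub>) = winv ?I (\<psi> x) \<otimes>\<^bsub>?I\<^esub> (\<psi> p \<otimes>\<^bsub>?I\<^esub> \<psi> p) \<otimes>\<^bsub>?I\<^esub> \<psi> x"
      using \<psi>'(2,4) x pc xc pp1 I.winv_mult[of "\<psi> p" "\<psi> x"] by (simp only: Q.mult_closed) (simp add: I.m_assoc)
    then show "\<psi> ((p \<otimes>\<^bsub>?Q\<^esub> x)\<^sup>\<star>\<^bsub>?Q\<^esub>) = winv ?I (\<psi> x) \<otimes>\<^bsub>?I\<^esub> \<psi> p \<otimes>\<^bsub>?I\<^esub> \<psi> x"
      using pp by simp
  qed
  have g: "FR_gen M X R m \<in> carrier ?Q" "FI_gen M X R m \<in> carrier ?I" if "m \<in> carrier M" for m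
    using FR_gen_closed[OF that] \<psi>'(1)[OF FR_gen_closed[OF that]] \<psi>g[OF that] by simp_all
  \<comment> \<open>The claim is made for all \<open>p\<close> at once, because the step applies a
    generator, or its inverse, to a projection already obtained from \<open>y\<close>.\<close>
  have "\<forall>p\<in>projections ?Q. \<exists>q\<in>projections ?Q. \<psi> q = y \<otimes>\<^bsub>?I\<^esub> \<psi> p \<otimes>\<^bsub>?I\<^esub> winv ?I y"
    if "y \<in> carrier ?I" for y
    using that
  proof (induction rule: FI_induct)
    case one
    then show ?case using psi_proj I.idem_winv[of "\<one>\<^bsub>?I\<^esub>"] by auto
  next
    case (gen m y)
    show ?case
    proof
      fix p assume p: "p \<in> projections ?Q"
      then obtain q where q: "q \<in> projections ?Q" "\<psi> q = y \<otimes>\<^bsub>?I\<^esub> \<psi> p \<otimes>\<^bsub>?I\<^esub> winv ?I y"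
        using gen.IH by blast
      have "\<psi> ((FR_gen M X R m \<otimes>\<^bsub>?Q\<^esub> q)\<^sup>\<oplus>\<^bsub>?Q\<^esub>) =
          (FI_gen M X R m \<otimes>\<^bsub>?I\<^esub> y) \<otimes>\<^bsub>?I\<^esub> \<psi> p \<otimes>\<^bsub>?I\<^esub> winv ?I (FI_gen M X R m \<otimes>\<^bsub>?I\<^esub> y)"
        unfolding conj(1)[OF q(1) g(1)[OF gen(1)]] \<psi>g[OF gen(1)] q(2)
        using g(2)[OF gen(1)] gen(2) psi_proj[OF p] by (simp add: I.winv_mult I.m_assoc)
      then show "\<exists>q\<in>projections ?Q. \<psi> q =
          (FI_gen M X R m \<otimes>\<^bsub>?I\<^esub> y) \<otimes>\<^bsub>?I\<^esub> \<psi> p \<otimes>\<^bsub>?I\<^esub> winv ?I (FI_gen M X R m \<otimes>\<^bsub>?I\<^esub> y)"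
        using Q.plus_projection Q.mult_closed g(1)[OF gen(1)] Q.projectionsD(1)[OF q(1)] by blast
    qed
  next
    case (inv m y)
    show ?case
    proof
      fix p assume p: "p \<in> projections ?Q"
      then obtain q where q: "q \<in> projections ?Q" "\<psi> q = y \<otimes>\<^bsub>?I\<^esub> \<psi> p \<otimes>\<^bsub>?I\<^esub> winv ?I y"
        using inv.IH by blast
      have "\<psi> ((q \<otimes>\<^bsub>?Q\<^esub> FR_gen M X R m)\<^sup>\<star>\<^bsub>?Q\<^esub>) =
          (winv ?I (FI_gen M X R m) \<otimes>\<^bsub>?I\<^esub> y) \<otimes>\<^bsub>?I\<^esub> \<psi> p \<otimes>\<^bsub>?I\<^esub> winv ?I (winv ?I (FI_gen M X R m) \<otimes>\<^bsub>?I\<^esub> y)"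
        unfolding conj(2)[OF q(1) g(1)[OF inv(1)]] \<psi>g[OF inv(1)] q(2)
        using g(2)[OF inv(1)] inv(2) psi_proj[OF p] by (simp add: I.winv_mult I.winv_winv I.m_assoc)
      then show "\<exists>q\<in>projections ?Q. \<psi> q =
          (winv ?I (FI_gen M X R m) \<otimes>\<^bsub>?I\<^esub> y) \<otimes>\<^bsub>?I\<^esub> \<psi> p \<otimes>\<^bsub>?I\<^esub> winv ?I (winv ?I (FI_gen M X R m) \<otimes>\<^bsub>?I\<^esub> y)"
        using Q.star_projection Q.mult_closed g(1)[OF inv(1)] Q.projectionsD(1)[OF q(1)] by blast
    qed
  qed
  from bspec[OF this[OF e(1)] Q.one_projection] obtain q where
    q: "q \<in> projections ?Q" "\<psi> q = e \<otimes>\<^bsub>?I\<^esub> \<psi> \<one>\<^bsub>?Q\<^esub> \<otimes>\<^bsub>?I\<^esub> winv ?I e" by blast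
  have "\<psi> q = e" using q(2) \<psi>'(3) e I.idem_winv by simp
  with q(1) show thesis by (rule that)
qed

section \<open>From injectivity to an embedding into a group\<close>

definition reduced_restriction :: "('a, 'c) monoid_scheme \<Rightarrow> 'a restriction" where
  "reduced_restriction M = \<lparr>carrier = carrier M, mult = mult M, one = \<one>\<^bsub>M\<^esub>,
     rstar = \<lambda>_. \<one>\<^bsub>M\<^esub>, rplus = \<lambda>_. \<one>\<^bsub>M\<^esub>\<rparr>"

text \<open>With star and plus constantly 1, every law becomes a monoid law. The unit is the only
  projection, so morphisms into this monoid send all projections to 1.\<close>

lemma reduced_restriction_monoid:
  assumes "monoid M"
  shows "restriction_monoid (reduced_restriction M)"
proof -
  interpret monoid M by fact
  show ?thesis by unfold_locales (simp_all add: reduced_restriction_def m_assoc)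
qed

lemma inj_imp_embeds_into_group:
  assumes M: "monoid M" and R: "\<forall>e\<in>R. admissible X e"
    and \<psi>: "\<psi> \<in> restriction_hom (FR M X R) (inverse_restriction (FI M X R))"
    and \<psi>g: "\<And>m. m \<in> carrier M \<Longrightarrow> \<psi> (FR_gen M X R m) = FI_gen M X R m"
    and inj: "inj_on \<psi> (carrier (FR M X R))"
  shows "embeds_into_group M"
proof -
  let ?Q = "FR M X R" and ?I = "FI M X R" and ?g = "FR_gen M X R"
  let ?E = "monoid_cong ?I (idempotent_relation ?I)"
  let ?G = "quot_monoid ?I ?E"
  have R': "\<forall>e\<in>R. is_identity X e" using R by (auto simp: admissible_def)
  interpret M: monoid M by fact
  interpret Q: restriction_monoid ?Q by (rule FR_restriction_monoid)
  interpret I: inverse_monoid ?I by (rule FI_inverse_monoid)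
  interpret q: monoid_quotient ?I "idempotent_relation ?I" ?E ?G
    by (simp_all add: monoid_quotient_def I.monoid_axioms)
  interpret G: group ?G by (rule I.group_quotient)
  note \<psi>' = restriction_homD[OF \<psi>, simplified]
  have g: "?g m \<in> carrier ?Q" "\<psi> (?g m) \<in> carrier ?I" if "m \<in> carrier M" for m
    using that by (simp_all add: FR_gen_closed \<psi>'(1))
  define h where "h = (\<lambda>m. ?E `` {\<psi> (?g m)})"
  have hc: "h m \<in> carrier ?G" if "m \<in> carrier M" for m
    using g[OF that] by (simp add: h_def)
  have "h (m \<otimes>\<^bsub>M\<^esub> n) = h m \<otimes>\<^bsub>?G\<^esub> h n" if m: "m \<in> carrier M" and n: "n \<in> carrier M" for m n
  proof -
    note gm = g[OF m] and gn = g[OF n] and gmn = g[OF M.m_closed[OF m n]]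
    \<comment> \<open>The product of two generators differs from the generator of the product only
      by the projection \<open>s\<close>. Its image is idempotent and becomes 1 in the group, which
      makes \<open>h\<close> multiplicative.\<close>
    define s where "s = (?g m \<otimes>\<^bsub>?Q\<^esub> ?g n)\<^sup>\<star>\<^bsub>?Q\<^esub>"
    have s: "s \<in> projections ?Q" using gm gn by (simp add: s_def)
    note sc = Q.projectionsD(1)[OF s]
    have "\<psi> s \<otimes>\<^bsub>?I\<^esub> \<psi> s = \<psi> s" using \<psi>'(2)[of s s] Q.proj_idem[OF s] sc by simp
    then have "(\<psi> s, \<one>\<^bsub>?I\<^esub>) \<in> ?E"
      using \<psi>'(1)[OF sc] by (intro monoid_cong.base) (auto simp: idempotent_relation_def)
    then have s1: "?E `` {\<psi> s} = \<one>\<^bsub>?G\<^esub>" using q.class_eq by simp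
    have "\<psi> (?g m) \<otimes>\<^bsub>?I\<^esub> \<psi> (?g n) = \<psi> (?g (m \<otimes>\<^bsub>M\<^esub> n)) \<otimes>\<^bsub>?I\<^esub> \<psi> s"
      using arg_cong[OF FR_gen_mult[OF M R' m n], of \<psi>] \<psi>'(2) gm gn gmn sc
      unfolding s_def[symmetric] by simp
    then have "h m \<otimes>\<^bsub>?G\<^esub> h n = h (m \<otimes>\<^bsub>M\<^esub> n) \<otimes>\<^bsub>?G\<^esub> (?E `` {\<psi> s})"
      using gm gn gmn \<psi>'(1)[OF sc] by (simp add: h_def)
    then show ?thesis unfolding s1 using hc[OF M.m_closed[OF m n]] G.r_one by metis
  qed
  moreover have "h \<one>\<^bsub>M\<^esub> = \<one>\<^bsub>?G\<^esub>" using FR_gen_one[OF M R'] \<psi>'(3) by (simp add: h_def)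
  ultimately have hom: "h \<in> monoid_hom M ?G" using hc by (simp add: monoid_hom_def hom_def)
  \<comment> \<open>Extending the identity of \<open>M\<close> gives a morphism that reads
    \<open>m\<close> off its generator and forgets projections.\<close>
  have id: "(\<lambda>m. m) \<in> monoid_hom M (reduced_restriction M)"
    by (simp add: monoid_hom_def hom_def reduced_restriction_def)
  obtain k where k: "k \<in> restriction_hom ?Q (reduced_restriction M)"
    "\<And>m. m \<in> carrier M \<Longrightarrow> k (?g m) = m"
    using FR_lift[OF M R reduced_restriction_monoid[OF M] id] by metis
  note k' = restriction_homD[OF k(1)]
  have "inj_on h (carrier M)"
  proof (rule inj_onI)
    fix m n assume m: "m \<in> carrier M" and n: "n \<in> carrier M" and "h m = h n"
    then have "(\<psi> (?g m), \<psi> (?g n)) \<in> ?E"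
      using eq_equiv_class[OF _ q.equiv_E] g(2)[OF n] unfolding h_def by blast
    then obtain e where e: "e \<in> carrier ?I" "e \<otimes>\<^bsub>?I\<^esub> e = e"
      "\<psi> (?g m) \<otimes>\<^bsub>?I\<^esub> e = \<psi> (?g n) \<otimes>\<^bsub>?I\<^esub> e"
      using I.idempotent_cong_imp by blast
    \<comment> \<open>With \<open>e\<close> written as the image of a projection, the equation lies
      between values of \<open>\<psi>\<close>, and injectivity brings it back to
      \<open>FR M X R\<close>, where \<open>k\<close> removes \<open>p\<close>.\<close>
    obtain p where p: "p \<in> projections ?Q" "\<psi> p = e" by (rule FI_idempotent_image[OF \<psi> \<psi>g e(1,2)])
    note pc = Q.projectionsD(1,2)[OF p(1)]
    have "\<psi> (?g m \<otimes>\<^bsub>?Q\<^esub> p) = \<psi> (?g n \<otimes>\<^bsub>?Q\<^esub> p)"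
      using e(3) \<psi>'(2)[OF g(1)[OF m] pc(1)] \<psi>'(2)[OF g(1)[OF n] pc(1)] p(2) by simp
    then have "?g m \<otimes>\<^bsub>?Q\<^esub> p = ?g n \<otimes>\<^bsub>?Q\<^esub> p"
      using inj g(1)[OF m] g(1)[OF n] pc(1) by (auto dest: inj_onD)
    then have "k (?g m) \<otimes>\<^bsub>M\<^esub> k p = k (?g n) \<otimes>\<^bsub>M\<^esub> k p"
      using k'(2)[OF g(1)[OF m] pc(1)] k'(2)[OF g(1)[OF n] pc(1)] by (simp add: reduced_restriction_def)
    moreover have "k p = \<one>\<^bsub>M\<^esub>" using k'(4)[OF pc(1)] pc(2) by (simp add: reduced_restriction_def)
    ultimately show "m = n" using k(2) m n by simp
  qed
  then show ?thesis by (rule embeds_into_groupI[OF G.group_axioms hom])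
qed

section \<open>From an embedding into a group to injectivity\<close>

lemma embeds_into_group_imp_inj:
  assumes M: "monoid M" and R: "\<forall>e\<in>R. admissible X e"
    and \<psi>: "\<psi> \<in> restriction_hom (FR M X R) (inverse_restriction (FI M X R))"
    and \<psi>g: "\<And>m. m \<in> carrier M \<Longrightarrow> \<psi> (FR_gen M X R m) = FI_gen M X R m"
    and emb: "embeds_into_group M"
  shows "inj_on \<psi> (carrier (FR M X R))"
proof (rule inj_onI)
  let ?Q = "FR M X R" and ?g = "FR_gen M X R"
  have R': "\<forall>e\<in>R. is_identity X e" using R by (auto simp: admissible_def)
  interpret Q: restriction_monoid ?Q by (rule FR_restriction_monoid)
  obtain G :: "('a \<times> bool) list set monoid" and h
    where G: "group G" and h: "h \<in> monoid_hom M G" "inj_on h (carrier M)"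
    using emb unfolding embeds_into_group_def by blast
  interpret G: group G by fact
  have h': "h \<in> monoid_hom M (inverse_restriction G)" using h(1) by (simp add: monoid_hom_def hom_def)
  obtain k where k: "k \<in> restriction_hom ?Q (inverse_restriction G)"
    "\<And>m. m \<in> carrier M \<Longrightarrow> k (?g m) = h m"
    using FR_lift[OF M R inverse_monoid.restriction_monoid[OF G.inverse_monoid] h'] by metis
  \<comment> \<open>Two invariants are recovered from \<open>\<psi> a\<close>: its value in the
    group through \<open>\<theta>\<close>, and its Munn partial bijection through
    \<open>\<mu>\<close>.\<close>
  obtain \<theta> where \<theta>: "\<And>a. a \<in> carrier ?Q \<Longrightarrow> \<theta> (\<psi> a) = k a"
    using FI_factor[OF M R' G.inverse_monoid k(1) \<psi> \<psi>g] by metis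
  obtain \<mu> where \<mu>: "\<And>a. a \<in> carrier ?Q \<Longrightarrow> \<mu> (\<psi> a) = munn ?Q a"
    using FI_factor[OF M R' symmetric_inverse_monoid Q.munn_hom \<psi> \<psi>g] by metis
  note k' = restriction_homD[OF k(1), simplified]
  \<comment> \<open>In a group the star is constantly 1, and a projection is its own star.\<close>
  have k_proj: "k e = \<one>\<^bsub>G\<^esub>" if e: "e \<in> projections ?Q" for e
    using k'(1)[OF Q.projectionsD(1)[OF e]] k'(4)[OF Q.projectionsD(1)[OF e]]
      Q.projectionsD(2)[OF e] by (simp add: G.winv_eq_inv)
  have k_decomp: "k (e \<otimes>\<^bsub>?Q\<^esub> ?g m) = h m" if "e \<in> projections ?Q" "m \<in> carrier M" for e m
    using k'(2)[OF Q.projectionsD(1)[OF that(1)] FR_gen_closed[OF that(2)]] k_proj[OF that(1)]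
      k(2)[OF that(2)] k'(1)[OF FR_gen_closed[OF that(2), of X R]] by simp
  \<comment> \<open>The projection of a decomposition is not unique, but it can be replaced by the
    plus of the element. So the element is determined by its plus and by \<open>m\<close>.\<close>
  have plus_decomp: "(e \<otimes>\<^bsub>?Q\<^esub> ?g m)\<^sup>\<oplus>\<^bsub>?Q\<^esub> \<otimes>\<^bsub>?Q\<^esub> ?g m = e \<otimes>\<^bsub>?Q\<^esub> ?g m"
    if e: "e \<in> projections ?Q" and m: "m \<in> carrier M" for e m
  proof -
    note ec = Q.projectionsD(1,3)[OF e] and g = FR_gen_closed[OF m, of X R]
    have "(e \<otimes>\<^bsub>?Q\<^esub> ?g m)\<^sup>\<oplus>\<^bsub>?Q\<^esub> = e \<otimes>\<^bsub>?Q\<^esub> (?g m)\<^sup>\<oplus>\<^bsub>?Q\<^esub>"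
      using Q.plus_mult_plus[OF ec(1) g] unfolding ec(2) .
    then show ?thesis using ec(1) g Q.plus_mult_self[OF g] by (simp add: Q.m_assoc)
  qed
  fix a b assume a: "a \<in> carrier ?Q" and b: "b \<in> carrier ?Q" and eq: "\<psi> a = \<psi> b"
  obtain e m where e: "e \<in> projections ?Q" "m \<in> carrier M" "a = e \<otimes>\<^bsub>?Q\<^esub> ?g m"
    using a by (rule FR_decomposition[OF M R'])
  obtain f n where f: "f \<in> projections ?Q" "n \<in> carrier M" "b = f \<otimes>\<^bsub>?Q\<^esub> ?g n"
    using b by (rule FR_decomposition[OF M R'])
  have "k a = k b" using \<theta>[OF a] \<theta>[OF b] eq by simp
  then have "h m = h n" using k_decomp[OF e(1,2)] k_decomp[OF f(1,2)] unfolding e(3) f(3) by simp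
  then have mn: "m = n" using h(2) e(2) f(2) by (auto dest: inj_onD)
  \<comment> \<open>The Munn representation is applied only to the pluses, which are projections,
    where \<open>munn_inj\<close> makes it faithful.\<close>
  have "\<psi> (a\<^sup>\<oplus>\<^bsub>?Q\<^esub>) = \<psi> (b\<^sup>\<oplus>\<^bsub>?Q\<^esub>)"
    using restriction_homD(5)[OF \<psi> a] restriction_homD(5)[OF \<psi> b] eq by simp
  then have "munn ?Q (a\<^sup>\<oplus>\<^bsub>?Q\<^esub>) = munn ?Q (b\<^sup>\<oplus>\<^bsub>?Q\<^esub>)"
    using \<mu>[OF Q.plus_closed[OF a]] \<mu>[OF Q.plus_closed[OF b]] by simp
  then have "a\<^sup>\<oplus>\<^bsub>?Q\<^esub> = b\<^sup>\<oplus>\<^bsub>?Q\<^esub>"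
    using Q.munn_inj a b by (auto dest: inj_onD)
  then have "a\<^sup>\<oplus>\<^bsub>?Q\<^esub> \<otimes>\<^bsub>?Q\<^esub> ?g m = b\<^sup>\<oplus>\<^bsub>?Q\<^esub> \<otimes>\<^bsub>?Q\<^esub> ?g n" unfolding mn by simp
  then show "a = b"
    unfolding plus_decomp[OF e(1,2), folded e(3)] plus_decomp[OF f(1,2), folded f(3)] .
qed

theorem proposition8p2:
  fixes M :: "('m, 'c) monoid_scheme"
    and X :: "'x set"
    and R :: "('x list rterm set \<times> 'x list rterm set) set"
    and \<psi> :: "'m rterm set set \<Rightarrow> ('m \<times> bool) list set set"
  assumes "monoid M"
    and "\<forall>e\<in>R. admissible X e"
    and "\<psi> \<in> restriction_hom (FR M X R) (inverse_restriction (FI M X R))"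
    and "\<forall>m\<in>carrier M. \<psi> (FR_gen M X R m) = FI_gen M X R m"
  shows "embeds_into_group M \<longleftrightarrow> inj_on \<psi> (carrier (FR M X R))"
  using embeds_into_group_imp_inj[OF assms(1-3)] inj_imp_embeds_into_group[OF assms(1-3)] assms(4)
  by blast

end
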